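(* Let $s>0$. Among all measurable sets $\Omega\subset\mathbb{R}$ of Lebesgue measure $s$, there exist sets maximizing the first eigenvalue $\lambda_1(L_\Omega)$. Moreover, any such maximizing set is, up to sets of measure zero, a finite union of intervals.
   Context: The Paley--Wiener space is $PW=\{f\in L^2(\mathbb{R}):\operatorname{supp}\widehat f\subseteq[-\pi,\pi]\}$, a closed subspace of $L^2(\mathbb{R})$ with the inherited norm, where $\widehat f(\xi)=\frac{1}{\sqrt{2\pi}}\int_{\mathbb{R}}f(t)e^{-i\xi t}\,dt$. For a measurable set $\Omega\subset\mathbb{R}$ of finite measure, the (time-frequency) localization operator $L_\Omega:PW\to PW$ is the compact nonnegative operator determined by $\langle L_\Omega f,g\rangle=\int_\Omega f(x)\overline{g(x)}\,dx$ for $f,g\in PW$. Its first (largest) eigenvalue is $\lambda_1(L_\Omega)=\sup\{\int_\Omega|f(x)|^2\,dx: f\in PW,\ \|f\|_2=1\}$. *)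

theory Defs
  imports "HOL-Analysis.Analysis"
begin

text \<open>Elements of \<open>L\<^sup>2(\<real>)\<close> are represented by functions, so equality in \<open>L\<^sup>2\<close> is equality
  almost everywhere.\<close>

definition square_integrable :: "(real \<Rightarrow> complex) set" where
  "square_integrable =
     {f \<in> borel_measurable lebesgue. integrable lebesgue (\<lambda>x. (norm (f x))\<^sup>2)}"

definition L2_inner :: "(real \<Rightarrow> complex) \<Rightarrow> (real \<Rightarrow> complex) \<Rightarrow> complex" where
  "L2_inner f g = (LINT x|lebesgue. f x * cnj (g x))"

text \<open>The Fourier integral; meaningful for integrable functions only.\<close>

definition fourier_integral :: "(real \<Rightarrow> complex) \<Rightarrow> real \<Rightarrow> complex" where
  "fourier_integral f \<xi> =
     of_real (1 / sqrt (2 * pi)) * (LINT t|lebesgue. f t * exp (- \<i> * of_real (\<xi> * t)))"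

text \<open>The Fourier--Plancherel transform of \<open>f \<in> L\<^sup>2\<close>, unique up to null sets: the
  \<open>L\<^sup>2\<close>-limit of the Fourier integrals of the truncations of \<open>f\<close> to \<open>[-n, n]\<close>, which are
  integrable.  The nonnegative integral avoids the convention that a divergent Bochner
  integral is 0.\<close>

definition has_fourier_transform :: "(real \<Rightarrow> complex) \<Rightarrow> (real \<Rightarrow> complex) \<Rightarrow> bool" where
  "has_fourier_transform f g \<longleftrightarrow>
     f \<in> square_integrable \<and> g \<in> square_integrable \<and>
     (\<lambda>n::nat. \<integral>\<^sup>+ \<xi>. ennreal ((norm (g \<xi> -
          fourier_integral (\<lambda>t. indicator {- real n..real n} t * f t) \<xi>))\<^sup>2) \<partial>lebesgue)
       \<longlonglongrightarrow> 0"

text \<open>The (essential) support of an \<open>L\<^sup>2\<close> function lies in the closed set \<open>[-\<pi>, \<pi>]\<close> iff the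
  function vanishes almost everywhere outside of it.\<close>

definition paley_wiener :: "(real \<Rightarrow> complex) set" where
  "paley_wiener =
     {f \<in> square_integrable. \<exists>g. has_fourier_transform f g \<and>
        (AE \<xi> in lebesgue. \<xi> \<notin> {-pi..pi} \<longrightarrow> g \<xi> = 0)}"

text \<open>The graph of the localization operator: \<open>h\<close> represents \<open>L\<^sub>\<Omega> f\<close>.  A relation is used because
  \<open>h\<close> is determined only up to null sets.\<close>

definition localization :: "real set \<Rightarrow> (real \<Rightarrow> complex) \<Rightarrow> (real \<Rightarrow> complex) \<Rightarrow> bool" where
  "localization \<Omega> f h \<longleftrightarrow>
     f \<in> paley_wiener \<and> h \<in> paley_wiener \<and>
     (\<forall>g\<in>paley_wiener. L2_inner h g = (LINT x:\<Omega>|lebesgue. f x * cnj (g x)))"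

text \<open>Only real eigenvalues are considered: the operator is self-adjoint.\<close>

definition localization_eigenvalue :: "real set \<Rightarrow> real \<Rightarrow> bool" where
  "localization_eigenvalue \<Omega> \<mu> \<longleftrightarrow>
     (\<exists>f. \<not> (AE x in lebesgue. f x = 0) \<and> localization \<Omega> f (\<lambda>x. of_real \<mu> * f x))"

text \<open>The operator is compact and nonnegative on an infinite-dimensional space, so for \<open>\<Omega>\<close> of
  finite measure the largest eigenvalue exists.\<close>

definition first_eigenvalue :: "real set \<Rightarrow> real" where
  "first_eigenvalue \<Omega> = (GREATEST \<mu>. localization_eigenvalue \<Omega> \<mu>)"

definition maximizes_first_eigenvalue :: "real \<Rightarrow> real set \<Rightarrow> bool" where
  "maximizes_first_eigenvalue s \<Omega> \<longleftrightarrow>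
     \<Omega> \<in> lmeasurable \<and> measure lebesgue \<Omega> = s \<and>
     (\<forall>\<Omega>'\<in>lmeasurable. measure lebesgue \<Omega>' = s \<longrightarrow> first_eigenvalue \<Omega>' \<le> first_eigenvalue \<Omega>)"

end

theory Submission
  imports Defs "HOL-Probability.Probability" "HOL-Complex_Analysis.Complex_Analysis"
begin

text \<open>Fix \<open>\<Omega>\<close> and let \<open>F\<close> range over the Paley--Wiener space. By Plancherel, bounded sequences in
  this space have subsequences converging locally uniformly (Montel), so the Rayleigh quotient
  \<open>\<integral>\<^sub>\<Omega> |F|\<^sup>2 / \<parallel>F\<parallel>\<^sup>2\<close> attains its supremum, which is the largest eigenvalue. For a fixed \<open>F\<close> the
  bathtub principle says that among all sets of measure \<open>s\<close> the energy \<open>\<integral>\<^sub>\<Omega> |F|\<^sup>2\<close> is maximal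
  exactly for a superlevel set of \<open>|F|\<^sup>2\<close>. As \<open>F\<close> is entire and vanishes at infinity on the real
  line, the level sets are finite, so the superlevel sets are finite unions of intervals. Hence a
  maximizing \<open>\<Omega>\<close> agrees almost everywhere with a superlevel set of its own first eigenfunction.

  For existence, take eigenfunctions of a maximizing sequence of sets. Their sup norms are bounded
  below because the sets have measure \<open>s\<close>, so after translation the eigenfunctions converge weakly to
  some \<open>G \<noteq> 0\<close>. The norm and the energy split asymptotically between \<open>G\<close> and the remainder, and the
  remainder has Rayleigh quotient at most the supremum; so \<open>G\<close> has at least the supremum on a
  superlevel set of measure \<open>s\<close>.

  Plancherel for functions of bounded support is obtained by Gauss summation for continuous
  functions, and by averaging over short intervals and Fatou's lemma in general.\<close>

subsection \<open>Square-integrable functions on a measure space\<close>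

text \<open>Translation preserves the Paley--Wiener space and the measure of sets, so a maximizing
  sequence may drift off or break into distant pieces. The sets themselves are never taken to a
  limit: only eigenfunctions converge, and the candidate set is built afresh from their limit G.
  Norm lost in the limit does no harm, since the bound by the supremum \<Lambda> applies to the lost
  piece too; subtracting its share leaves \<Lambda> times the squared norm of G at most the energy
  of G. This works for varying sets because the cross terms are bounded by the integral of |R| |G|,
  in which the set does not occur. A level with superlevel set of measure exactly s exists because
  level sets are null, which makes the measure continuous in the level, and because zero sets are
  null, which makes it exceed s at low levels. Two definitions shape the rest. The eigenvalue is the
  \<open>GREATEST\<close> solution of an eigenvalue equation, so the maximizer has to be shown to
  solve that equation, by a first variation. The transform is an L2 limit, so membership in the
  space is rephrased as orthogonality to inverse transforms of test functions living off the
  band.\<close>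

definition L2 :: "'a measure \<Rightarrow> ('a \<Rightarrow> complex) set" where
  "L2 M = {f \<in> borel_measurable M. integrable M (\<lambda>x. (cmod (f x))\<^sup>2)}"

text \<open>The squared norm: without the root, the parallelogram law and the expansion of a sum are
  polynomial identities.\<close>

definition norm2 :: "'a measure \<Rightarrow> ('a \<Rightarrow> complex) \<Rightarrow> real" where
  "norm2 M f = (\<integral>x. (cmod (f x))\<^sup>2 \<partial>M)"

definition inner2 :: "'a measure \<Rightarrow> ('a \<Rightarrow> complex) \<Rightarrow> ('a \<Rightarrow> complex) \<Rightarrow> complex" where
  "inner2 M f g = (\<integral>x. f x * cnj (g x) \<partial>M)"

lemma borel_measurable_cnj [measurable (raw)]:
  "f \<in> borel_measurable M \<Longrightarrow> (\<lambda>x. cnj (f x)) \<in> borel_measurable M"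
  by (rule borel_measurable_continuous_on[OF continuous_on_cnj[OF continuous_on_id]])

lemma L2_measurable [measurable_dest]: "f \<in> L2 M \<Longrightarrow> f \<in> borel_measurable M"
  by (simp add: L2_def)

lemma L2_integrable: "f \<in> L2 M \<Longrightarrow> integrable M (\<lambda>x. (cmod (f x))\<^sup>2)"
  by (simp add: L2_def)

lemma norm2_nonneg: "0 \<le> norm2 M f"
  by (simp add: norm2_def)

lemma L2_nn_integral: "f \<in> L2 M \<Longrightarrow> (\<integral>\<^sup>+x. ennreal ((cmod (f x))\<^sup>2) \<partial>M) = ennreal (norm2 M f)"
  unfolding norm2_def by (rule nn_integral_eq_integral) (auto simp: L2_integrable)

lemma L2_I_nn:
  assumes "f \<in> borel_measurable M" "(\<integral>\<^sup>+x. ennreal ((cmod (f x))\<^sup>2) \<partial>M) \<le> ennreal c"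
  shows "f \<in> L2 M"
proof -
  have "(\<integral>\<^sup>+x. ennreal ((cmod (f x))\<^sup>2) \<partial>M) < \<infinity>"
    using assms(2) by (rule order.strict_trans1) simp
  then show ?thesis
    using assms(1) unfolding L2_def by (auto simp: integrable_iff_bounded)
qed

lemma norm2_le_nn:
  assumes "f \<in> L2 M" "(\<integral>\<^sup>+x. ennreal ((cmod (f x))\<^sup>2) \<partial>M) \<le> ennreal c" "0 \<le> c"
  shows "norm2 M f \<le> c"
  using assms by (simp add: L2_nn_integral)

lemma norm2_eq_nn:
  assumes "f \<in> borel_measurable M" "(\<integral>\<^sup>+x. ennreal ((cmod (f x))\<^sup>2) \<partial>M) = ennreal c" "0 \<le> c"
  shows "norm2 M f = c"
  unfolding norm2_def using assms by (subst integral_eq_nn_integral) auto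

lemma L2_dominated:
  assumes "f \<in> L2 M" "g \<in> borel_measurable M" "AE x in M. cmod (g x) \<le> cmod (f x)"
  shows "g \<in> L2 M"
proof -
  note [measurable] = L2_measurable[OF assms(1)] assms(2)
  have "integrable M (\<lambda>x. (cmod (g x))\<^sup>2)"
    by (rule Bochner_Integration.integrable_bound[OF L2_integrable[OF assms(1)]])
       (use assms(3) in \<open>auto intro!: power_mono\<close>)
  then show ?thesis using assms by (simp add: L2_def)
qed

lemma norm2_mono:
  assumes "f \<in> L2 M" "g \<in> L2 M" "AE x in M. cmod (g x) \<le> cmod (f x)"
  shows "norm2 M g \<le> norm2 M f"
  unfolding norm2_def
  by (rule integral_mono_AE[OF L2_integrable[OF assms(2)] L2_integrable[OF assms(1)]])
     (use assms(3) in \<open>auto intro!: power_mono\<close>)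

lemma L2_cong_AE:
  assumes "f \<in> L2 M" "g \<in> borel_measurable M" "AE x in M. f x = g x"
  shows "g \<in> L2 M"
  using assms by (intro L2_dominated[OF assms(1,2)]) auto

lemma norm2_cong_AE:
  assumes "f \<in> borel_measurable M" "g \<in> borel_measurable M" "AE x in M. f x = g x"
  shows "norm2 M f = norm2 M g"
  unfolding norm2_def by (rule integral_cong_AE) (use assms in auto)

lemma inner2_cong_AE:
  assumes "f \<in> borel_measurable M" "g \<in> borel_measurable M" "AE x in M. f x = g x"
    "f' \<in> borel_measurable M" "g' \<in> borel_measurable M" "AE x in M. f' x = g' x"
  shows "inner2 M f f' = inner2 M g g'"
  unfolding inner2_def by (rule integral_cong_AE) (use assms in auto)

lemma L2_mult:
  assumes "f \<in> L2 M" "g \<in> L2 M"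
  shows "integrable M (\<lambda>x. f x * g x)"
proof (rule Bochner_Integration.integrable_bound)
  show "integrable M (\<lambda>x. (cmod (f x))\<^sup>2 + (cmod (g x))\<^sup>2)"
    using assms by (auto simp: L2_integrable)
  show "(\<lambda>x. f x * g x) \<in> borel_measurable M" using assms by measurable
  have "a * b \<le> a\<^sup>2 + b\<^sup>2" if "a \<ge> 0" "b \<ge> 0" for a b :: real
    using sum_squares_bound[of a b] mult_nonneg_nonneg[OF that] by linarith
  then show "AE x in M. cmod (f x * g x) \<le> norm ((cmod (f x))\<^sup>2 + (cmod (g x))\<^sup>2)"
    by (auto simp: norm_mult)
qed

lemma L2_cnj: "f \<in> L2 M \<Longrightarrow> (\<lambda>x. cnj (f x)) \<in> L2 M"
  by (auto simp: L2_def)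

lemma L2_mult_cnj: "f \<in> L2 M \<Longrightarrow> g \<in> L2 M \<Longrightarrow> integrable M (\<lambda>x. f x * cnj (g x))"
  using L2_mult[OF _ L2_cnj] by blast

lemma L2_scale: "f \<in> L2 M \<Longrightarrow> (\<lambda>x. c * f x) \<in> L2 M"
  by (auto simp: L2_def norm_mult power_mult_distrib)

lemma cmod_add_sq: "(cmod (a + b))\<^sup>2 = (cmod a)\<^sup>2 + (cmod b)\<^sup>2 + 2 * Re (a * cnj b)"
  unfolding cmod_power2 by (simp add: power2_eq_square algebra_simps)

lemma L2_add:
  assumes "f \<in> L2 M" "g \<in> L2 M"
  shows "(\<lambda>x. f x + g x) \<in> L2 M"
proof -
  have "integrable M (\<lambda>x. (cmod (f x))\<^sup>2 + (cmod (g x))\<^sup>2 + 2 * Re (f x * cnj (g x)))"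
    using assms L2_mult_cnj[OF assms]
    by (intro Bochner_Integration.integrable_add Bochner_Integration.integrable_mult_right integrable_Re)
       (auto simp: L2_integrable)
  then show ?thesis using assms by (auto simp: L2_def cmod_add_sq)
qed

lemma L2_diff:
  assumes "f \<in> L2 M" "g \<in> L2 M"
  shows "(\<lambda>x. f x - g x) \<in> L2 M"
  using L2_add[OF assms(1) L2_scale[OF assms(2), of "-1"]] by simp

lemma L2_restrict:
  assumes "f \<in> L2 M" "A \<in> sets M"
  shows "(\<lambda>x. indicator A x * f x) \<in> L2 M"
  by (rule L2_dominated[OF assms(1)])
     (use assms in \<open>auto simp: norm_mult indicator_def\<close>)

lemma norm2_add:
  assumes "f \<in> L2 M" "g \<in> L2 M"
  shows "norm2 M (\<lambda>x. f x + g x) = norm2 M f + norm2 M g + 2 * Re (inner2 M f g)"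
proof -
  have "norm2 M (\<lambda>x. f x + g x) = (\<integral>x. (cmod (f x))\<^sup>2 + (cmod (g x))\<^sup>2 + 2 * Re (f x * cnj (g x)) \<partial>M)"
    unfolding norm2_def cmod_add_sq ..
  also have "\<dots> = norm2 M f + norm2 M g + (\<integral>x. 2 * Re (f x * cnj (g x)) \<partial>M)"
    unfolding norm2_def using assms L2_mult_cnj[OF assms]
    by (subst Bochner_Integration.integral_add)
       (auto simp: L2_integrable simp del: complex_cnj_mult Re_complex_of_real times_complex.sel)
  also have "(\<integral>x. 2 * Re (f x * cnj (g x)) \<partial>M) = 2 * Re (inner2 M f g)"
    unfolding inner2_def using L2_mult_cnj[OF assms] by (simp del: times_complex.sel)
  finally show ?thesis .
qed

lemma norm2_scale: "norm2 M (\<lambda>x. c * f x) = (cmod c)\<^sup>2 * norm2 M f"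
  unfolding norm2_def by (simp add: norm_mult power_mult_distrib)

lemma inner2_scale_left: "inner2 M (\<lambda>x. c * f x) g = c * inner2 M f g"
  unfolding inner2_def by (simp add: mult.assoc)

lemma inner2_scale_right: "inner2 M f (\<lambda>x. c * g x) = cnj c * inner2 M f g"
  unfolding inner2_def by (simp add: mult.left_commute)

lemma inner2_add_left:
  assumes "f \<in> L2 M" "g \<in> L2 M" "h \<in> L2 M"
  shows "inner2 M (\<lambda>x. f x + g x) h = inner2 M f h + inner2 M g h"
  unfolding inner2_def using L2_mult_cnj[OF assms(1,3)] L2_mult_cnj[OF assms(2,3)]
  by (simp add: distrib_right)

lemma inner2_diff_left:
  assumes "f \<in> L2 M" "g \<in> L2 M" "h \<in> L2 M"
  shows "inner2 M (\<lambda>x. f x - g x) h = inner2 M f h - inner2 M g h"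
  unfolding inner2_def using L2_mult_cnj[OF assms(1,3)] L2_mult_cnj[OF assms(2,3)]
  by (simp add: left_diff_distrib)

lemma inner2_cnj: "cnj (inner2 M f g) = inner2 M g f"
  unfolding inner2_def by (subst Bochner_Integration.integral_cnj[symmetric]) (simp add: mult.commute)

lemma inner2_self: "inner2 M f f = of_real (norm2 M f)"
  unfolding inner2_def norm2_def
  by (subst integral_complex_of_real[symmetric]) (simp add: complex_norm_square[symmetric])

lemma norm2_diff:
  assumes "f \<in> L2 M" "g \<in> L2 M"
  shows "norm2 M (\<lambda>x. f x - g x) = norm2 M f + norm2 M g - 2 * Re (inner2 M f g)"
  using norm2_add[OF assms(1) L2_scale[OF assms(2), of "-1"]]
  using inner2_scale_right[of M f "-1" g] norm2_scale[of M "-1" g] by simp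

lemma norm2_eq_0_iff:
  assumes "f \<in> L2 M"
  shows "norm2 M f = 0 \<longleftrightarrow> (AE x in M. f x = 0)"
  unfolding norm2_def using integral_nonneg_eq_0_iff_AE[OF L2_integrable[OF assms]] by auto

text \<open>Absolute values stand inside the integral because this form also yields L1 bounds, as in
  \<open>L1_le_norm2_band\<close>.\<close>

lemma Cauchy_Schwarz_L2_norm:
  assumes "f \<in> L2 M" "g \<in> L2 M"
  shows "(\<integral>x. cmod (f x) * cmod (g x) \<partial>M)\<^sup>2 \<le> norm2 M f * norm2 M g"
proof -
  note [measurable] = L2_measurable[OF assms(1)] L2_measurable[OF assms(2)]
  have int: "integrable M (\<lambda>x. cmod (f x) * cmod (g x))"
    using integrable_norm[OF L2_mult[OF assms]] by (simp add: norm_mult)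
  have "ennreal ((\<integral>x. cmod (f x) * cmod (g x) \<partial>M)\<^sup>2) = (\<integral>\<^sup>+x. ennreal (cmod (f x) * cmod (g x)) \<partial>M)\<^sup>2"
    by (subst nn_integral_eq_integral[OF int]) (auto simp: ennreal_power)
  also have "\<dots> = (\<integral>\<^sup>+x. ennreal (cmod (f x)) * ennreal (cmod (g x)) \<partial>M)\<^sup>2"
    by (simp add: ennreal_mult)
  also have "\<dots> \<le> (\<integral>\<^sup>+x. (ennreal (cmod (f x)))\<^sup>2 \<partial>M) * (\<integral>\<^sup>+x. (ennreal (cmod (g x)))\<^sup>2 \<partial>M)"
    by (rule Cauchy_Schwarz_nn_integral) auto
  also have "\<dots> = ennreal (norm2 M f * norm2 M g)"
    using assms by (simp add: ennreal_power L2_nn_integral ennreal_mult norm2_nonneg)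
  finally show ?thesis
    by (simp add: ennreal_le_iff norm2_nonneg)
qed

lemma Cauchy_Schwarz_L2:
  assumes "f \<in> L2 M" "g \<in> L2 M"
  shows "(cmod (inner2 M f g))\<^sup>2 \<le> norm2 M f * norm2 M g"
proof -
  have "cmod (inner2 M f g) \<le> (\<integral>x. cmod (f x) * cmod (g x) \<partial>M)"
    unfolding inner2_def using integral_norm_bound[of M "\<lambda>x. f x * cnj (g x)"] by (simp add: norm_mult)
  then have "(cmod (inner2 M f g))\<^sup>2 \<le> (\<integral>x. cmod (f x) * cmod (g x) \<partial>M)\<^sup>2"
    by (rule power_mono) simp
  then show ?thesis using Cauchy_Schwarz_L2_norm[OF assms] by linarith
qed

section \<open>Convergence in L2: weak limits, Fatou's lemma and completeness\<close>

lemma inner2_tendsto_left: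
  assumes "\<And>n. f n \<in> L2 M" "g \<in> L2 M" "h \<in> L2 M"
    "(\<lambda>n. norm2 M (\<lambda>x. g x - f n x)) \<longlonglongrightarrow> 0"
  shows "(\<lambda>n. inner2 M (f n) h) \<longlonglongrightarrow> inner2 M g h"
proof -
  have "(\<lambda>n. (cmod (inner2 M g h - inner2 M (f n) h))\<^sup>2) \<longlonglongrightarrow> 0"
  proof (rule tendsto_sandwich[of "\<lambda>_. 0"])
    show "\<forall>\<^sub>F n in sequentially. (cmod (inner2 M g h - inner2 M (f n) h))\<^sup>2 \<le> norm2 M (\<lambda>x. g x - f n x) * norm2 M h"
      using Cauchy_Schwarz_L2[OF L2_diff[OF assms(2,1)] assms(3)] assms
      by (auto simp: inner2_diff_left)
    show "(\<lambda>n. norm2 M (\<lambda>x. g x - f n x) * norm2 M h) \<longlonglongrightarrow> 0"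
      using tendsto_mult_left_zero[OF assms(4)] .
  qed auto
  then have "(\<lambda>n. cmod (inner2 M g h - inner2 M (f n) h)) \<longlonglongrightarrow> 0"
    using tendsto_power_zero tendsto_real_sqrt[of _ 0] by fastforce
  then have "(\<lambda>n. inner2 M g h - inner2 M (f n) h) \<longlonglongrightarrow> 0"
    by (rule tendsto_norm_zero_cancel)
  from tendsto_diff[OF tendsto_const[of "inner2 M g h"] this] show ?thesis by simp
qed

text \<open>The bound is asked only eventually, since the completeness proof applies the lemma to
  tails of a Cauchy sequence.\<close>

lemma norm2_Fatou:
  assumes "\<And>n. f n \<in> L2 M" "g \<in> borel_measurable M" "AE x in M. (\<lambda>n. f n x) \<longlonglongrightarrow> g x"
    "\<forall>\<^sub>F n in sequentially. norm2 M (f n) \<le> c" "0 \<le> c"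
  shows "g \<in> L2 M" "norm2 M g \<le> c"
proof -
  note [measurable] = L2_measurable[OF assms(1)] assms(2)
  have "(\<integral>\<^sup>+x. ennreal ((cmod (g x))\<^sup>2) \<partial>M) = (\<integral>\<^sup>+x. liminf (\<lambda>n. ennreal ((cmod (f n x))\<^sup>2)) \<partial>M)"
  proof (rule nn_integral_cong_AE, use assms(3) in eventually_elim)
    fix x assume "(\<lambda>n. f n x) \<longlonglongrightarrow> g x"
    then have "(\<lambda>n. ennreal ((cmod (f n x))\<^sup>2)) \<longlonglongrightarrow> ennreal ((cmod (g x))\<^sup>2)"
      by (intro tendsto_ennrealI tendsto_intros)
    then show "ennreal ((cmod (g x))\<^sup>2) = liminf (\<lambda>n. ennreal ((cmod (f n x))\<^sup>2))"
      using lim_imp_Liminf[OF sequentially_bot] by metis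
  qed
  also have "\<dots> \<le> liminf (\<lambda>n. \<integral>\<^sup>+x. ennreal ((cmod (f n x))\<^sup>2) \<partial>M)"
    by (rule nn_integral_liminf) auto
  also have "\<dots> = liminf (\<lambda>n. ennreal (norm2 M (f n)))"
    by (simp add: L2_nn_integral[OF assms(1)])
  also have "\<dots> \<le> liminf (\<lambda>n. ennreal c)"
    by (rule Liminf_mono) (use assms(4) in \<open>auto elim!: eventually_mono simp: ennreal_leI\<close>)
  also have "\<dots> = ennreal c" by (simp add: Liminf_const)
  finally have *: "(\<integral>\<^sup>+x. ennreal ((cmod (g x))\<^sup>2) \<partial>M) \<le> ennreal c" .
  show "g \<in> L2 M" using L2_I_nn[OF assms(2) *] .
  from norm2_le_nn[OF this * assms(5)] show "norm2 M g \<le> c" .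
qed

text \<open>Young's inequality \<open>r h \<le> \<epsilon> r\<^sup>2 + h\<^sup>2 / (4 \<epsilon>)\<close> shows that the positive part of
  \<open>r h - \<epsilon> r\<^sup>2\<close> is dominated by \<open>h\<^sup>2 / (4 \<epsilon>)\<close>.\<close>

lemma L2_product_tendsto_0:
  assumes r: "\<And>n. r n \<in> L2 M" and h: "h \<in> L2 M" and lim: "AE x in M. (\<lambda>n. r n x) \<longlonglongrightarrow> 0"
    and bd: "\<And>n. norm2 M (r n) \<le> C"
  shows "(\<lambda>n. \<integral>x. cmod (r n x) * cmod (h x) \<partial>M) \<longlonglongrightarrow> 0"
proof (rule LIMSEQ_I)
  fix e :: real assume e: "e > 0"
  have C: "C \<ge> 0" using bd[of 0] norm2_nonneg[of M "r 0"] by linarith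
  \<comment> \<open>The term d times \<open>norm2 M (r n)\<close> may cost at most e/2; C + 1
    replaces C so that C = 0 is allowed.\<close>
  define d where "d = e / (2 * (C + 1))"
  have d: "d > 0" using e C by (simp add: d_def)
  note [measurable] = L2_measurable[OF r] L2_measurable[OF h]
  define p where "p n x = max 0 (cmod (r n x) * cmod (h x) - d * (cmod (r n x))\<^sup>2)" for n x
  have pm [measurable]: "p n \<in> borel_measurable M" for n unfolding p_def by measurable
  have young: "a * b - d * a\<^sup>2 \<le> b\<^sup>2 / (4 * d)" for a b :: real
  proof -
    have "0 \<le> (2 * d * a - b)\<^sup>2 / (4 * d)" using d by simp
    also have "\<dots> = d * a\<^sup>2 - a * b + b\<^sup>2 / (4 * d)"
      using d by (simp add: power2_eq_square field_simps)
    finally show ?thesis by linarith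
  qed
  have pb: "norm (p n x) \<le> (cmod (h x))\<^sup>2 / (4 * d)" for n x
    unfolding p_def using young[of "cmod (r n x)" "cmod (h x)"] d by auto
  have hi: "integrable M (\<lambda>x. (cmod (h x))\<^sup>2 / (4 * d))"
    using L2_integrable[OF h] by simp
  have pl: "AE x in M. (\<lambda>n. p n x) \<longlonglongrightarrow> 0"
    using lim
  proof eventually_elim
    fix x assume "(\<lambda>n. r n x) \<longlonglongrightarrow> 0"
    then have "(\<lambda>n. cmod (r n x)) \<longlonglongrightarrow> 0" by (rule tendsto_norm_zero)
    then have "(\<lambda>n. p n x) \<longlonglongrightarrow> max 0 (0 * cmod (h x) - d * 0\<^sup>2)"
      unfolding p_def by (intro tendsto_intros)
    then show "(\<lambda>n. p n x) \<longlonglongrightarrow> 0" by simp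
  qed
  have "(\<lambda>n. \<integral>x. p n x \<partial>M) \<longlonglongrightarrow> (\<integral>x. 0 \<partial>M)"
    by (rule integral_dominated_convergence[OF _ _ hi]) (use pl pb in auto)
  then have "(\<lambda>n. \<integral>x. p n x \<partial>M) \<longlonglongrightarrow> 0" by simp
  then obtain N where N: "\<And>n. n \<ge> N \<Longrightarrow> norm ((\<integral>x. p n x \<partial>M) - 0) < e / 2"
    using e LIMSEQ_D[of _ 0 "e/2"] by (metis half_gt_zero)
  have pi: "integrable M (p n)" for n
    by (rule Bochner_Integration.integrable_bound[OF hi])
       (use pb in \<open>auto intro!: AE_I2 intro: order.trans[OF _ abs_ge_self] simp del: abs_mult abs_divide\<close>)
  have "norm ((\<integral>x. cmod (r n x) * cmod (h x) \<partial>M) - 0) < e" if "n \<ge> N" for n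
  proof -
    have int: "integrable M (\<lambda>x. cmod (r n x) * cmod (h x))"
      using integrable_norm[OF L2_mult[OF r h]] by (simp add: norm_mult)
    have "(\<integral>x. cmod (r n x) * cmod (h x) \<partial>M) \<le> (\<integral>x. p n x + d * (cmod (r n x))\<^sup>2 \<partial>M)"
      by (rule integral_mono[OF int Bochner_Integration.integrable_add[OF pi integrable_mult_right[OF L2_integrable[OF r]]]])
         (auto simp: p_def)
    also have "\<dots> = (\<integral>x. p n x \<partial>M) + d * norm2 M (r n)"
      using pi L2_integrable[OF r] by (simp add: norm2_def)
    also have "\<dots> < e / 2 + d * (C + 1)"
      using N[OF that] bd[of n] d by (intro add_less_le_mono mult_left_mono) auto
    also have "\<dots> = e" using C by (simp add: d_def field_simps)
    finally show ?thesis by simp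
  qed
  then show "\<exists>no. \<forall>n\<ge>no. norm ((\<integral>x. cmod (r n x) * cmod (h x) \<partial>M) - 0) < e" by blast
qed

text \<open>Fatou puts the pointwise limit into L2, so the differences are bounded in L2 and tend to
  0 almost everywhere; \<open>L2_product_tendsto_0\<close> then disposes of their inner products
  with h.\<close>

lemma inner2_weak_tendsto:
  assumes f: "\<And>n. f n \<in> L2 M" and g: "g \<in> borel_measurable M" and h: "h \<in> L2 M"
    and lim: "AE x in M. (\<lambda>n. f n x) \<longlonglongrightarrow> g x" and bd: "\<And>n. norm2 M (f n) \<le> C"
  shows "(\<lambda>n. inner2 M (f n) h) \<longlonglongrightarrow> inner2 M g h"
proof -
  have C: "C \<ge> 0" using bd[of 0] norm2_nonneg[of M "f 0"] by linarith
  have g2: "g \<in> L2 M" and gC: "norm2 M g \<le> C"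
    using norm2_Fatou[OF f g lim _ C] bd by auto
  define r where "r n = (\<lambda>x. f n x - g x)" for n
  have r: "r n \<in> L2 M" for n unfolding r_def by (rule L2_diff[OF f g2])
  have "norm2 M (r n) \<le> 4 * C" for n
  proof -
    \<comment> \<open>Parallelogram law: the second summand is nonnegative, so the first is at most
      4C.\<close>
    have "norm2 M (r n) + norm2 M (\<lambda>x. f n x + g x) = 2 * norm2 M (f n) + 2 * norm2 M g"
      unfolding r_def norm2_diff[OF f g2] norm2_add[OF f g2] by simp
    then show ?thesis using bd[of n] gC norm2_nonneg[of M "\<lambda>x. f n x + g x"] by linarith
  qed
  moreover have "AE x in M. (\<lambda>n. r n x) \<longlonglongrightarrow> 0"
    using lim by eventually_elim (auto simp: r_def intro: LIM_zero)
  ultimately have *: "(\<lambda>n. \<integral>x. cmod (r n x) * cmod (h x) \<partial>M) \<longlonglongrightarrow> 0"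
    by (intro L2_product_tendsto_0[OF r h])
  have "cmod (inner2 M (f n) h - inner2 M g h) \<le> (\<integral>x. cmod (r n x) * cmod (h x) \<partial>M)" for n
  proof -
    have "inner2 M (f n) h - inner2 M g h = inner2 M (r n) h"
      unfolding r_def by (rule inner2_diff_left[OF f g2 h, symmetric])
    then show ?thesis
      unfolding inner2_def using integral_norm_bound[of M "\<lambda>x. r n x * cnj (h x)"] by (simp add: norm_mult)
  qed
  then show ?thesis
    by (intro LIM_zero_cancel[OF Lim_null_comparison[OF always_eventually *]]) auto
qed

text \<open>Riesz--Fischer: a fast subsequence converges almost everywhere, and Fatou applied to
  \<open>f (s j) - f n\<close> as j grows makes its limit the limit of the whole sequence.\<close>

lemma L2_complete:
  assumes f: "\<And>n. f n \<in> L2 M"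
    and cauchy: "\<And>e. e > 0 \<Longrightarrow> \<exists>N. \<forall>m\<ge>N. \<forall>n\<ge>N. norm2 M (\<lambda>x. f m x - f n x) < e"
  obtains g where "g \<in> L2 M" "(\<lambda>n. norm2 M (\<lambda>x. g x - f n x)) \<longlonglongrightarrow> 0"
proof -
  note [measurable] = L2_measurable[OF f]
  \<comment> \<open>Squared norms below 8^-k absorb the weight 4^k used below and still leave the
    summable 2^-k. The weight is what yields a geometric bound on |D k x| at almost every x.\<close>
  have "\<exists>N. \<forall>m\<ge>N. \<forall>n\<ge>N. norm2 M (\<lambda>x. f m x - f n x) < (1/8) ^ k" for k
    using cauchy[of "(1/8) ^ k"] by simp
  then obtain N where N: "\<And>k m n. m \<ge> N k \<Longrightarrow> n \<ge> N k \<Longrightarrow> norm2 M (\<lambda>x. f m x - f n x) < (1/8) ^ k"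
    by metis
  \<comment> \<open>Summing all earlier N i makes s monotone and at least N k; the summand k makes
    it unbounded.\<close>
  define s where "s k = (\<Sum>i\<le>k. N i) + k" for k
  have sN: "N k \<le> s k" for k unfolding s_def by (simp add: member_le_sum trans_le_add1)
  have smono: "s k \<le> s (Suc k)" for k unfolding s_def by simp
  have sk: "k \<le> s k" for k unfolding s_def by simp
  define D where "D k x = f (s (Suc k)) x - f (s k) x" for k x
  have DL: "D k \<in> L2 M" for k unfolding D_def by (rule L2_diff[OF f f])
  have Dn: "norm2 M (D k) \<le> (1/8) ^ k" for k
    unfolding D_def using N[of k "s (Suc k)" "s k"] sN[of k] smono[of k] by simp
  have "AE x in M. summable (\<lambda>k. 4 ^ k * (cmod (D k x))\<^sup>2)"
  proof -
    have [measurable]: "D k \<in> borel_measurable M" for k using DL by auto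
    have "(\<integral>\<^sup>+x. (\<Sum>k. ennreal (4 ^ k * (cmod (D k x))\<^sup>2)) \<partial>M) = (\<Sum>k. \<integral>\<^sup>+x. ennreal (4 ^ k * (cmod (D k x))\<^sup>2) \<partial>M)"
      by (rule nn_integral_suminf) auto
    also have "\<dots> = (\<Sum>k. ennreal (4 ^ k * norm2 M (D k)))"
      using DL by (simp add: ennreal_mult nn_integral_cmult L2_nn_integral norm2_nonneg)
    also have "\<dots> \<le> (\<Sum>k. ennreal ((1/2) ^ k))"
    proof (rule suminf_le)
      fix k
      have "4 ^ k * norm2 M (D k) \<le> 4 ^ k * (1/8) ^ k" using Dn by (intro mult_left_mono) auto
      also have "\<dots> = (1/2::real) ^ k" by (simp add: power_mult_distrib[symmetric])
      finally show "ennreal (4 ^ k * norm2 M (D k)) \<le> ennreal ((1/2) ^ k)" by (rule ennreal_leI)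
    qed auto
    also have "\<dots> = ennreal (\<Sum>k. (1/2) ^ k)"
      by (rule suminf_ennreal2) (auto intro: summable_geometric)
    also have "\<dots> < \<infinity>" by simp
    finally have "AE x in M. (\<Sum>k. ennreal (4 ^ k * (cmod (D k x))\<^sup>2)) \<noteq> \<infinity>"
      by (intro nn_integral_PInf_AE) auto
    then show ?thesis
      by eventually_elim (auto intro!: summable_suminf_not_top simp: top_ennreal_def)
  qed
  then have conv: "AE x in M. convergent (\<lambda>k. f (s k) x)"
  proof eventually_elim
    fix x assume "summable (\<lambda>k. 4 ^ k * (cmod (D k x))\<^sup>2)"
    then have "Bseq (\<lambda>k. 4 ^ k * (cmod (D k x))\<^sup>2)"
      using summable_LIMSEQ_zero by (intro convergent_imp_Bseq convergentI[of _ 0]) blast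
    then obtain K where K: "K > 0" "\<And>k. norm (4 ^ k * (cmod (D k x))\<^sup>2) \<le> K"
      by (auto elim: BseqE)
    have "cmod (D k x) \<le> sqrt K * (1/2) ^ k" for k
    proof -
      have "(2 ^ k * cmod (D k x))\<^sup>2 \<le> K"
        using K(2)[of k] power_mult_distrib[of "2::real" 2 k]
        by (simp add: power_mult_distrib power2_eq_square mult_ac)
      then have "2 ^ k * cmod (D k x) \<le> sqrt K" by (rule real_le_rsqrt)
      then show ?thesis by (simp add: field_simps power_divide)
    qed
    then have "summable (\<lambda>k. D k x)"
      by (intro summable_comparison_test'[OF summable_mult[OF summable_geometric]]) auto
    then have "convergent (\<lambda>n. \<Sum>k<n. D k x)" by (simp add: summable_iff_convergent)
    also have "(\<lambda>n. \<Sum>k<n. D k x) = (\<lambda>n. f (s n) x - f (s 0) x)"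
      unfolding D_def by (rule ext) (rule sum_lessThan_telescope)
    finally have "convergent (\<lambda>n. (f (s n) x - f (s 0) x) + f (s 0) x)"
      by (rule convergent_add) (rule convergent_const)
    then show "convergent (\<lambda>k. f (s k) x)" by simp
  qed
  define g where "g x = lim (\<lambda>k. f (s k) x)" for x
  have gm [measurable]: "g \<in> borel_measurable M" unfolding g_def by measurable
  have gl: "AE x in M. (\<lambda>k. f (s k) x) \<longlonglongrightarrow> g x"
    using conv by eventually_elim (auto simp: g_def convergent_LIMSEQ_iff)
  have key: "(\<lambda>x. g x - f n x) \<in> L2 M \<and> norm2 M (\<lambda>x. g x - f n x) \<le> (1/8) ^ k" if "n \<ge> N k" for n k
  proof -
    have 1: "AE x in M. (\<lambda>j. f (s j) x - f n x) \<longlonglongrightarrow> g x - f n x"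
      using gl by eventually_elim (intro tendsto_intros)
    have 2: "norm2 M (\<lambda>x. f (s j) x - f n x) \<le> (1/8) ^ k" if "j \<ge> N k" for j
      using N[of k "s j" n] \<open>n \<ge> N k\<close> that sk[of j] by simp
    show ?thesis
      using norm2_Fatou[OF L2_diff[OF f f] _ 1 eventually_sequentiallyI[OF 2]] by simp
  qed
  have "g \<in> L2 M"
    using L2_add[OF conjunct1[OF key[of 0 "N 0"]] f[of "N 0"]] by simp
  moreover have "(\<lambda>n. norm2 M (\<lambda>x. g x - f n x)) \<longlonglongrightarrow> 0"
  proof (rule LIMSEQ_I)
    fix e :: real assume "e > 0"
    then obtain k where "(1/8::real) ^ k < e" using real_arch_pow_inv[of e "1/8"] by auto
    then have "norm (norm2 M (\<lambda>x. g x - f n x) - 0) < e" if "n \<ge> N k" for n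
      using key[OF that] norm2_nonneg[of M "\<lambda>x. g x - f n x"] by auto
    then show "\<exists>no. \<forall>n\<ge>no. norm (norm2 M (\<lambda>x. g x - f n x) - 0) < e" by blast
  qed
  ultimately show ?thesis by (rule that)
qed

subsection \<open>The Plancherel theorem for functions of bounded support\<close>

lemma borel_measurable_cis [measurable (raw)]:
  "f \<in> borel_measurable M \<Longrightarrow> (\<lambda>x. cis (f x)) \<in> borel_measurable M"
  by (rule borel_measurable_continuous_on[where f=cis]) (auto intro: continuous_intros)

text \<open>Unnormalized and over Borel sets, where product measures and affine substitutions are at
  hand; the factor 1/sqrt(2 pi) and Lebesgue measurable functions return in
  \<open>fourier_integral_lborel\<close>.\<close>

definition fourier_lborel :: "(real \<Rightarrow> complex) \<Rightarrow> real \<Rightarrow> complex" where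
  "fourier_lborel f \<xi> = (\<integral>t. f t * cis (- (\<xi> * t)) \<partial>lborel)"

lemma integrable_mult_cis:
  assumes f: "integrable M f" and g [measurable]: "g \<in> borel_measurable M"
  shows "integrable M (\<lambda>x. f x * cis (g x))"
proof -
  have [measurable]: "f \<in> borel_measurable M" using f by auto
  show ?thesis
    by (rule Bochner_Integration.integrable_bound[OF f]) (auto simp: norm_mult)
qed

lemma fourier_lborel_measurable [measurable]:
  assumes [measurable]: "f \<in> borel_measurable borel"
  shows "fourier_lborel f \<in> borel_measurable borel"
  unfolding fourier_lborel_def[abs_def] by measurable

lemma norm_fourier_lborel_le: "cmod (fourier_lborel f \<xi>) \<le> (\<integral>t. cmod (f t) \<partial>lborel)"
  unfolding fourier_lborel_def
  using integral_norm_bound[of lborel "\<lambda>t. f t * cis (- (\<xi> * t))"] by (simp add: norm_mult)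

lemma integrable_pair_product:
  fixes f g :: "real \<Rightarrow> complex"
  assumes f: "integrable lborel f" and g: "integrable lborel g"
    and [measurable]: "k \<in> borel_measurable (borel \<Otimes>\<^sub>M borel)" and k: "\<And>z. cmod (k z) \<le> 1"
  shows "integrable (lborel \<Otimes>\<^sub>M lborel) (\<lambda>z. f (fst z) * g (snd z) * k z)"
proof -
  have [measurable]: "f \<in> borel_measurable borel" "g \<in> borel_measurable borel" using f g by auto
  have "integrable (lborel \<Otimes>\<^sub>M lborel) (\<lambda>z. f (fst z) * g (snd z))"
  proof (rule lborel_pair.Fubini_integrable)
    show "integrable lborel (\<lambda>x. \<integral>y. norm (f (fst (x, y)) * g (snd (x, y))) \<partial>lborel)"
      using f by (auto simp: norm_mult)
    show "AE x in lborel. integrable lborel (\<lambda>y. f (fst (x, y)) * g (snd (x, y)))"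
      using g by auto
  qed measurable
  then show ?thesis
    by (rule Bochner_Integration.integrable_bound)
       (use k in \<open>auto simp: norm_mult intro!: AE_I2 mult_left_le\<close>)
qed

text \<open>Fubini for a kernel that is symmetric in x and y.\<close>

lemma fourier_lborel_multiplication:
  assumes f: "integrable lborel f" and g: "integrable lborel g"
  shows "(\<integral>x. fourier_lborel f x * g x \<partial>lborel) = (\<integral>x. f x * fourier_lborel g x \<partial>lborel)"
proof -
  have int: "integrable (lborel \<Otimes>\<^sub>M lborel) (\<lambda>(x, y). f x * g y * cis (- (x * y)))"
    using integrable_pair_product[OF f g, of "\<lambda>z. cis (- (fst z * snd z))"] by (simp add: split_beta')
  have "(\<integral>y. (\<integral>x. f x * g y * cis (- (x * y)) \<partial>lborel) \<partial>lborel) =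
        (\<integral>x. (\<integral>y. f x * g y * cis (- (x * y)) \<partial>lborel) \<partial>lborel)"
    by (rule lborel_pair.Fubini_integral[OF int])
  moreover have "(\<integral>x. f x * g y * cis (- (x * y)) \<partial>lborel) = fourier_lborel f y * g y" for y
    unfolding fourier_lborel_def by (subst Bochner_Integration.integral_mult_left_zero[symmetric]) (simp add: mult_ac)
  moreover have "(\<integral>y. f x * g y * cis (- (x * y)) \<partial>lborel) = f x * fourier_lborel g x" for x
    unfolding fourier_lborel_def by (subst Bochner_Integration.integral_mult_right_zero[symmetric]) (simp add: mult_ac)
  ultimately show ?thesis by simp
qed

section \<open>Gaussian integrals and Gauss summation\<close>

lemma integrable_gaussian: "integrable lborel (\<lambda>x::real. exp (- (x\<^sup>2 / 2)))"
proof -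
  have "integrable lborel (\<lambda>x. sqrt (2 * pi) * std_normal_density x)"
    by (intro integrable_mult_right integrable_normal_density) auto
  then show ?thesis unfolding std_normal_density_def by simp
qed

lemma integral_gaussian: "(\<integral>x. exp (- ((x::real)\<^sup>2 / 2)) \<partial>lborel) = sqrt (2 * pi)"
proof -
  have "(\<integral>x. sqrt (2 * pi) * std_normal_density x \<partial>lborel) = sqrt (2 * pi)"
    by (subst Bochner_Integration.integral_mult_right_zero) (simp add: integral_normal_density)
  then show ?thesis unfolding std_normal_density_def by simp
qed

text \<open>The left side is the characteristic function of the standard normal law at -t, up to the
  factor 1/sqrt(2 pi) in the density.\<close>

lemma fourier_gaussian:
  "(\<integral>x. of_real (exp (- (x\<^sup>2 / 2))) * cis (- (t * x)) \<partial>lborel) = of_real (sqrt (2 * pi) * exp (- (t\<^sup>2 / 2)))"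
proof -
  have "char std_normal_distribution (- t) = (\<integral>x. std_normal_density x *\<^sub>R iexp (- t * x) \<partial>lborel)"
    unfolding char_def by (subst integral_density) (auto simp: normal_density_nonneg)
  also have "\<dots> = (\<integral>x. (1 / sqrt (2 * pi)) *\<^sub>R (of_real (exp (- (x\<^sup>2 / 2))) * cis (- (t * x))) \<partial>lborel)"
    unfolding std_normal_density_def by (simp add: scaleR_conv_of_real cis_conv_exp)
  also have "\<dots> = (1 / sqrt (2 * pi)) *\<^sub>R (\<integral>x. of_real (exp (- (x\<^sup>2 / 2))) * cis (- (t * x)) \<partial>lborel)"
    by simp
  finally have "(\<integral>x. of_real (exp (- (x\<^sup>2 / 2))) * cis (- (t * x)) \<partial>lborel) =
    sqrt (2 * pi) *\<^sub>R char std_normal_distribution (- t)" by simp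
  then show ?thesis by (simp add: char_std_normal_distribution scaleR_conv_of_real)
qed

lemma fourier_gaussian_scaled:
  assumes "a > 0"
  shows "fourier_lborel (\<lambda>x. of_real (exp (- ((a * x)\<^sup>2 / 2)))) t = of_real (sqrt (2 * pi) / a * exp (- ((t / a)\<^sup>2 / 2)))"
proof -
  have "fourier_lborel (\<lambda>x. of_real (exp (- ((a * x)\<^sup>2 / 2)))) t =
     \<bar>1 / a\<bar> *\<^sub>R (\<integral>x. of_real (exp (- ((a * (0 + 1 / a * x))\<^sup>2 / 2))) * cis (- (t * (0 + 1 / a * x))) \<partial>lborel)"
    unfolding fourier_lborel_def using assms by (intro lborel_integral_real_affine) auto
  also have "\<dots> = (1 / a) *\<^sub>R (\<integral>x. of_real (exp (- (x\<^sup>2 / 2))) * cis (- ((t / a) * x)) \<partial>lborel)"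
    using assms by simp
  finally show ?thesis unfolding fourier_gaussian using assms by (simp add: scaleR_conv_of_real)
qed

text \<open>The multiplication formula moves the transform from A to the wide Gaussian, which
  becomes a narrow Gaussian around 0; rescaling turns this concentration into A (x / (n + 1))
  tending to A 0 under a fixed Gaussian. One factor sqrt(2 pi) comes from the transform of the
  Gaussian, the other from its integral.\<close>

lemma gauss_summation:
  assumes A: "integrable lborel A" and bd: "\<And>h. cmod (A h) \<le> B" and cont: "isCont A 0"
  shows "(\<lambda>n. \<integral>x. fourier_lborel A x * of_real (exp (- ((1 / real (Suc n) * x)\<^sup>2 / 2))) \<partial>lborel)
    \<longlonglongrightarrow> of_real (2 * pi) * A 0"
proof -
  have [measurable]: "A \<in> borel_measurable borel" using A by auto
  have eq: "(\<integral>x. fourier_lborel A x * of_real (exp (- ((1 / real (Suc n) * x)\<^sup>2 / 2))) \<partial>lborel) =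
     of_real (sqrt (2 * pi)) * (\<integral>x. A (1 / real (Suc n) * x) * of_real (exp (- (x\<^sup>2 / 2))) \<partial>lborel)" (is "?L n = ?R n") for n
  proof -
    define a where "a = 1 / real (Suc n)"
    have a: "a > 0" by (simp add: a_def)
    have gi: "integrable lborel (\<lambda>x. complex_of_real (exp (- ((a * x)\<^sup>2 / 2))))"
      using lborel_integrable_real_affine[OF integrable_gaussian, of a 0] a
      by (intro integrable_of_real) simp
    have "?L n = (\<integral>x. A x * of_real (sqrt (2 * pi) / a * exp (- ((x / a)\<^sup>2 / 2))) \<partial>lborel)"
      unfolding a_def[symmetric] fourier_lborel_multiplication[OF A gi] fourier_gaussian_scaled[OF a] ..
    also have "\<dots> = \<bar>a\<bar> *\<^sub>R (\<integral>x. A (0 + a * x) * of_real (sqrt (2 * pi) / a * exp (- (((0 + a * x) / a)\<^sup>2 / 2))) \<partial>lborel)"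
      using a by (intro lborel_integral_real_affine) auto
    also have "\<dots> = (\<integral>x. of_real (sqrt (2 * pi)) * (A (a * x) * of_real (exp (- (x\<^sup>2 / 2)))) \<partial>lborel)"
      unfolding scaleR_conv_of_real
      by (subst Bochner_Integration.integral_mult_right_zero[symmetric]) (use a in \<open>simp add: mult_ac\<close>)
    also have "\<dots> = ?R n" unfolding a_def by simp
    finally show ?thesis .
  qed
  have "(\<lambda>n. \<integral>x. A (1 / real (Suc n) * x) * of_real (exp (- (x\<^sup>2 / 2))) \<partial>lborel) \<longlonglongrightarrow>
      (\<integral>x. A 0 * of_real (exp (- (x\<^sup>2 / 2))) \<partial>lborel)"
  proof (rule integral_dominated_convergence[where w = "\<lambda>x. B * exp (- (x\<^sup>2 / 2))"])
    show "AE x in lborel. (\<lambda>n. A (1 / real (Suc n) * x) * of_real (exp (- (x\<^sup>2 / 2)))) \<longlonglongrightarrow> A 0 * of_real (exp (- (x\<^sup>2 / 2)))"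
    proof (intro AE_I2 tendsto_intros)
      fix x
      have "(\<lambda>n. 1 / real (Suc n) * x) \<longlonglongrightarrow> 0"
        using tendsto_mult_left_zero[OF LIMSEQ_inverse_real_of_nat, of x] by (simp add: field_simps)
      then show "(\<lambda>n. A (1 / real (Suc n) * x)) \<longlonglongrightarrow> A 0"
        using isCont_tendsto_compose[OF cont] by blast
    qed
    show "integrable lborel (\<lambda>x. B * exp (- (x\<^sup>2 / 2)))" using integrable_gaussian by simp
  qed (use bd in \<open>auto simp: norm_mult mult_right_mono\<close>)
  also have "(\<integral>x. A 0 * of_real (exp (- (x\<^sup>2 / 2))) \<partial>lborel) = A 0 * of_real (sqrt (2 * pi))"
    using integral_gaussian by (simp add: integral_complex_of_real)
  finally have "(\<lambda>n. ?R n) \<longlonglongrightarrow> of_real (sqrt (2 * pi)) * (A 0 * of_real (sqrt (2 * pi)))"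
    by (intro tendsto_intros)
  moreover have "of_real (sqrt (2 * pi)) * (A 0 * of_real (sqrt (2 * pi))) = of_real (2 * pi) * A 0"
    by (simp add: mult_ac of_real_mult[symmetric] del: of_real_mult)
  ultimately show ?thesis unfolding eq by simp
qed

section \<open>Plancherel for continuous functions of bounded support\<close>

definition autocorrelation :: "(real \<Rightarrow> complex) \<Rightarrow> real \<Rightarrow> complex" where
  "autocorrelation u h = (\<integral>x. u x * cnj (u (x - h)) \<partial>lborel)"

text \<open>The autocorrelation is the convolution of u with its conjugate reflection. Its value at
  0 is the squared norm of u and its transform is the squared modulus of the transform of u, so that
  summation at 0 becomes Plancherel's identity.\<close>

lemma autocorrelation_fourier:
  assumes u: "integrable lborel u"
  shows "integrable lborel (autocorrelation u)"
    and "fourier_lborel (autocorrelation u) \<xi> = of_real ((cmod (fourier_lborel u \<xi>))\<^sup>2)"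
proof -
  have [measurable]: "u \<in> borel_measurable borel" using u by auto
  have cu: "integrable lborel (\<lambda>x. cnj (u x))" using u by simp
  have shift: "integrable lborel (\<lambda>h. g (x - h))" if "integrable lborel g" for g :: "real \<Rightarrow> complex" and x
    using lborel_integrable_real_affine[OF that, of "-1" x] by simp
  have shiftn: "(\<integral>h. g (x - h) \<partial>lborel) = integral\<^sup>L lborel g" for g :: "real \<Rightarrow> 'b::{banach,second_countable_topology}" and x
    using lborel_integral_real_affine[of "-1" g x] by simp
  have int0: "integrable (lborel \<Otimes>\<^sub>M lborel) (\<lambda>z. u (fst z) * cnj (u (fst z - snd z)))"
  proof (rule lborel_pair.Fubini_integrable)
    have "(\<integral>h. cmod (u (x - h)) \<partial>lborel) = (\<integral>h. cmod (u h) \<partial>lborel)" for x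
      using shiftn[of "\<lambda>h. cmod (u h)" x] .
    then show "integrable lborel (\<lambda>x. \<integral>y. norm (u (fst (x, y)) * cnj (u (fst (x, y) - snd (x, y)))) \<partial>lborel)"
      using u by (auto simp: norm_mult)
    show "AE x in lborel. integrable lborel (\<lambda>y. u (fst (x, y)) * cnj (u (fst (x, y) - snd (x, y))))"
      using shift[OF cu] by auto
  qed measurable
  have int: "integrable (lborel \<Otimes>\<^sub>M lborel) (\<lambda>(x, h). u x * cnj (u (x - h)) * cis (- (\<xi> * h)))"
    using integrable_mult_cis[OF int0, of "\<lambda>z. - (\<xi> * snd z)"] by (simp add: split_beta')
  show "integrable lborel (autocorrelation u)"
    using lborel_pair.integrable_snd[of "\<lambda>x h. u x * cnj (u (x - h))"] int0
    unfolding autocorrelation_def[abs_def] by (simp add: split_beta')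
  have "fourier_lborel (autocorrelation u) \<xi> = (\<integral>h. (\<integral>x. u x * cnj (u (x - h)) * cis (- (\<xi> * h)) \<partial>lborel) \<partial>lborel)"
    unfolding fourier_lborel_def autocorrelation_def by simp
  also have "\<dots> = (\<integral>x. (\<integral>h. u x * cnj (u (x - h)) * cis (- (\<xi> * h)) \<partial>lborel) \<partial>lborel)"
    by (rule lborel_pair.Fubini_integral[OF int])
  also have "\<dots> = (\<integral>x. u x * cis (- (\<xi> * x)) * cnj (fourier_lborel u \<xi>) \<partial>lborel)"
  proof (rule Bochner_Integration.integral_cong)
    fix x
    have "(\<integral>h. u x * cnj (u (x - h)) * cis (- (\<xi> * h)) \<partial>lborel) =
          (\<integral>h. u x * cis (- (\<xi> * x)) * cnj (u (x - h) * cis (- (\<xi> * (x - h)))) \<partial>lborel)"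
    proof (rule Bochner_Integration.integral_cong)
      fix h
      \<comment> \<open>The phase is split into one factor for u at x and one conjugated factor for
        u at x - h.\<close>
      have "cis (- (\<xi> * h)) = cis (- (\<xi> * x)) * cnj (cis (- (\<xi> * (x - h))))"
        by (simp add: cis_cnj cis_mult algebra_simps)
      then show "u x * cnj (u (x - h)) * cis (- (\<xi> * h)) = u x * cis (- (\<xi> * x)) * cnj (u (x - h) * cis (- (\<xi> * (x - h))))"
        by (simp add: mult_ac)
    qed simp
    also have "\<dots> = u x * cis (- (\<xi> * x)) * (\<integral>h. cnj (u h * cis (- (\<xi> * h))) \<partial>lborel)"
      using shiftn[of "\<lambda>h. cnj (u h * cis (- (\<xi> * h)))" x]
      by (simp del: complex_cnj_mult)
    also have "(\<integral>h. cnj (u h * cis (- (\<xi> * h))) \<partial>lborel) = cnj (fourier_lborel u \<xi>)"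
      unfolding fourier_lborel_def by (rule Bochner_Integration.integral_cnj)
    finally show "(\<integral>h. u x * cnj (u (x - h)) * cis (- (\<xi> * h)) \<partial>lborel) = u x * cis (- (\<xi> * x)) * cnj (fourier_lborel u \<xi>)" .
  qed simp
  also have "\<dots> = fourier_lborel u \<xi> * cnj (fourier_lborel u \<xi>)"
    unfolding fourier_lborel_def[of u] by simp
  finally show "fourier_lborel (autocorrelation u) \<xi> = of_real ((cmod (fourier_lborel u \<xi>))\<^sup>2)"
    using complex_norm_square[of "fourier_lborel u \<xi>"] by simp
qed

lemma bounded_support_bounded:
  fixes u :: "real \<Rightarrow> complex"
  assumes c: "continuous_on UNIV u" and supp: "\<And>x. x \<notin> {-R..R} \<Longrightarrow> u x = 0"
  obtains B where "B > 0" "\<And>x. cmod (u x) \<le> B"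
proof -
  have "bounded (u ` {-R..R})"
    by (intro compact_imp_bounded compact_continuous_image) (auto intro: continuous_on_subset[OF c])
  then obtain B where "B > 0" "\<And>x. x \<in> {-R..R} \<Longrightarrow> cmod (u x) \<le> B"
    by (auto simp: bounded_pos)
  then show ?thesis using supp by (intro that[of B]) (metis norm_zero less_imp_le)+
qed

text \<open>Gauss summation of the autocorrelation gives the right side as the limit of weighted
  integrals. The integrand is nonnegative and the weights increase to 1, so by monotone convergence
  the same limit is the full integral, whose finiteness is thus part of the conclusion. Continuity
  of u enters through continuity of the autocorrelation at 0.\<close>

lemma plancherel_continuous:
  assumes c: "continuous_on UNIV u" and supp: "\<And>x. x \<notin> {-R..R} \<Longrightarrow> u x = 0"
  shows "(\<integral>\<^sup>+\<xi>. ennreal ((cmod (fourier_lborel u \<xi>))\<^sup>2) \<partial>lborel) = ennreal (2 * pi * (\<integral>x. (cmod (u x))\<^sup>2 \<partial>lborel))"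
proof -
  have [measurable]: "u \<in> borel_measurable borel" by (rule borel_measurable_continuous_onI[OF c])
  obtain B where B: "B > 0" "\<And>x. cmod (u x) \<le> B" using bounded_support_bounded[OF c supp] by metis
  have indi: "integrable lborel (\<lambda>x. indicator {-R..R} x *\<^sub>R K)" for K :: real
    by (intro integrable_scaleR_left integrable_real_indicator) (auto simp: emeasure_lborel_Icc_eq)
  have u: "integrable lborel u"
    by (rule Bochner_Integration.integrable_bound[OF indi[of B]]) (use B supp in \<open>auto split: split_indicator\<close>)
  have A0: "autocorrelation u 0 = of_real (\<integral>x. (cmod (u x))\<^sup>2 \<partial>lborel)"
    unfolding autocorrelation_def
    by (subst integral_complex_of_real[symmetric]) (simp add: complex_norm_square[symmetric])
  have Abd: "cmod (autocorrelation u h) \<le> (\<integral>x. cmod (u x) * B \<partial>lborel)" for h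
    unfolding autocorrelation_def
  proof (rule order.trans[OF integral_norm_bound], rule integral_mono)
    have ub: "integrable lborel (\<lambda>x. cmod (u x) * B)" using integrable_norm[OF u] by simp
    show "integrable lborel (\<lambda>x. cmod (u x) * B)" by (rule ub)
    show "integrable lborel (\<lambda>x. norm (u x * cnj (u (x - h))))"
      by (rule Bochner_Integration.integrable_bound[OF ub]) (use B in \<open>auto simp: norm_mult intro!: mult_left_mono AE_I2\<close>)
  qed (use B in \<open>auto simp: norm_mult intro: mult_left_mono\<close>)
  have Acont: "isCont (autocorrelation u) 0"
  proof -
    have "(\<lambda>n. autocorrelation u (h n)) \<longlonglongrightarrow> autocorrelation u 0" if h: "h \<longlonglongrightarrow> 0" for h
      unfolding autocorrelation_def
    proof (rule integral_dominated_convergence[where w = "\<lambda>x. cmod (u x) * B"])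
      have "(\<lambda>n. u (x - h n)) \<longlonglongrightarrow> u (x - 0)" for x
      proof (rule isCont_tendsto_compose[of _ u])
        show "isCont u (x - 0)" using c by (simp add: continuous_on_eq_continuous_at)
      qed (intro tendsto_intros h)
      then show "AE x in lborel. (\<lambda>n. u x * cnj (u (x - h n))) \<longlonglongrightarrow> u x * cnj (u (x - 0))"
        by (intro AE_I2 tendsto_intros)
      show "integrable lborel (\<lambda>x. cmod (u x) * B)" using integrable_norm[OF u] by simp
    qed (use B in \<open>auto simp: norm_mult intro!: AE_I2 mult_left_mono\<close>)
    then show ?thesis unfolding isCont_def tendsto_at_iff_sequentially comp_def by blast
  qed
  define w where "w n x = exp (- ((1 / real (Suc n) * x)\<^sup>2 / 2))" for n and x :: real
  have w01: "0 \<le> w n x" "w n x \<le> 1" for n x unfolding w_def by auto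
  have [measurable]: "w n \<in> borel_measurable borel" for n unfolding w_def by measurable
  let ?F = "\<lambda>x. (cmod (fourier_lborel u x))\<^sup>2"
  have "(\<lambda>n. \<integral>x. fourier_lborel (autocorrelation u) x * of_real (w n x) \<partial>lborel) \<longlonglongrightarrow> of_real (2 * pi) * autocorrelation u 0"
    unfolding w_def by (rule gauss_summation[OF autocorrelation_fourier(1)[OF u] Abd Acont])
  then have lim: "(\<lambda>n. \<integral>x. ?F x * w n x \<partial>lborel) \<longlonglongrightarrow> 2 * pi * (\<integral>x. (cmod (u x))\<^sup>2 \<partial>lborel)"
    unfolding autocorrelation_fourier(2)[OF u] A0 of_real_mult[symmetric] integral_complex_of_real
    by (simp only: tendsto_of_real_iff)
  have wi: "integrable lborel (\<lambda>x. ?F x * w n x)" for n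
  proof (rule Bochner_Integration.integrable_bound)
    show "integrable lborel (\<lambda>x. (\<integral>t. cmod (u t) \<partial>lborel)\<^sup>2 * w n x)"
      using lborel_integrable_real_affine[OF integrable_gaussian, of "1 / real (Suc n)" 0] unfolding w_def
      by (intro integrable_mult_right) simp
    show "AE x in lborel. norm (?F x * w n x) \<le> norm ((\<integral>t. cmod (u t) \<partial>lborel)\<^sup>2 * w n x)"
      using w01 by (auto intro!: AE_I2 mult_right_mono power_mono norm_fourier_lborel_le)
  qed measurable
  have "(\<lambda>n. \<integral>\<^sup>+x. ennreal (?F x * w n x) \<partial>lborel) \<longlonglongrightarrow> (\<integral>\<^sup>+x. ennreal (?F x) \<partial>lborel)"
  proof (rule nn_integral_LIMSEQ)
    have wm: "w m x \<le> w n x" if "m \<le> n" for m n x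
    proof -
      have "(1 / real (Suc n) * x)\<^sup>2 \<le> (1 / real (Suc m) * x)\<^sup>2"
        unfolding power_mult_distrib using that
        by (intro mult_right_mono power_mono) (auto simp: frac_le)
      then show ?thesis unfolding w_def by simp
    qed
    show "incseq (\<lambda>n x. ennreal (?F x * w n x))"
      by (auto simp: incseq_def le_fun_def intro!: ennreal_leI mult_left_mono wm)
    fix x
    have "(\<lambda>n. 1 / real (Suc n) * x) \<longlonglongrightarrow> 0"
      using tendsto_mult_left_zero[OF LIMSEQ_inverse_real_of_nat, of x] by (simp add: field_simps)
    then have "(\<lambda>n. w n x) \<longlonglongrightarrow> exp (- (0\<^sup>2 / 2))"
      unfolding w_def by (intro tendsto_intros) auto
    then have "(\<lambda>n. ?F x * w n x) \<longlonglongrightarrow> ?F x * 1" by (intro tendsto_intros) simp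
    then show "(\<lambda>n. ennreal (?F x * w n x)) \<longlonglongrightarrow> ennreal (?F x)" by (intro tendsto_ennrealI) simp
  qed measurable
  moreover have "(\<lambda>n. \<integral>\<^sup>+x. ennreal (?F x * w n x) \<partial>lborel) = (\<lambda>n. ennreal (\<integral>x. ?F x * w n x \<partial>lborel))"
    using w01 by (intro ext nn_integral_eq_integral wi) auto
  ultimately have "(\<lambda>n. ennreal (\<integral>x. ?F x * w n x \<partial>lborel)) \<longlonglongrightarrow> (\<integral>\<^sup>+x. ennreal (?F x) \<partial>lborel)" by simp
  with tendsto_ennrealI[OF lim] show ?thesis using LIMSEQ_unique by blast
qed

section \<open>Steklov averages\<close>

definition steklov :: "real \<Rightarrow> (real \<Rightarrow> complex) \<Rightarrow> real \<Rightarrow> complex" where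
  "steklov h f x = (\<integral>z. indicator {0..1} z * f (x + h * z) \<partial>lborel)"

text \<open>The definition uses a fixed interval of integration, which suits Fubini; the moving
  interval obtained here suits continuity and differentiation.\<close>

lemma steklov_altdef:
  assumes "h > 0"
  shows "steklov h f x = (1 / h) *\<^sub>R (\<integral>t. indicator {x..x + h} t * f t \<partial>lborel)"
proof -
  have "(\<integral>t. indicator {x..x + h} t * f t \<partial>lborel) =
     \<bar>h\<bar> *\<^sub>R (\<integral>z. indicator {x..x + h} (x + h * z) * f (x + h * z) \<partial>lborel)"
    using assms by (intro lborel_integral_real_affine) auto
  also have "(\<lambda>z. indicator {x..x + h} (x + h * z) * f (x + h * z)) = (\<lambda>z. indicator {0..1} z * f (x + h * z))"
  proof
    fix z
    have "x + h * z \<in> {x..x + h} \<longleftrightarrow> z \<in> {0..1}"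
      using assms by (auto simp: zero_le_mult_iff)
    then show "indicator {x..x + h} (x + h * z) * f (x + h * z) = indicator {0..1} z * f (x + h * z)"
      by (simp add: indicator_def)
  qed
  finally show ?thesis using assms by (simp add: steklov_def)
qed

lemma steklov_support:
  assumes "0 < h" "h \<le> 1" "\<And>x. x \<notin> {-R..R} \<Longrightarrow> f x = 0" "x \<notin> {-(R+1)..R+1}"
  shows "steklov h f x = 0"
proof -
  have "(\<lambda>t. indicator {x..x + h} t * f t) = (\<lambda>t. 0)"
  proof
    fix t
    show "indicator {x..x + h} t * f t = 0"
      using assms(1,2,4) assms(3)[of t] by (cases "t \<in> {x..x+h}") (auto simp: not_le)
  qed
  then show ?thesis by (simp add: steklov_altdef[OF assms(1)])
qed

text \<open>When the interval moves, its indicator is eventually constant at every point other than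
  the two limiting endpoints, and |f| dominates.\<close>

lemma continuous_steklov:
  assumes h: "0 < h" and f: "integrable lborel f"
  shows "continuous_on UNIV (steklov h f)"
proof -
  have [measurable]: "f \<in> borel_measurable borel" using f by auto
  have "isCont (steklov h f) x" for x
  proof -
    have "(\<lambda>n. \<integral>t. indicator {X n..X n + h} t * f t \<partial>lborel) \<longlonglongrightarrow> (\<integral>t. indicator {x..x + h} t * f t \<partial>lborel)"
      if X: "X \<longlonglongrightarrow> x" for X
    proof (rule integral_dominated_convergence[where w = "\<lambda>t. cmod (f t)"])
      have "AE t in lborel. t \<noteq> x \<and> t \<noteq> x + h" by (auto intro: AE_conjI AE_lborel_singleton)
      then show "AE t in lborel. (\<lambda>n. indicator {X n..X n + h} t * f t) \<longlonglongrightarrow> indicator {x..x + h} t * f t"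
      proof eventually_elim
        fix t assume t: "t \<noteq> x \<and> t \<noteq> x + h"
        have Xh: "(\<lambda>n. X n + h) \<longlonglongrightarrow> x + h" by (intro tendsto_intros X)
        have 1: "\<forall>\<^sub>F n in sequentially. (X n \<le> t) = (x \<le> t)"
        proof (cases "x < t")
          case True
          then show ?thesis using order_tendstoD(2)[OF X True] by (auto elim: eventually_mono)
        next
          case False
          then have "t < x" using t by auto
          then show ?thesis using order_tendstoD(1)[OF X \<open>t < x\<close>] by (auto elim: eventually_mono)
        qed
        have 2: "\<forall>\<^sub>F n in sequentially. (t \<le> X n + h) = (t \<le> x + h)"
        proof (cases "t < x + h")
          case True
          then show ?thesis using order_tendstoD(1)[OF Xh True] by (auto elim: eventually_mono)
        next
          case False
          then have "x + h < t" using t by auto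
          then show ?thesis using order_tendstoD(2)[OF Xh \<open>x + h < t\<close>] by (auto elim: eventually_mono)
        qed
        from 1 2 have "\<forall>\<^sub>F n in sequentially. indicator {X n..X n + h} t * f t = indicator {x..x + h} t * f t"
          by eventually_elim (auto simp: indicator_def)
        then show "(\<lambda>n. indicator {X n..X n + h} t * f t) \<longlonglongrightarrow> indicator {x..x + h} t * f t"
          by (rule tendsto_eventually)
      qed
      show "integrable lborel (\<lambda>t. cmod (f t))" using f by simp
    qed (auto simp: norm_mult indicator_def)
    then have "(\<lambda>n. steklov h f (X n)) \<longlonglongrightarrow> steklov h f x" if "X \<longlonglongrightarrow> x" for X
      unfolding steklov_altdef[OF h] using that by (intro tendsto_intros) auto
    then show ?thesis unfolding isCont_def tendsto_at_iff_sequentially comp_def by blast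
  qed
  then show ?thesis by (simp add: continuous_at_imp_continuous_on)
qed

text \<open>This is Lebesgue's differentiation theorem for one-sided intervals.
  \<open>integrable_ccontinuous_explicit\<close> phrases it with \<open>negligible\<close>
  exceptional sets, hence the detour through Lebesgue measure.\<close>

lemma steklov_tendsto:
  assumes f: "integrable lborel f"
  shows "AE x in lborel. (\<lambda>n. steklov (1 / real (Suc n)) f x) \<longlonglongrightarrow> f x"
proof -
  have si: "set_integrable lborel S f" if "S \<in> sets lborel" for S
    unfolding set_integrable_def using integrable_mult_indicator[OF that f] .
  have "f integrable_on cbox a b" for a b
    using set_borel_integral_eq_integral(1)[OF si] by simp
  then obtain N where N: "negligible N"
     "\<And>x e. x \<notin> N \<Longrightarrow> 0 < e \<Longrightarrow> \<exists>d>0. \<forall>h. 0 < h \<and> h < d \<longrightarrow>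
          norm (integral (cbox x (x + h *\<^sub>R One)) f /\<^sub>R h ^ DIM(real) - f x) < e"
    using integrable_ccontinuous_explicit[of f] by blast
  have eq: "steklov h f x = integral (cbox x (x + h *\<^sub>R One)) f /\<^sub>R h ^ DIM(real)" if "h > 0" for h x
  proof -
    have "(\<integral>t. indicator {x..x + h} t * f t \<partial>lborel) = (LINT t:{x..x+h}|lborel. f t)"
      unfolding set_lebesgue_integral_def by (intro Bochner_Integration.integral_cong) (auto simp: indicator_def)
    also have "\<dots> = integral {x..x+h} f"
      by (rule set_borel_integral_eq_integral(2)[OF si]) simp
    finally show ?thesis unfolding steklov_altdef[OF that] by (simp add: divide_inverse)
  qed
  have "(\<lambda>n. steklov (1 / real (Suc n)) f x) \<longlonglongrightarrow> f x" if x: "x \<notin> N" for x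
  proof (rule LIMSEQ_I)
    fix e :: real assume "e > 0"
    then obtain d where d: "d > 0" "\<And>h. 0 < h \<Longrightarrow> h < d \<Longrightarrow> norm (steklov h f x - f x) < e"
      using N(2)[OF x] eq by metis
    obtain n0 where n0: "inverse (real (Suc n0)) < d" using reals_Archimedean[OF d(1)] by blast
    have "norm (steklov (1 / real (Suc n)) f x - f x) < e" if "n \<ge> n0" for n
    proof (rule d(2))
      have "1 / real (Suc n) \<le> 1 / real (Suc n0)" using that by (intro divide_left_mono) auto
      then show "1 / real (Suc n) < d" using n0 by (simp add: inverse_eq_divide)
    qed simp
    then show "\<exists>no. \<forall>n\<ge>no. norm (steklov (1 / real (Suc n)) f x - f x) < e" by blast
  qed
  then have "AE x in lebesgue. (\<lambda>n. steklov (1 / real (Suc n)) f x) \<longlonglongrightarrow> f x"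
    using N(1) by (intro AE_I'[of N]) (auto simp: negligible_iff_null_sets)
  then show ?thesis by (simp add: AE_completion_iff)
qed

lemma complex_indicator01:
  shows integrable_indicator01: "integrable lborel (indicator {0..1::real} :: real \<Rightarrow> complex)"
    and integral_indicator01: "integral\<^sup>L lborel (indicator {0..1::real} :: real \<Rightarrow> complex) = 1"
proof -
  have eq: "(\<lambda>x::real. complex_of_real (indicator {0..1} x)) = indicator {0..1}"
    by (auto simp: indicator_def)
  have "integrable lborel (\<lambda>x::real. complex_of_real (indicator {0..1} x))"
    by (intro integrable_of_real integrable_real_indicator) auto
  then show "integrable lborel (indicator {0..1::real} :: real \<Rightarrow> complex)" unfolding eq .
  have "(\<integral>x. complex_of_real (indicator {0..1::real} x) \<partial>lborel) = 1"
    by (subst integral_complex_of_real) simp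
  then show "integral\<^sup>L lborel (indicator {0..1::real} :: real \<Rightarrow> complex) = 1" unfolding eq .
qed

text \<open>The average is made of translates by h z, each of which multiplies the transform by a
  phase. The mean phase has modulus at most 1 and tends to 1 along h = 1/(n+1), the two facts on
  which \<open>plancherel_lborel\<close> rests.\<close>

lemma fourier_steklov:
  assumes f: "integrable lborel f"
  shows "fourier_lborel (steklov h f) \<xi> = (\<integral>z. indicator {0..1} z * cis (h * \<xi> * z) \<partial>lborel) * fourier_lborel f \<xi>"
proof -
  have [measurable]: "f \<in> borel_measurable borel" using f by auto
  have shift: "integrable lborel (\<lambda>x. g (x + c))" "(\<integral>x. g (x + c) \<partial>lborel) = integral\<^sup>L lborel g"
    if "integrable lborel g" for g :: "real \<Rightarrow> 'b::{banach,second_countable_topology}" and c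
    using lborel_integrable_real_affine[OF that, of 1 c] lborel_integral_real_affine[of 1 g c] by (simp_all add: add.commute)
  have int0: "integrable (lborel \<Otimes>\<^sub>M lborel) (\<lambda>w. indicator {0..1} (fst w) * f (snd w + h * fst w))"
  proof (rule lborel_pair.Fubini_integrable)
    have "(\<integral>x. cmod (f (x + h * z)) \<partial>lborel) = (\<integral>x. cmod (f x) \<partial>lborel)" for z
      using shift(2)[OF integrable_norm[OF f], of "h * z"] .
    then show "integrable lborel (\<lambda>x. \<integral>y. norm (indicator {0..1} (fst (x, y)) * f (snd (x, y) + h * fst (x, y))) \<partial>lborel)"
      using integrable_norm[OF integrable_indicator01] by (auto simp: norm_mult)
    show "AE x in lborel. integrable lborel (\<lambda>y. indicator {0..1} (fst (x, y)) * f (snd (x, y) + h * fst (x, y)))"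
      using shift(1)[OF f] by auto
  qed measurable
  have int: "integrable (lborel \<Otimes>\<^sub>M lborel) (\<lambda>(z, x). indicator {0..1} z * f (x + h * z) * cis (- (\<xi> * x)))"
    using integrable_mult_cis[OF int0, of "\<lambda>w. - (\<xi> * snd w)"] by (simp add: split_beta')
  have "fourier_lborel (steklov h f) \<xi> = (\<integral>x. (\<integral>z. indicator {0..1} z * f (x + h * z) * cis (- (\<xi> * x)) \<partial>lborel) \<partial>lborel)"
    unfolding fourier_lborel_def steklov_def by simp
  also have "\<dots> = (\<integral>z. (\<integral>x. indicator {0..1} z * f (x + h * z) * cis (- (\<xi> * x)) \<partial>lborel) \<partial>lborel)"
    by (rule lborel_pair.Fubini_integral[OF int])
  also have "\<dots> = (\<integral>z. indicator {0..1} z * cis (h * \<xi> * z) * fourier_lborel f \<xi> \<partial>lborel)"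
  proof (rule Bochner_Integration.integral_cong)
    fix z
    have "(\<integral>x. indicator {0..1} z * f (x + h * z) * cis (- (\<xi> * x)) \<partial>lborel) =
          (\<integral>x. indicator {0..1} z * cis (h * \<xi> * z) * (f (x + h * z) * cis (- (\<xi> * (x + h * z)))) \<partial>lborel)"
    proof (rule Bochner_Integration.integral_cong)
      fix x
      have "cis (- (\<xi> * x)) = cis (h * \<xi> * z) * cis (- (\<xi> * (x + h * z)))"
        by (simp add: cis_mult algebra_simps)
      then show "indicator {0..1} z * f (x + h * z) * cis (- (\<xi> * x)) =
         indicator {0..1} z * cis (h * \<xi> * z) * (f (x + h * z) * cis (- (\<xi> * (x + h * z))))"
        by (simp add: mult_ac)
    qed simp
    also have "\<dots> = indicator {0..1} z * cis (h * \<xi> * z) * fourier_lborel f \<xi>"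
      using shift(2)[OF integrable_mult_cis[OF f, of "\<lambda>x. - (\<xi> * x)"], of "h * z"]
      unfolding fourier_lborel_def by simp
    finally show "(\<integral>x. indicator {0..1} z * f (x + h * z) * cis (- (\<xi> * x)) \<partial>lborel) =
      indicator {0..1} z * cis (h * \<xi> * z) * fourier_lborel f \<xi>" .
  qed simp
  also have "\<dots> = (\<integral>z. indicator {0..1} z * cis (h * \<xi> * z) \<partial>lborel) * fourier_lborel f \<xi>"
    by simp
  finally show ?thesis .
qed

text \<open>Cauchy--Schwarz against the indicator of [0,1], which has norm 1, bounds the square of
  the mean by the mean of the squares; Tonelli and translation invariance do the rest.\<close>

lemma steklov_L2:
  assumes h: "h \<noteq> 0" and f: "f \<in> L2 lborel" and m [measurable]: "steklov h f \<in> borel_measurable borel"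
  shows "steklov h f \<in> L2 lborel" "norm2 lborel (steklov h f) \<le> norm2 lborel f"
proof -
  have [measurable]: "f \<in> borel_measurable borel" using L2_measurable[OF f] by simp
  define I :: "real \<Rightarrow> complex" where "I = indicator {0..1}"
  have [measurable]: "I \<in> borel_measurable borel" unfolding I_def by measurable
  have nI: "(cmod (I z))\<^sup>2 = indicator {0..1} z" for z by (auto simp: I_def indicator_def)
  have I2: "I \<in> L2 lborel" "norm2 lborel I = 1"
    unfolding L2_def norm2_def by (simp_all add: nI integrable_indicator_iff)
  have pt: "ennreal ((cmod (steklov h f x))\<^sup>2) \<le> (\<integral>\<^sup>+z. indicator {0..1} z * ennreal ((cmod (f (x + h * z)))\<^sup>2) \<partial>lborel)" for x
  proof -
    define g where "g = (\<lambda>z. indicator {0..1} z * f (x + h * z))"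
    have "(\<lambda>z. f (x + h * z)) \<in> L2 lborel"
      unfolding L2_def using lborel_integrable_real_affine[OF L2_integrable[OF f] h, of x] by simp
    then have g: "g \<in> L2 lborel" unfolding g_def by (rule L2_restrict) simp
    have "steklov h f x = inner2 lborel g I"
      unfolding steklov_def inner2_def g_def I_def
      by (intro Bochner_Integration.integral_cong) (auto simp: indicator_def)
    then have "(cmod (steklov h f x))\<^sup>2 \<le> norm2 lborel g"
      using Cauchy_Schwarz_L2[OF g I2(1)] I2(2) by simp
    then have "ennreal ((cmod (steklov h f x))\<^sup>2) \<le> (\<integral>\<^sup>+z. ennreal ((cmod (g z))\<^sup>2) \<partial>lborel)"
      unfolding L2_nn_integral[OF g] by (rule ennreal_leI)
    also have "\<dots> = (\<integral>\<^sup>+z. indicator {0..1} z * ennreal ((cmod (f (x + h * z)))\<^sup>2) \<partial>lborel)"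
      unfolding g_def by (intro nn_integral_cong) (auto simp: indicator_def)
    finally show ?thesis .
  qed
  have "(\<integral>\<^sup>+x. ennreal ((cmod (steklov h f x))\<^sup>2) \<partial>lborel) \<le>
      (\<integral>\<^sup>+x. (\<integral>\<^sup>+z. indicator {0..1} z * ennreal ((cmod (f (x + h * z)))\<^sup>2) \<partial>lborel) \<partial>lborel)"
    by (intro nn_integral_mono pt)
  also have "\<dots> = (\<integral>\<^sup>+z. (\<integral>\<^sup>+x. indicator {0..1} z * ennreal ((cmod (f (x + h * z)))\<^sup>2) \<partial>lborel) \<partial>lborel)"
    by (rule lborel_pair.Fubini') measurable
  also have "\<dots> = (\<integral>\<^sup>+z. indicator {0..1::real} z * ennreal (norm2 lborel f) \<partial>lborel)"
  proof (rule nn_integral_cong)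
    fix z
    have "(\<integral>\<^sup>+x. ennreal ((cmod (f (x + h * z)))\<^sup>2) \<partial>lborel) = ennreal (norm2 lborel f)"
      using nn_integral_real_affine[of "\<lambda>x. ennreal ((cmod (f x))\<^sup>2)" 1 "h * z"] L2_nn_integral[OF f]
      by (simp add: add.commute)
    then show "(\<integral>\<^sup>+x. indicator {0..1} z * ennreal ((cmod (f (x + h * z)))\<^sup>2) \<partial>lborel) = indicator {0..1} z * ennreal (norm2 lborel f)"
      by (simp add: nn_integral_cmult)
  qed
  also have "\<dots> = ennreal (norm2 lborel f)" by (simp add: nn_integral_multc)
  finally have *: "(\<integral>\<^sup>+x. ennreal ((cmod (steklov h f x))\<^sup>2) \<partial>lborel) \<le> ennreal (norm2 lborel f)" .
  show "steklov h f \<in> L2 lborel" by (rule L2_I_nn[OF _ *]) simp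
  then show "norm2 lborel (steklov h f) \<le> norm2 lborel f" by (rule norm2_le_nn[OF _ * norm2_nonneg])
qed

lemma integrable_of_L2_bounded_support:
  assumes f: "f \<in> L2 M" and A: "A \<in> sets M" "emeasure M A < \<infinity>" and supp: "\<And>x. x \<in> space M \<Longrightarrow> x \<notin> A \<Longrightarrow> f x = 0"
  shows "integrable M f"
proof (rule Bochner_Integration.integrable_bound)
  show "integrable M (\<lambda>x. indicator A x + (cmod (f x))\<^sup>2)"
    using A L2_integrable[OF f] by (intro Bochner_Integration.integrable_add) auto
  have le: "a \<le> 1 + a\<^sup>2" if "a \<ge> 0" for a :: real
    using sum_squares_bound[of a 1] by (simp add: power2_eq_square) (use that in linarith)
  show "AE x in M. cmod (f x) \<le> norm (indicator A x + (cmod (f x))\<^sup>2)"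
  proof (rule AE_I2)
    fix x assume "x \<in> space M"
    then show "cmod (f x) \<le> norm (indicator A x + (cmod (f x))\<^sup>2)"
      using supp[of x] le[of "cmod (f x)"] by (cases "x \<in> A") auto
  qed
qed (use L2_measurable[OF f] in simp)

text \<open>Fatou is used on both sides. The transforms of the averages converge pointwise, which
  bounds the norm of the transform from above. Their multipliers have modulus at most 1, so the
  norms of the averages are controlled by the transform of f, and almost everywhere convergence of
  the averages gives the bound from below.\<close>

lemma plancherel_lborel:
  assumes f: "f \<in> L2 lborel" and supp: "\<And>x. x \<notin> {-R..R} \<Longrightarrow> f x = 0"
  shows "fourier_lborel f \<in> L2 lborel" "norm2 lborel (fourier_lborel f) = 2 * pi * norm2 lborel f"
proof -
  have [measurable]: "f \<in> borel_measurable borel" using L2_measurable[OF f] by simp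
  have fi: "integrable lborel f"
    by (rule integrable_of_L2_bounded_support[OF f, of "{-R..R}"]) (use supp in \<open>auto simp: emeasure_lborel_Icc_eq\<close>)
  define g where "g n = steklov (1 / real (Suc n)) f" for n
  define \<sigma> where "\<sigma> n \<xi> = (\<integral>z. indicator {0..1} z * cis (1 / real (Suc n) * \<xi> * z) \<partial>lborel)" for n \<xi>
  have gc: "continuous_on UNIV (g n)" for n unfolding g_def by (rule continuous_steklov[OF _ fi]) simp
  have gm: "g n \<in> borel_measurable borel" for n by (rule borel_measurable_continuous_onI[OF gc])
  have gs: "g n x = 0" if "x \<notin> {-(R+1)..R+1}" for n x
    unfolding g_def by (rule steklov_support[OF _ _ supp that]) auto
  have g2: "g n \<in> L2 lborel" "norm2 lborel (g n) \<le> norm2 lborel f" for n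
    unfolding g_def by (rule steklov_L2[OF _ f]; use gm[of n] in \<open>simp add: g_def\<close>)+
  have Fg: "fourier_lborel (g n) \<xi> = \<sigma> n \<xi> * fourier_lborel f \<xi>" for n \<xi>
    unfolding g_def \<sigma>_def by (rule fourier_steklov[OF fi])
  have pg: "(\<integral>\<^sup>+\<xi>. ennreal ((cmod (fourier_lborel (g n) \<xi>))\<^sup>2) \<partial>lborel) = ennreal (2 * pi * norm2 lborel (g n))" for n
    unfolding norm2_def by (rule plancherel_continuous[OF gc gs])
  have Fgm: "fourier_lborel (g n) \<in> borel_measurable lborel" for n using gm[of n] by simp
  have Fg2: "fourier_lborel (g n) \<in> L2 lborel" for n
    by (rule L2_I_nn[OF Fgm order_eq_refl[OF pg]])
  have Fgn: "norm2 lborel (fourier_lborel (g n)) = 2 * pi * norm2 lborel (g n)" for n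
    by (rule norm2_eq_nn[OF Fgm pg]) (simp add: norm2_nonneg)
  have \<sigma>1: "cmod (\<sigma> n \<xi>) \<le> 1" for n \<xi>
  proof -
    have "cmod (\<sigma> n \<xi>) \<le> (\<integral>z. cmod (indicator {0..1} z * cis (1 / real (Suc n) * \<xi> * z)) \<partial>lborel)"
      unfolding \<sigma>_def by (rule integral_norm_bound)
    also have "\<dots> = (\<integral>z. indicator {0..1::real} z \<partial>lborel)"
      by (intro Bochner_Integration.integral_cong) (auto simp: norm_mult indicator_def)
    finally show ?thesis by simp
  qed
  have \<sigma>lim: "(\<lambda>n. \<sigma> n \<xi>) \<longlonglongrightarrow> 1" for \<xi>
  proof -
    have "(\<lambda>n. \<sigma> n \<xi>) \<longlonglongrightarrow> (\<integral>z. indicator {0..1::real} z * cis 0 \<partial>lborel)"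
      unfolding \<sigma>_def
    proof (rule integral_dominated_convergence[where w = "indicator {0..1}"])
      show "AE z in lborel. (\<lambda>n. indicator {0..1} z * cis (1 / real (Suc n) * \<xi> * z)) \<longlonglongrightarrow> indicator {0..1} z * cis 0"
      proof (intro AE_I2 tendsto_intros)
        fix z
        show "(\<lambda>n. 1 / real (Suc n) * \<xi> * z) \<longlonglongrightarrow> 0"
          using tendsto_mult_left_zero[OF LIMSEQ_inverse_real_of_nat, of "\<xi> * z"] by (simp add: field_simps)

      qed
    qed (auto simp: norm_mult indicator_def integrable_indicator_iff)
    then show ?thesis by (simp add: integral_indicator01)
  qed
  have Flim: "AE \<xi> in lborel. (\<lambda>n. fourier_lborel (g n) \<xi>) \<longlonglongrightarrow> fourier_lborel f \<xi>"
    unfolding Fg using tendsto_mult_right[OF \<sigma>lim] by (intro AE_I2) auto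
  have F2: "fourier_lborel f \<in> L2 lborel" and Fle: "norm2 lborel (fourier_lborel f) \<le> 2 * pi * norm2 lborel f"
    using norm2_Fatou[OF Fg2 _ Flim, of "2 * pi * norm2 lborel f"] g2(2) norm2_nonneg[of lborel f]
    unfolding Fgn by (auto simp: always_eventually)
  show "fourier_lborel f \<in> L2 lborel" by (rule F2)
  have "norm2 lborel (g n) \<le> norm2 lborel (fourier_lborel f) / (2 * pi)" for n
  proof -
    have "norm2 lborel (fourier_lborel (g n)) \<le> norm2 lborel (fourier_lborel f)"
      by (rule norm2_mono[OF F2 Fg2]) (use \<sigma>1 in \<open>auto simp: Fg norm_mult intro!: AE_I2 mult_left_le_one_le\<close>)
    then show ?thesis unfolding Fgn by (simp add: field_simps)
  qed
  then have "norm2 lborel f \<le> norm2 lborel (fourier_lborel f) / (2 * pi)"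
    by (intro norm2_Fatou(2)[OF g2(1)]) (use steklov_tendsto[OF fi] in \<open>auto simp: g_def norm2_nonneg\<close>)
  then have "2 * pi * norm2 lborel f \<le> norm2 lborel (fourier_lborel f)" by (simp add: field_simps)
  with Fle show "norm2 lborel (fourier_lborel f) = 2 * pi * norm2 lborel f" by simp
qed

subsection \<open>The Fourier--Plancherel transform\<close>

lemma square_integrable_eq_L2: "square_integrable = L2 lebesgue"
  by (simp add: square_integrable_def L2_def)

lemma L2_inner_eq_inner2: "L2_inner f g = inner2 lebesgue f g"
  by (simp add: L2_inner_def inner2_def)

text \<open>The definitions speak of Lebesgue measurable functions, but the Fubini arguments run on
  products of Borel measures.\<close>

lemma borel_representative:
  fixes f :: "real \<Rightarrow> complex"
  assumes "f \<in> borel_measurable lebesgue"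
  obtains g where "g \<in> borel_measurable borel" "AE x in lebesgue. f x = g x"
proof -
  have "(\<lambda>x. Re (f x)) \<in> borel_measurable lebesgue" "(\<lambda>x. Im (f x)) \<in> borel_measurable lebesgue"
    using assms by measurable
  then obtain u v where uv: "u \<in> borel_measurable lborel" "v \<in> borel_measurable lborel"
    and ae: "AE x in lborel. Re (f x) = u x" "AE x in lborel. Im (f x) = v x"
    using completion_ex_borel_measurable_real[of "\<lambda>x. Re (f x)" lborel]
      completion_ex_borel_measurable_real[of "\<lambda>x. Im (f x)" lborel] by blast
  have "AE x in lebesgue. f x = Complex (u x) (v x)"
    using AE_completion[OF ae(1)] AE_completion[OF ae(2)]
    by eventually_elim (simp add: complex_eq_iff)
  moreover have "(\<lambda>x. Complex (u x) (v x)) \<in> borel_measurable borel"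
    unfolding Complex_eq using uv by measurable
  ultimately show ?thesis using that by blast
qed

lemma measurable_lebesgue_borel: "f \<in> borel_measurable borel \<Longrightarrow> f \<in> borel_measurable lebesgue"
  by (rule measurable_completion) simp

lemma borel_lebesgue_transfer:
  fixes f :: "real \<Rightarrow> complex"
  assumes f: "f \<in> borel_measurable borel"
  shows "f \<in> L2 lebesgue \<longleftrightarrow> f \<in> L2 lborel" "norm2 lebesgue f = norm2 lborel f"
    "integrable lebesgue f \<longleftrightarrow> integrable lborel f" "integral\<^sup>L lebesgue f = integral\<^sup>L lborel f"
  using f measurable_lebesgue_borel[OF f]
  by (auto simp: L2_def norm2_def integrable_completion integral_completion)

lemma fourier_integral_cis:
  "fourier_integral f \<xi> = of_real (1 / sqrt (2 * pi)) * (\<integral>t. f t * cis (- (\<xi> * t)) \<partial>lebesgue)"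
  unfolding fourier_integral_def cis_conv_exp by simp

lemma fourier_integral_lborel:
  assumes f: "f \<in> borel_measurable lebesgue" and g: "g \<in> borel_measurable borel" and ae: "AE x in lebesgue. f x = g x"
  shows "fourier_integral f = (\<lambda>\<xi>. of_real (1 / sqrt (2 * pi)) * fourier_lborel g \<xi>)"
proof
  fix \<xi>
  have c: "(\<lambda>t. cis (- (\<xi> * t))) \<in> borel_measurable lebesgue"
    by (intro measurable_lebesgue_borel) measurable
  have "(\<integral>t. f t * cis (- (\<xi> * t)) \<partial>lebesgue) = (\<integral>t. g t * cis (- (\<xi> * t)) \<partial>lebesgue)"
  proof (rule integral_cong_AE)
    show "(\<lambda>t. f t * cis (- (\<xi> * t))) \<in> borel_measurable lebesgue" using f c by measurable
    show "(\<lambda>t. g t * cis (- (\<xi> * t))) \<in> borel_measurable lebesgue"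
      using measurable_lebesgue_borel[OF g] c by measurable
    show "AE t in lebesgue. f t * cis (- (\<xi> * t)) = g t * cis (- (\<xi> * t))"
      using ae by eventually_elim simp
  qed
  also have "\<dots> = fourier_lborel g \<xi>"
    unfolding fourier_lborel_def by (rule integral_completion) (use g in measurable)
  finally show "fourier_integral f \<xi> = of_real (1 / sqrt (2 * pi)) * fourier_lborel g \<xi>"
    unfolding fourier_integral_cis by simp
qed

lemma fourier_integral_measurable:
  assumes "f \<in> borel_measurable lebesgue"
  shows "fourier_integral f \<in> borel_measurable borel"
proof -
  obtain g where g: "g \<in> borel_measurable borel" "AE x in lebesgue. f x = g x"
    using borel_representative[OF assms] .
  note [measurable] = g(1)
  show ?thesis unfolding fourier_integral_lborel[OF assms g] by measurable
qed

text \<open>On these functions the Fourier integral converges absolutely. They serve both as the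
  truncations in the definition of the transform and as the test functions of the duality
  arguments.\<close>

definition L2_bounded_support :: "(real \<Rightarrow> complex) set" where
  "L2_bounded_support = {f \<in> L2 lebesgue. \<exists>R. \<forall>x. x \<notin> {-R..R} \<longrightarrow> f x = 0}"

lemma L2_bounded_support_L2: "f \<in> L2_bounded_support \<Longrightarrow> f \<in> L2 lebesgue"
  by (simp add: L2_bounded_support_def)

lemma L2_bounded_support_integrable:
  assumes "f \<in> L2_bounded_support"
  shows "integrable lebesgue f"
proof -
  obtain R where "\<And>x. x \<notin> {-R..R} \<Longrightarrow> f x = 0" using assms by (auto simp: L2_bounded_support_def)
  then show ?thesis
    using integrable_of_L2_bounded_support[OF L2_bounded_support_L2[OF assms], of "{-R..R}"]
    by (auto simp: emeasure_lborel_Icc_eq)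
qed

lemma L2_bounded_support_add:
  assumes "f \<in> L2_bounded_support" "g \<in> L2_bounded_support"
  shows "(\<lambda>x. f x + g x) \<in> L2_bounded_support"
proof -
  obtain R where R: "\<And>x. x \<notin> {-R..R} \<Longrightarrow> f x = 0" using assms by (auto simp: L2_bounded_support_def)
  obtain S where S: "\<And>x. x \<notin> {-S..S} \<Longrightarrow> g x = 0" using assms by (auto simp: L2_bounded_support_def)
  have "f x + g x = 0" if "x \<notin> {-(max R S)..max R S}" for x
    using that R[of x] S[of x] by (cases "x \<in> {-R..R}"; cases "x \<in> {-S..S}") auto
  then show ?thesis using assms L2_add[of f lebesgue g] unfolding L2_bounded_support_def by blast
qed

lemma L2_bounded_support_scale: "f \<in> L2_bounded_support \<Longrightarrow> (\<lambda>x. c * f x) \<in> L2_bounded_support"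
  unfolding L2_bounded_support_def using L2_scale by fastforce

lemma L2_bounded_support_diff:
  assumes "f \<in> L2_bounded_support" "g \<in> L2_bounded_support"
  shows "(\<lambda>x. f x - g x) \<in> L2_bounded_support"
  using L2_bounded_support_add[OF assms(1) L2_bounded_support_scale[OF assms(2), of "-1"]] by simp

lemma L2_bounded_support_truncate:
  assumes "f \<in> L2 lebesgue"
  shows "(\<lambda>x. indicator {-R..R} x * f x) \<in> L2_bounded_support"
  unfolding L2_bounded_support_def using L2_restrict[OF assms, of "{-R..R}"]
  by (auto intro!: exI[of _ R])

lemma fourier_integral_add:
  assumes "integrable lebesgue f" "integrable lebesgue g"
  shows "fourier_integral (\<lambda>x. f x + g x) \<xi> = fourier_integral f \<xi> + fourier_integral g \<xi>"
proof -
  have c: "(\<lambda>t. - (\<xi> * t)) \<in> borel_measurable lebesgue"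
    by (intro measurable_lebesgue_borel) measurable
  show ?thesis
    unfolding fourier_integral_cis
    using integrable_mult_cis[OF assms(1) c] integrable_mult_cis[OF assms(2) c]
    by (simp add: distrib_right distrib_left add_divide_distrib)
qed

lemma fourier_integral_scale: "fourier_integral (\<lambda>x. c * f x) \<xi> = c * fourier_integral f \<xi>"
  unfolding fourier_integral_cis by (simp add: mult.assoc)

lemma fourier_integral_diff:
  assumes "integrable lebesgue f" "integrable lebesgue g"
  shows "fourier_integral (\<lambda>x. f x - g x) \<xi> = fourier_integral f \<xi> - fourier_integral g \<xi>"
  using fourier_integral_add[OF assms(1), of "\<lambda>x. - 1 * g x" \<xi>] fourier_integral_scale[of "-1" g \<xi>] assms
  by simp

lemma plancherel:
  assumes f: "f \<in> L2_bounded_support"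
  shows "fourier_integral f \<in> L2 lebesgue" "norm2 lebesgue (fourier_integral f) = norm2 lebesgue f"
proof -
  obtain R where R: "\<And>x. x \<notin> {-R..R} \<Longrightarrow> f x = 0" using f by (auto simp: L2_bounded_support_def)
  have f2: "f \<in> L2 lebesgue" using L2_bounded_support_L2[OF f] .
  obtain g0 where g0: "g0 \<in> borel_measurable borel" "AE x in lebesgue. f x = g0 x"
    using borel_representative[OF L2_measurable[OF f2]] .
  \<comment> \<open>The Borel representative is cut off again, since on a null set outside [-R, R]
    it may differ from f.\<close>
  define g where "g = (\<lambda>x. indicator {-R..R} x * g0 x)"
  have gm: "g \<in> borel_measurable borel" unfolding g_def using g0(1) by measurable
  have ae: "AE x in lebesgue. f x = g x"
    using g0(2)
  proof eventually_elim
    fix x assume "f x = g0 x"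
    then show "f x = g x" using R[of x] by (cases "x \<in> {-R..R}") (auto simp: g_def)
  qed
  have "g \<in> L2 lebesgue" by (rule L2_cong_AE[OF f2 measurable_lebesgue_borel[OF gm] ae])
  then have g2: "g \<in> L2 lborel" using borel_lebesgue_transfer(1)[OF gm] by simp
  have Fm: "fourier_lborel g \<in> borel_measurable borel" using gm by simp
  have gs: "g x = 0" if "x \<notin> {-R..R}" for x using that by (simp add: g_def)
  note P = plancherel_lborel[OF g2 gs]
  have F: "fourier_integral f = (\<lambda>\<xi>. of_real (1 / sqrt (2 * pi)) * fourier_lborel g \<xi>)"
    by (rule fourier_integral_lborel[OF L2_measurable[OF f2] gm ae])
  show "fourier_integral f \<in> L2 lebesgue"
    unfolding F by (rule L2_scale) (use P(1) borel_lebesgue_transfer(1)[OF Fm] in simp)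
  have "norm2 lebesgue (fourier_integral f) = (1 / sqrt (2 * pi))\<^sup>2 * (2 * pi * norm2 lborel g)"
    unfolding F norm2_scale borel_lebesgue_transfer(2)[OF Fm] norm_of_real using P(2) by simp
  also have "\<dots> = norm2 lborel g" by (simp add: power_divide)
  also have "\<dots> = norm2 lebesgue f"
    unfolding borel_lebesgue_transfer(2)[OF gm, symmetric]
    by (rule norm2_cong_AE[symmetric, OF L2_measurable[OF f2] measurable_lebesgue_borel[OF gm] ae])
  finally show "norm2 lebesgue (fourier_integral f) = norm2 lebesgue f" .
qed

text \<open>Polarization: Plancherel for u + c v compares real parts, and c = 1 and c = \<i> recover
  the complex number.\<close>

lemma parseval:
  assumes u: "u \<in> L2_bounded_support" and v: "v \<in> L2_bounded_support"
  shows "inner2 lebesgue (fourier_integral u) (fourier_integral v) = inner2 lebesgue u v"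
proof -
  have re: "Re (cnj c * inner2 lebesgue (fourier_integral u) (fourier_integral v)) = Re (cnj c * inner2 lebesgue u v)" for c
  proof -
    have cv: "(\<lambda>x. c * v x) \<in> L2_bounded_support" by (rule L2_bounded_support_scale[OF v])
    have F: "fourier_integral (\<lambda>x. u x + c * v x) = (\<lambda>\<xi>. fourier_integral u \<xi> + c * fourier_integral v \<xi>)"
      using fourier_integral_add[OF L2_bounded_support_integrable[OF u] L2_bounded_support_integrable[OF cv]]
      by (auto simp: fourier_integral_scale)
    have "norm2 lebesgue (\<lambda>\<xi>. fourier_integral u \<xi> + c * fourier_integral v \<xi>) = norm2 lebesgue (\<lambda>x. u x + c * v x)"
      using plancherel(2)[OF L2_bounded_support_add[OF u cv]] F by simp
    then show ?thesis
      unfolding norm2_add[OF plancherel(1)[OF u] L2_scale[OF plancherel(1)[OF v]]]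
        norm2_add[OF L2_bounded_support_L2[OF u] L2_bounded_support_L2[OF cv]]
        norm2_scale plancherel(2)[OF u] plancherel(2)[OF v] inner2_scale_right by simp
  qed
  show ?thesis using re[of 1] re[of \<i>] by (simp add: complex_eq_iff)
qed

text \<open>The adjoint of the Fourier integral, by \<open>fourier_integral_adjoint\<close>. That it
  inverts the transform is established for the Paley--Wiener space in
  \<open>paley_wiener_representative\<close>.\<close>

definition inverse_fourier :: "(real \<Rightarrow> complex) \<Rightarrow> real \<Rightarrow> complex" where
  "inverse_fourier h x = fourier_integral h (- x)"

lemma inverse_fourier_measurable:
  assumes "h \<in> borel_measurable lebesgue"
  shows "inverse_fourier h \<in> borel_measurable borel"
proof -
  note [measurable] = fourier_integral_measurable[OF assms]
  show ?thesis unfolding inverse_fourier_def[abs_def] by measurable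
qed

lemma inverse_fourier_L2:
  assumes h: "h \<in> L2_bounded_support"
  shows "inverse_fourier h \<in> L2 lebesgue" "norm2 lebesgue (inverse_fourier h) = norm2 lebesgue h"
proof -
  have m: "fourier_integral h \<in> borel_measurable borel" "inverse_fourier h \<in> borel_measurable borel"
    using fourier_integral_measurable inverse_fourier_measurable L2_measurable[OF L2_bounded_support_L2[OF h]] by blast+
  have *: "fourier_integral h \<in> L2 lborel"
    using plancherel(1)[OF h] borel_lebesgue_transfer(1)[OF m(1)] by simp
  have "integrable lborel (\<lambda>x. (cmod (inverse_fourier h x))\<^sup>2)"
    using lborel_integrable_real_affine[OF L2_integrable[OF *], of "-1" 0]
    by (simp add: inverse_fourier_def)
  then show "inverse_fourier h \<in> L2 lebesgue"
    using borel_lebesgue_transfer(1)[OF m(2)] m(2) by (simp add: L2_def)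
  have "norm2 lborel (inverse_fourier h) = norm2 lborel (fourier_integral h)"
    using lborel_integral_real_affine[of "-1" "\<lambda>x. (cmod (fourier_integral h x))\<^sup>2" 0]
    by (simp add: norm2_def inverse_fourier_def)
  then show "norm2 lebesgue (inverse_fourier h) = norm2 lebesgue h"
    using plancherel(2)[OF h] borel_lebesgue_transfer(2)[OF m(1)] borel_lebesgue_transfer(2)[OF m(2)] by simp
qed

text \<open>The multiplication formula applied to the conjugate of h: conjugation reverses the sign
  of the frequency, which is the reflection in \<open>inverse_fourier\<close>.\<close>

lemma fourier_integral_adjoint:
  assumes f: "integrable lebesgue f" and h: "integrable lebesgue h"
  shows "inner2 lebesgue (fourier_integral f) h = inner2 lebesgue f (inverse_fourier h)"
proof -
  have fm: "f \<in> borel_measurable lebesgue" and hm: "h \<in> borel_measurable lebesgue" using f h by auto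
  obtain f' where f': "f' \<in> borel_measurable borel" "AE x in lebesgue. f x = f' x"
    using borel_representative[OF fm] .
  obtain h' where h': "h' \<in> borel_measurable borel" "AE x in lebesgue. h x = h' x"
    using borel_representative[OF hm] .
  note [measurable] = f'(1) h'(1)
  have lm: "g \<in> borel_measurable lebesgue" if "g \<in> borel_measurable borel" for g :: "real \<Rightarrow> complex"
    using measurable_lebesgue_borel[OF that] .
  have fi: "integrable lborel f'"
    using integrable_cong_AE_imp[OF f lm[OF f'(1)]] f'(2) borel_lebesgue_transfer(3)[OF f'(1)] by auto
  have hi: "integrable lborel h'"
    using integrable_cong_AE_imp[OF h lm[OF h'(1)]] h'(2) borel_lebesgue_transfer(3)[OF h'(1)] by auto
  have chi: "integrable lborel (\<lambda>x. cnj (h' x))" using hi by simp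
  let ?c = "complex_of_real (1 / sqrt (2 * pi))"
  have cF: "fourier_lborel (\<lambda>x. cnj (h' x)) x = cnj (fourier_lborel h' (- x))" for x
    unfolding fourier_lborel_def
    by (subst Bochner_Integration.integral_cnj[symmetric]) (simp add: cis_cnj)
  have m1: "(\<lambda>x. ?c * fourier_lborel f' x) \<in> borel_measurable borel"
    and m2: "(\<lambda>x. ?c * fourier_lborel h' (- x)) \<in> borel_measurable borel" by measurable
  have m3: "(\<lambda>x. fourier_lborel f' x * cnj (h' x)) \<in> borel_measurable borel"
    and m4: "(\<lambda>x. f' x * cnj (fourier_lborel h' (- x))) \<in> borel_measurable borel" by measurable
  have ae: "AE x in lebesgue. f' x = f x"
    using f'(2) by (rule AE_mp) (intro AE_I2, simp)
  have "inner2 lebesgue (fourier_integral f) h = inner2 lebesgue (\<lambda>x. ?c * fourier_lborel f' x) h'"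
    unfolding fourier_integral_lborel[OF fm f']
    by (rule inner2_cong_AE[OF lm[OF m1] lm[OF m1] AE_I2[OF refl] hm lm[OF h'(1)] h'(2)])
  also have "\<dots> = ?c * (\<integral>x. fourier_lborel f' x * cnj (h' x) \<partial>lborel)"
    unfolding inner2_scale_left inner2_def borel_lebesgue_transfer(4)[OF m3] ..
  also have "(\<integral>x. fourier_lborel f' x * cnj (h' x) \<partial>lborel) = (\<integral>x. f' x * cnj (fourier_lborel h' (- x)) \<partial>lborel)"
    unfolding fourier_lborel_multiplication[OF fi chi] cF ..
  also have "?c * \<dots> = inner2 lebesgue f' (\<lambda>x. ?c * fourier_lborel h' (- x))"
    unfolding inner2_scale_right inner2_def borel_lebesgue_transfer(4)[OF m4] by simp
  also have "\<dots> = inner2 lebesgue f (inverse_fourier h)"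
    unfolding inverse_fourier_def[abs_def] fourier_integral_lborel[OF hm h']
    by (rule inner2_cong_AE[OF lm[OF f'(1)] fm ae lm[OF m2] lm[OF m2] AE_I2[OF refl]])
  finally show ?thesis .
qed

section \<open>The L2 transform: existence and duality\<close>

lemma truncate_tendsto:
  assumes f: "f \<in> L2 lebesgue"
  shows "(\<lambda>n::nat. norm2 lebesgue (\<lambda>x. f x - indicator {- real n..real n} x * f x)) \<longlonglongrightarrow> 0"
proof -
  note [measurable] = L2_measurable[OF f]
  have "(\<lambda>n::nat. norm2 lebesgue (\<lambda>x. f x - indicator {- real n..real n} x * f x)) \<longlonglongrightarrow> (\<integral>x. 0 \<partial>(lebesgue :: real measure))"
    unfolding norm2_def
  proof (rule integral_dominated_convergence[OF _ _ L2_integrable[OF f]])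
    show "AE x in lebesgue. (\<lambda>n. (cmod (f x - indicator {- real n..real n} x * f x))\<^sup>2) \<longlonglongrightarrow> 0"
    proof (intro AE_I2 tendsto_eventually eventually_sequentiallyI)
      fix x :: real and n assume "nat \<lceil>\<bar>x\<bar>\<rceil> \<le> n"
      then have "\<bar>x\<bar> \<le> real n" by linarith
      then have "x \<in> {- real n..real n}" by auto
      then show "(cmod (f x - indicator {- real n..real n} x * f x))\<^sup>2 = 0" by simp
    qed
    show "AE x in lebesgue. norm ((cmod (f x - indicator {- real n..real n} x * f x))\<^sup>2) \<le> (cmod (f x))\<^sup>2" for n
      by (intro AE_I2) (auto simp: indicator_def)
    show "(\<lambda>x. (cmod (f x - indicator {- real n..real n} x * f x))\<^sup>2) \<in> borel_measurable lebesgue" for n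
      using L2_diff[OF f L2_restrict[OF f, of "{- real n..real n}"]] by (auto dest!: L2_measurable)
  qed simp
  then show ?thesis by simp
qed

text \<open>By Plancherel for the truncations all differences lie in L2, so the extended integrals
  are finite and the limit becomes one of real numbers.\<close>

lemma has_fourier_transform_iff:
  "has_fourier_transform f g \<longleftrightarrow> f \<in> L2 lebesgue \<and> g \<in> L2 lebesgue \<and>
     (\<lambda>n::nat. norm2 lebesgue (\<lambda>\<xi>. g \<xi> - fourier_integral (\<lambda>t. indicator {- real n..real n} t * f t) \<xi>)) \<longlonglongrightarrow> 0"
proof (cases "f \<in> L2 lebesgue \<and> g \<in> L2 lebesgue")
  case True
  have "(\<lambda>\<xi>. g \<xi> - fourier_integral (\<lambda>t. indicator {- real n..real n} t * f t) \<xi>) \<in> L2 lebesgue" for n :: nat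
    using True plancherel(1)[OF L2_bounded_support_truncate] by (intro L2_diff) auto
  then have "(\<integral>\<^sup>+ \<xi>. ennreal ((norm (g \<xi> - fourier_integral (\<lambda>t. indicator {- real n..real n} t * f t) \<xi>))\<^sup>2) \<partial>lebesgue) =
     ennreal (norm2 lebesgue (\<lambda>\<xi>. g \<xi> - fourier_integral (\<lambda>t. indicator {- real n..real n} t * f t) \<xi>))" for n :: nat
    by (rule L2_nn_integral)
  then show ?thesis
    unfolding has_fourier_transform_def square_integrable_eq_L2
    by (simp add: norm2_nonneg ennreal_0[symmetric] del: ennreal_0)
qed (auto simp: has_fourier_transform_def square_integrable_eq_L2)

text \<open>Plancherel for differences of truncations carries the Cauchy property over to the
  transforms; completeness of L2 supplies the limit.\<close>

lemma has_fourier_transform_exists: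
  assumes f: "f \<in> L2 lebesgue"
  obtains g where "has_fourier_transform f g"
proof -
  define t where "t n = (\<lambda>x. indicator {- real n..real n} x * f x)" for n
  have t: "t n \<in> L2_bounded_support" for n unfolding t_def by (rule L2_bounded_support_truncate[OF f])
  have td: "norm2 lebesgue (\<lambda>x. fourier_integral (t m) x - fourier_integral (t n) x) = norm2 lebesgue (\<lambda>x. t m x - t n x)" for m n
    unfolding plancherel(2)[OF L2_bounded_support_diff[OF t[of m] t[of n]], symmetric]
      fourier_integral_diff[OF L2_bounded_support_integrable[OF t[of m]] L2_bounded_support_integrable[OF t[of n]], symmetric]
    ..
  have "\<exists>N. \<forall>m\<ge>N. \<forall>n\<ge>N. norm2 lebesgue (\<lambda>x. fourier_integral (t m) x - fourier_integral (t n) x) < e" if e: "e > 0" for e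
  proof -
    obtain N where N: "\<And>n. n \<ge> N \<Longrightarrow> norm (norm2 lebesgue (\<lambda>x. f x - t n x) - 0) < e"
      using LIMSEQ_D[OF truncate_tendsto[OF f] e] unfolding t_def by blast
    \<comment> \<open>Two truncations agree on the smaller window, and outside it their difference
      is 0 or f up to sign; hence the tail beyond the smaller window.\<close>
    have le: "norm2 lebesgue (\<lambda>x. t m x - t n x) \<le> norm2 lebesgue (\<lambda>x. f x - t (min m n) x)" for m n
      using L2_bounded_support_L2[OF t] f
      by (intro norm2_mono L2_diff) (auto simp: t_def indicator_def)
    have "norm2 lebesgue (\<lambda>x. t m x - t n x) < e" if "m \<ge> N" "n \<ge> N" for m n
      using le[of m n] N[of "min m n"] that by (auto simp: abs_if split: if_splits)
    then show ?thesis unfolding td by blast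
  qed
  then obtain g where "g \<in> L2 lebesgue" "(\<lambda>n. norm2 lebesgue (\<lambda>x. g x - fourier_integral (t n) x)) \<longlonglongrightarrow> 0"
    using L2_complete[of "\<lambda>n. fourier_integral (t n)" lebesgue] plancherel(1)[OF t] by metis
  then show ?thesis using f that unfolding has_fourier_transform_iff t_def by blast
qed

text \<open>The adjoint relation passes to the limit along the truncations. It converts statements
  about the support of g into orthogonality relations for f.\<close>

lemma has_fourier_transform_adjoint:
  assumes fg: "has_fourier_transform f g" and h: "h \<in> L2_bounded_support"
  shows "inner2 lebesgue g h = inner2 lebesgue f (inverse_fourier h)"
proof -
  define t where "t n = (\<lambda>x. indicator {- real n..real n} x * f x)" for n :: nat
  have f: "f \<in> L2 lebesgue" and g: "g \<in> L2 lebesgue"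
    and lim: "(\<lambda>n. norm2 lebesgue (\<lambda>\<xi>. g \<xi> - fourier_integral (t n) \<xi>)) \<longlonglongrightarrow> 0"
    using fg unfolding has_fourier_transform_iff t_def by auto
  have t: "t n \<in> L2_bounded_support" for n unfolding t_def by (rule L2_bounded_support_truncate[OF f])
  have "(\<lambda>n. inner2 lebesgue (fourier_integral (t n)) h) \<longlonglongrightarrow> inner2 lebesgue g h"
    by (rule inner2_tendsto_left[OF plancherel(1)[OF t] g L2_bounded_support_L2[OF h] lim])
  moreover have "(\<lambda>n. inner2 lebesgue (t n) (inverse_fourier h)) \<longlonglongrightarrow> inner2 lebesgue f (inverse_fourier h)"
    by (rule inner2_tendsto_left[OF L2_bounded_support_L2[OF t] f inverse_fourier_L2(1)[OF h]])
       (use truncate_tendsto[OF f] in \<open>simp add: t_def\<close>)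
  moreover have "inner2 lebesgue (fourier_integral (t n)) h = inner2 lebesgue (t n) (inverse_fourier h)" for n
    by (rule fourier_integral_adjoint[OF L2_bounded_support_integrable[OF t] L2_bounded_support_integrable[OF h]])
  ultimately show ?thesis using LIMSEQ_unique by auto
qed

subsection \<open>Band-limited functions\<close>

lemma AE_zero_of_truncations:
  assumes "\<And>n::nat. AE x in M. indicator {- real n..real n} x * f x = (0::complex)"
  shows "AE x in M. f x = 0"
proof -
  have "AE x in M. \<forall>n::nat. indicator {- real n..real n} x * f x = 0"
    using assms unfolding AE_all_countable by blast
  then show ?thesis
  proof eventually_elim
    fix x :: real assume *: "\<forall>n::nat. indicator {- real n..real n} x * f x = 0"
    obtain n :: nat where "\<bar>x\<bar> \<le> real n" using real_arch_simple by blast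
    then have "x \<in> {- real n..real n}" by auto
    then show "f x = 0" using spec[OF *, of n] by simp
  qed
qed

text \<open>Only test functions of bounded support are available, so d is tested against its own
  truncations, each of which then has norm 0.\<close>

lemma L2_zero_if_orthogonal_truncations:
  assumes d: "d \<in> L2 lebesgue"
    and orth: "\<And>n::nat. inner2 lebesgue d (\<lambda>x. indicator {- real n..real n} x * d x) = 0"
  shows "AE x in lebesgue. d x = 0"
proof (rule AE_zero_of_truncations)
  fix n :: nat
  let ?v = "\<lambda>x. indicator {- real n..real n} x * d x"
  have v: "?v \<in> L2 lebesgue" by (rule L2_restrict[OF d]) simp
  have "inner2 lebesgue d ?v = inner2 lebesgue ?v ?v"
    unfolding inner2_def by (rule Bochner_Integration.integral_cong) (auto simp: indicator_def)
  then have "norm2 lebesgue ?v = 0" using orth[of n] inner2_self[of lebesgue ?v] by simp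
  then show "AE x in lebesgue. indicator {- real n..real n} x * d x = 0"
    using norm2_eq_0_iff[OF v] by simp
qed

text \<open>In this form the Paley--Wiener space is visibly a subspace closed under weak limits.\<close>

lemma paley_wiener_iff:
  "f \<in> paley_wiener \<longleftrightarrow> f \<in> L2 lebesgue \<and>
     (\<forall>h\<in>L2_bounded_support. (\<forall>\<xi>\<in>{-pi..pi}. h \<xi> = 0) \<longrightarrow> inner2 lebesgue f (inverse_fourier h) = 0)"
proof safe
  assume f: "f \<in> paley_wiener"
  then show "f \<in> L2 lebesgue" by (simp add: paley_wiener_def square_integrable_eq_L2)
  fix h assume h: "h \<in> L2_bounded_support" "\<forall>\<xi>\<in>{-pi..pi}. h \<xi> = 0"
  obtain g where g: "has_fourier_transform f g" "AE \<xi> in lebesgue. \<xi> \<notin> {-pi..pi} \<longrightarrow> g \<xi> = 0"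
    using f by (auto simp: paley_wiener_def)
  have "inner2 lebesgue g h = 0"
    unfolding inner2_def
  proof (rule integral_eq_zero_AE, use g(2) in eventually_elim)
    fix \<xi> assume "\<xi> \<notin> {-pi..pi} \<longrightarrow> g \<xi> = 0"
    then show "g \<xi> * cnj (h \<xi>) = 0" using h(2) by (cases "\<xi> \<in> {-pi..pi}") auto
  qed
  then show "inner2 lebesgue f (inverse_fourier h) = 0"
    using has_fourier_transform_adjoint[OF g(1) h(1)] by simp
next
  assume f: "f \<in> L2 lebesgue"
    and orth: "\<forall>h\<in>L2_bounded_support. (\<forall>\<xi>\<in>{-pi..pi}. h \<xi> = 0) \<longrightarrow> inner2 lebesgue f (inverse_fourier h) = 0"
  obtain g where g: "has_fourier_transform f g" using has_fourier_transform_exists[OF f] .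
  have g2: "g \<in> L2 lebesgue" using g by (simp add: has_fourier_transform_iff)
  \<comment> \<open>The part of the transform outside the band. Its truncations vanish on the band
    and are therefore admissible tests.\<close>
  define d where "d = (\<lambda>\<xi>. indicator (- {-pi..pi}) \<xi> * g \<xi>)"
  have d: "d \<in> L2 lebesgue" unfolding d_def by (rule L2_restrict[OF g2]) simp
  have "AE \<xi> in lebesgue. d \<xi> = 0"
  proof (rule L2_zero_if_orthogonal_truncations[OF d])
    fix n :: nat
    let ?v = "\<lambda>x. indicator {- real n..real n} x * d x"
    have v: "?v \<in> L2_bounded_support" by (rule L2_bounded_support_truncate[OF d])
    have "inner2 lebesgue d ?v = inner2 lebesgue g ?v"
      unfolding inner2_def by (rule Bochner_Integration.integral_cong) (auto simp: d_def indicator_def)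
    also have "\<dots> = inner2 lebesgue f (inverse_fourier ?v)" by (rule has_fourier_transform_adjoint[OF g v])
    also have "\<dots> = 0" using orth v by (auto simp: d_def)
    finally show "inner2 lebesgue d ?v = 0" .
  qed
  then have "AE \<xi> in lebesgue. \<xi> \<notin> {-pi..pi} \<longrightarrow> g \<xi> = 0"
    by eventually_elim (auto simp: d_def)
  then show "f \<in> paley_wiener" using f g by (auto simp: paley_wiener_def square_integrable_eq_L2)
qed

text \<open>Vanishing off the band is required everywhere, so pointwise estimates that use |\<xi>|
  \<le> pi have no exceptional set.\<close>

definition band_spectra :: "(real \<Rightarrow> complex) set" where
  "band_spectra = {g \<in> L2 lebesgue. \<forall>\<xi>. \<xi> \<notin> {-pi..pi} \<longrightarrow> g \<xi> = 0}"

text \<open>The continuous representatives of the elements of the Paley--Wiener space.\<close>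

definition band_limited :: "(real \<Rightarrow> complex) set" where
  "band_limited = inverse_fourier ` band_spectra"

lemma band_spectra_bounded_support: "g \<in> band_spectra \<Longrightarrow> g \<in> L2_bounded_support"
  by (auto simp: band_spectra_def L2_bounded_support_def)

lemma band_limited_L2: "F \<in> band_limited \<Longrightarrow> F \<in> L2 lebesgue"
  unfolding band_limited_def using inverse_fourier_L2(1) band_spectra_bounded_support by blast

lemma inverse_fourier_parseval:
  assumes u: "u \<in> L2_bounded_support" and v: "v \<in> L2_bounded_support"
  shows "inner2 lebesgue (inverse_fourier u) (inverse_fourier v) = inner2 lebesgue u v"
proof -
  have "inner2 lebesgue (inverse_fourier u) (inverse_fourier v) = inner2 lebesgue (fourier_integral u) (fourier_integral v)"
    unfolding inner2_def inverse_fourier_def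
    using lebesgue_integral_real_affine[of "-1" "\<lambda>x. fourier_integral u x * cnj (fourier_integral v x)" 0] by simp
  then show ?thesis using parseval[OF u v] by simp
qed

text \<open>Parseval turns each test into an inner product of two spectra with disjoint
  supports.\<close>

lemma band_limited_paley_wiener:
  assumes "F \<in> band_limited"
  shows "F \<in> paley_wiener"
  unfolding paley_wiener_iff
proof (intro conjI ballI impI)
  show "F \<in> L2 lebesgue" by (rule band_limited_L2[OF assms])
  fix h assume h: "h \<in> L2_bounded_support" "\<forall>\<xi>\<in>{-pi..pi}. h \<xi> = 0"
  obtain g where g: "g \<in> band_spectra" "F = inverse_fourier g" using assms by (auto simp: band_limited_def)
  have "inner2 lebesgue F (inverse_fourier h) = inner2 lebesgue g h"
    unfolding g(2) by (rule inverse_fourier_parseval[OF band_spectra_bounded_support[OF g(1)] h(1)])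
  also have "\<dots> = (\<integral>x. 0 \<partial>(lebesgue :: real measure))"
    unfolding inner2_def
  proof (rule Bochner_Integration.integral_cong)
    show "g x * cnj (h x) = 0" for x
      using g(1) h(2) by (cases "x \<in> {-pi..pi}") (auto simp: band_spectra_def)
  qed simp
  finally show "inner2 lebesgue F (inverse_fourier h) = 0" by simp
qed

text \<open>Fourier inversion in weak form: Parseval for the truncations of f, the limit, and the
  adjoint relation show that f and the inverse transform F of its spectrum have the same inner
  product with every L2 function of bounded support.\<close>

lemma paley_wiener_representative:
  assumes f: "f \<in> paley_wiener"
  obtains F where "F \<in> band_limited" "AE x in lebesgue. f x = F x"
proof -
  obtain g0 where g0: "has_fourier_transform f g0" "AE \<xi> in lebesgue. \<xi> \<notin> {-pi..pi} \<longrightarrow> g0 \<xi> = 0"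
    using f by (auto simp: paley_wiener_def)
  have f2: "f \<in> L2 lebesgue" and g02: "g0 \<in> L2 lebesgue" using g0(1) by (auto simp: has_fourier_transform_iff)
  define g where "g = (\<lambda>\<xi>. indicator {-pi..pi} \<xi> * g0 \<xi>)"
  have g2: "g \<in> L2 lebesgue" unfolding g_def by (rule L2_restrict[OF g02]) simp
  have g: "g \<in> band_spectra" using g2 by (auto simp: band_spectra_def g_def)
  have ae: "AE \<xi> in lebesgue. g0 \<xi> = g \<xi>"
    using g0(2) by eventually_elim (auto simp: g_def indicator_def)
  define F where "F = inverse_fourier g"
  have F: "F \<in> band_limited" using g by (simp add: F_def band_limited_def)
  note F2 = band_limited_L2[OF F]
  define t where "t n = (\<lambda>x. indicator {- real n..real n} x * f x)" for n :: nat
  have t: "t n \<in> L2_bounded_support" for n unfolding t_def by (rule L2_bounded_support_truncate[OF f2])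
  have key: "inner2 lebesgue f v = inner2 lebesgue F v" if v: "v \<in> L2_bounded_support" for v
  proof -
    have "(\<lambda>n. inner2 lebesgue (t n) v) \<longlonglongrightarrow> inner2 lebesgue f v"
      by (rule inner2_tendsto_left[OF L2_bounded_support_L2[OF t] f2 L2_bounded_support_L2[OF v]])
         (use truncate_tendsto[OF f2] in \<open>simp add: t_def\<close>)
    moreover have "(\<lambda>n. inner2 lebesgue (fourier_integral (t n)) (fourier_integral v)) \<longlonglongrightarrow> inner2 lebesgue g0 (fourier_integral v)"
      by (rule inner2_tendsto_left[OF plancherel(1)[OF t] g02 plancherel(1)[OF v]])
         (use g0(1) in \<open>simp add: has_fourier_transform_iff t_def\<close>)
    ultimately have "inner2 lebesgue f v = inner2 lebesgue g0 (fourier_integral v)"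
      unfolding parseval[OF t v] by (rule LIMSEQ_unique)
    also have "\<dots> = inner2 lebesgue g (fourier_integral v)"
      by (rule inner2_cong_AE[OF L2_measurable[OF g02] L2_measurable[OF g2] ae _ _ AE_I2[OF refl]])
         (rule L2_measurable[OF plancherel(1)[OF v]])+
    also have "\<dots> = cnj (inner2 lebesgue (fourier_integral v) g)" by (simp add: inner2_cnj)
    also have "\<dots> = cnj (inner2 lebesgue v F)"
      unfolding F_def fourier_integral_adjoint[OF L2_bounded_support_integrable[OF v]
          L2_bounded_support_integrable[OF band_spectra_bounded_support[OF g]]] ..
    finally show ?thesis by (simp add: inner2_cnj)
  qed
  define d where "d = (\<lambda>x. f x - F x)"
  have d: "d \<in> L2 lebesgue" unfolding d_def by (rule L2_diff[OF f2 F2])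
  have "AE x in lebesgue. d x = 0"
  proof (rule L2_zero_if_orthogonal_truncations[OF d])
    fix n :: nat
    have v: "(\<lambda>x. indicator {- real n..real n} x * d x) \<in> L2_bounded_support"
      by (rule L2_bounded_support_truncate[OF d])
    show "inner2 lebesgue d (\<lambda>x. indicator {- real n..real n} x * d x) = 0"
      using key[OF v] inner2_diff_left[OF f2 F2 L2_bounded_support_L2[OF v]] by (simp add: d_def)
  qed
  then have "AE x in lebesgue. f x = F x" by eventually_elim (simp add: d_def)
  with F show ?thesis by (rule that)
qed

section \<open>Linear structure and closedness of the Paley--Wiener space\<close>

lemma paley_wiener_L2: "f \<in> paley_wiener \<Longrightarrow> f \<in> L2 lebesgue"
  by (simp add: paley_wiener_iff)

lemma paley_wiener_add:
  assumes "f \<in> paley_wiener" "g \<in> paley_wiener"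
  shows "(\<lambda>x. f x + g x) \<in> paley_wiener"
  using assms unfolding paley_wiener_iff
  by (auto simp: L2_add inner2_add_left inverse_fourier_L2)

lemma paley_wiener_scale: "f \<in> paley_wiener \<Longrightarrow> (\<lambda>x. c * f x) \<in> paley_wiener"
  unfolding paley_wiener_iff by (auto simp: L2_scale inner2_scale_left)

lemma paley_wiener_diff:
  assumes "f \<in> paley_wiener" "g \<in> paley_wiener"
  shows "(\<lambda>x. f x - g x) \<in> paley_wiener"
  using paley_wiener_add[OF assms(1) paley_wiener_scale[OF assms(2), of "-1"]] by simp

text \<open>Boundedness and almost everywhere convergence give weak convergence, and every condition
  in \<open>paley_wiener_iff\<close> is an inner product with a fixed L2 function.\<close>

lemma paley_wiener_closed:
  assumes f: "\<And>n. f n \<in> paley_wiener" and g: "g \<in> borel_measurable lebesgue"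
    and lim: "AE x in lebesgue. (\<lambda>n. f n x) \<longlonglongrightarrow> g x" and bd: "\<And>n. norm2 lebesgue (f n) \<le> C"
  shows "g \<in> paley_wiener" "norm2 lebesgue g \<le> C"
proof -
  have C: "C \<ge> 0" using bd[of 0] norm2_nonneg[of lebesgue "f 0"] by linarith
  note F = norm2_Fatou[OF paley_wiener_L2[OF f] g lim always_eventually[OF allI[OF bd]] C]
  show "norm2 lebesgue g \<le> C" by (rule F(2))
  show "g \<in> paley_wiener" unfolding paley_wiener_iff
  proof (intro conjI ballI impI F(1))
    fix h assume h: "h \<in> L2_bounded_support" "\<forall>\<xi>\<in>{-pi..pi}. h \<xi> = 0"
    have "(\<lambda>n. inner2 lebesgue (f n) (inverse_fourier h)) \<longlonglongrightarrow> inner2 lebesgue g (inverse_fourier h)"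
      by (rule inner2_weak_tendsto[OF paley_wiener_L2[OF f] g inverse_fourier_L2(1)[OF h(1)] lim bd])
    moreover have "inner2 lebesgue (f n) (inverse_fourier h) = 0" for n
      using f[of n] h unfolding paley_wiener_iff by blast
    ultimately show "inner2 lebesgue g (inverse_fourier h) = 0" by (simp add: LIMSEQ_const_iff)
  qed
qed

section \<open>Entire extensions and pointwise estimates\<close>

definition entire_extension :: "(real \<Rightarrow> complex) \<Rightarrow> complex \<Rightarrow> complex" where
  "entire_extension g z = of_real (1 / sqrt (2 * pi)) * (\<integral>\<xi>. g \<xi> * exp (\<i> * of_real \<xi> * z) \<partial>lebesgue)"

lemma band_spectra_integrable: "g \<in> band_spectra \<Longrightarrow> integrable lebesgue g"
  by (intro L2_bounded_support_integrable band_spectra_bounded_support)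

text \<open>The inversion integral keeps its meaning at complex points because the spectrum is
  bounded; on the real line nothing changes.\<close>

lemma entire_extension_of_real: "entire_extension g (of_real x) = inverse_fourier g x"
  unfolding entire_extension_def inverse_fourier_def fourier_integral_def by (simp add: mult_ac)

text \<open>Cauchy--Schwarz against the indicator of the band, whose squared norm 2 pi cancels the
  normalization of the transform exactly. This is why the later bounds have no extra
  constant.\<close>

lemma L1_le_norm2_band:
  assumes g: "g \<in> band_spectra"
  shows "(1 / sqrt (2 * pi)) * (\<integral>\<xi>. cmod (g \<xi>) \<partial>lebesgue) \<le> sqrt (norm2 lebesgue g)"
proof -
  define I :: "real \<Rightarrow> complex" where "I = indicator {-pi..pi}"
  have Im: "I \<in> borel_measurable lebesgue"
    unfolding I_def by (intro measurable_lebesgue_borel) measurable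
  have I1: "(cmod (I x))\<^sup>2 = indicator {-pi..pi} x" for x by (auto simp: I_def indicator_def)
  have "I \<in> L2 lebesgue" unfolding L2_def using Im by (simp add: I1 integrable_indicator_iff emeasure_lborel_Icc_eq)
  moreover have "norm2 lebesgue I = 2 * pi" unfolding norm2_def I1 by simp
  moreover have "g \<in> L2 lebesgue" using g by (simp add: band_spectra_def)
  ultimately have "(\<integral>\<xi>. cmod (g \<xi>) * cmod (I \<xi>) \<partial>lebesgue)\<^sup>2 \<le> norm2 lebesgue g * (2 * pi)"
    using Cauchy_Schwarz_L2_norm[of g lebesgue I] by simp
  also have "(\<integral>\<xi>. cmod (g \<xi>) * cmod (I \<xi>) \<partial>lebesgue) = (\<integral>\<xi>. cmod (g \<xi>) \<partial>lebesgue)"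
    using g by (intro Bochner_Integration.integral_cong) (auto simp: I_def indicator_def band_spectra_def)
  finally have "(\<integral>\<xi>. cmod (g \<xi>) \<partial>lebesgue) \<le> sqrt (norm2 lebesgue g * (2 * pi))"
    by (rule real_le_rsqrt)
  then show ?thesis by (simp add: real_sqrt_mult field_simps)
qed

text \<open>The exponential is expanded and integrated term by term. On the band the n-th term is at
  most |g| (pi |w|)^n / n!, which sums; the result is a power series converging everywhere.\<close>

lemma entire_extension_holomorphic:
  assumes g: "g \<in> band_spectra"
  shows "entire_extension g holomorphic_on UNIV"
proof -
  have gm [measurable]: "g \<in> borel_measurable lebesgue" using g L2_measurable by (auto simp: band_spectra_def)
  have idm: "(\<lambda>\<xi>::real. \<xi>) \<in> borel_measurable lebesgue" by (rule measurable_lebesgue_borel) simp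
  have gi: "integrable lebesgue (\<lambda>\<xi>. cmod (g \<xi>))" using band_spectra_integrable[OF g] by simp
  define a where "a n = of_real (1 / sqrt (2 * pi)) * (\<integral>\<xi>. g \<xi> * (\<i> * of_real \<xi>) ^ n /\<^sub>R fact n \<partial>lebesgue)" for n
  have sums: "(\<lambda>n. a n * (w - 0) ^ n) sums entire_extension g w" for w
  proof -
    define f where "f n \<xi> = g \<xi> * ((\<i> * of_real \<xi> * w) ^ n /\<^sub>R fact n)" for n \<xi>
    define b where "b n = (pi * cmod w) ^ n /\<^sub>R fact n" for n
    have b: "summable b" unfolding b_def by (rule summable_exp_generic)
    have fb: "cmod (f n \<xi>) \<le> cmod (g \<xi>) * b n" for n \<xi>
    proof (cases "\<xi> \<in> {-pi..pi}")
      case True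
      then have "\<bar>\<xi>\<bar> \<le> pi" by auto
      then have "(\<bar>\<xi>\<bar> * cmod w) ^ n \<le> (pi * cmod w) ^ n"
        by (intro power_mono mult_right_mono) auto
      then show ?thesis
        unfolding f_def b_def by (auto simp: norm_mult norm_power intro!: mult_left_mono divide_right_mono)
    next
      case False
      then show ?thesis using g by (simp add: f_def band_spectra_def)
    qed
    have fm: "f n \<in> borel_measurable lebesgue" for n
      unfolding f_def using gm idm by measurable
    have fi: "integrable lebesgue (f n)" for n
      by (rule Bochner_Integration.integrable_bound[OF integrable_mult_left[OF gi, of "b n"] fm])
         (use fb in \<open>auto intro!: AE_I2 order.trans[OF _ abs_ge_self]\<close>)
    have "(\<lambda>n. integral\<^sup>L lebesgue (f n)) sums (\<integral>\<xi>. (\<Sum>n. f n \<xi>) \<partial>lebesgue)"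
    proof (rule sums_integral[OF fi])
      show "AE \<xi> in lebesgue. summable (\<lambda>n. norm (f n \<xi>))"
      proof (rule AE_I2)
        fix \<xi>
        show "summable (\<lambda>n. norm (f n \<xi>))"
          by (rule summable_comparison_test'[OF summable_mult[OF b, of "cmod (g \<xi>)"], of 0]) (use fb in simp)
      qed
      have "(\<integral>\<xi>. norm (f n \<xi>) \<partial>lebesgue) \<le> (\<integral>\<xi>. cmod (g \<xi>) \<partial>lebesgue) * b n" for n
        using integral_mono[OF integrable_norm[OF fi] integrable_mult_left[OF gi, of "b n"] fb] by simp
      then show "summable (\<lambda>n. \<integral>\<xi>. norm (f n \<xi>) \<partial>lebesgue)"
        by (intro summable_comparison_test'[OF summable_mult[OF b, of "\<integral>\<xi>. cmod (g \<xi>) \<partial>lebesgue"], of 0]) simp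
    qed
    moreover have "(\<Sum>n. f n \<xi>) = g \<xi> * exp (\<i> * of_real \<xi> * w)" for \<xi>
      unfolding f_def using sums_mult[OF exp_converges] by (intro sums_unique[symmetric])
    ultimately have "(\<lambda>n. of_real (1 / sqrt (2 * pi)) * integral\<^sup>L lebesgue (f n)) sums entire_extension g w"
      unfolding entire_extension_def by (intro sums_mult) simp
    moreover have "integral\<^sup>L lebesgue (f n) = (\<integral>\<xi>. g \<xi> * (\<i> * of_real \<xi>) ^ n /\<^sub>R fact n \<partial>lebesgue) * w ^ n" for n
      unfolding f_def
      by (subst Bochner_Integration.integral_mult_left_zero[symmetric]) (simp add: power_mult_distrib mult_ac)
    ultimately show ?thesis unfolding a_def by (simp add: mult.assoc)
  qed
  have "entire_extension g holomorphic_on ball 0 r" for r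
    using power_series_holomorphic[of 0 r a "entire_extension g"] sums by blast
  then have "entire_extension g field_differentiable at z" for z
    using holomorphic_on_imp_differentiable_at[of _ "ball 0 (cmod z + 1)" z] by (simp add: add_pos_nonneg)
  then show ?thesis by (simp add: holomorphic_on_def field_differentiable_at_within)
qed

text \<open>The bound depends on g only through its norm, so it is uniform over a bounded family:
  the local boundedness that Montel's theorem asks for.\<close>

lemma entire_extension_bound:
  assumes g: "g \<in> band_spectra"
  shows "cmod (entire_extension g z) \<le> sqrt (norm2 lebesgue g) * exp (pi * cmod z)"
proof -
  have gi: "integrable lebesgue (\<lambda>\<xi>. cmod (g \<xi>))" using band_spectra_integrable[OF g] by simp
  have gm [measurable]: "g \<in> borel_measurable lebesgue" using g L2_measurable by (auto simp: band_spectra_def)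
  have idm: "(\<lambda>\<xi>::real. \<xi>) \<in> borel_measurable lebesgue" by (rule measurable_lebesgue_borel) simp
  have pt: "cmod (g \<xi> * exp (\<i> * of_real \<xi> * z)) \<le> cmod (g \<xi>) * exp (pi * cmod z)" for \<xi>
  proof (cases "\<xi> \<in> {-pi..pi}")
    case True
    then have "\<bar>\<xi>\<bar> * cmod z \<le> pi * cmod z" by (intro mult_right_mono) auto
    moreover have "cmod (exp (\<i> * of_real \<xi> * z)) \<le> exp (\<bar>\<xi>\<bar> * cmod z)"
      using norm_exp[of "\<i> * of_real \<xi> * z"] by (simp add: norm_mult)
    ultimately have "cmod (exp (\<i> * of_real \<xi> * z)) \<le> exp (pi * cmod z)"
      by (meson exp_le_cancel_iff order.trans)
    then show ?thesis by (auto simp: norm_mult intro: mult_left_mono)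
  next
    case False
    then show ?thesis using g by (simp add: band_spectra_def)
  qed
  have fm: "(\<lambda>\<xi>. g \<xi> * exp (\<i> * of_real \<xi> * z)) \<in> borel_measurable lebesgue"
    using gm idm by measurable
  have gie: "integrable lebesgue (\<lambda>\<xi>. cmod (g \<xi>) * exp (pi * cmod z))" using gi by simp
  have fi: "integrable lebesgue (\<lambda>\<xi>. g \<xi> * exp (\<i> * of_real \<xi> * z))"
    by (rule Bochner_Integration.integrable_bound[OF gie fm]) (use pt in auto)
  have "cmod (\<integral>\<xi>. g \<xi> * exp (\<i> * of_real \<xi> * z) \<partial>lebesgue) \<le> (\<integral>\<xi>. cmod (g \<xi>) * exp (pi * cmod z) \<partial>lebesgue)"
    by (rule Bochner_Integration.integral_norm_bound_integral[OF fi gie pt])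
  then have "cmod (entire_extension g z) \<le> 1 / sqrt (2 * pi) * ((\<integral>\<xi>. cmod (g \<xi>) \<partial>lebesgue) * exp (pi * cmod z))"
    unfolding entire_extension_def by (simp add: norm_mult norm_divide divide_right_mono)
  also have "\<dots> = 1 / sqrt (2 * pi) * (\<integral>\<xi>. cmod (g \<xi>) \<partial>lebesgue) * exp (pi * cmod z)" by simp
  also have "\<dots> \<le> sqrt (norm2 lebesgue g) * exp (pi * cmod z)"
    by (intro mult_right_mono L1_le_norm2_band[OF g]) simp
  finally show ?thesis .
qed

text \<open>Both bounds reduce to the L1 norm of the spectrum. The factor pi in the Lipschitz
  constant is the largest frequency in the band.\<close>

lemma band_limited_estimates:
  assumes F: "F \<in> band_limited"
  shows band_limited_lipschitz: "cmod (F x - F y) \<le> pi * sqrt (norm2 lebesgue F) * \<bar>x - y\<bar>"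
    and band_limited_bounded: "cmod (F x) \<le> sqrt (norm2 lebesgue F)"
proof -
  obtain g where g: "g \<in> band_spectra" and Fg: "F = inverse_fourier g" using F by (auto simp: band_limited_def)
  have nF: "norm2 lebesgue F = norm2 lebesgue g"
    unfolding Fg by (rule inverse_fourier_L2(2)[OF band_spectra_bounded_support[OF g]])
  have gint: "integrable lebesgue g" by (rule band_spectra_integrable[OF g])
  then have gi: "integrable lebesgue (\<lambda>\<xi>. cmod (g \<xi>))" by simp
  have cm: "(\<lambda>\<xi>. - (- x * \<xi>)) \<in> borel_measurable lebesgue" for x :: real
    by (intro measurable_lebesgue_borel) measurable
  have fi: "integrable lebesgue (\<lambda>\<xi>. g \<xi> * cis (- (- x * \<xi>)))" for x :: real
    using integrable_mult_cis[OF gint cm] .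
  have Fx: "F x = of_real (1 / sqrt (2 * pi)) * (\<integral>\<xi>. g \<xi> * cis (- (- x * \<xi>)) \<partial>lebesgue)" for x
    unfolding Fg inverse_fourier_def fourier_integral_cis ..
  have cis_lip: "cmod (cis a - cis b) \<le> \<bar>a - b\<bar>" for a b
  proof -
    have "cis a - cis b = cis b * (iexp (a - b) - 1)"
      unfolding cis_conv_exp[symmetric] by (simp add: right_diff_distrib cis_mult)
    then show ?thesis using iexp_approx1[of "a - b" 0] by (simp add: norm_mult)
  qed
  have pt: "cmod (g \<xi> * cis (- (- x * \<xi>)) - g \<xi> * cis (- (- y * \<xi>))) \<le> cmod (g \<xi>) * (pi * \<bar>x - y\<bar>)" for \<xi>
  proof (cases "\<xi> \<in> {-pi..pi}")
    case True
    have "cmod (g \<xi> * cis (- (- x * \<xi>)) - g \<xi> * cis (- (- y * \<xi>))) = cmod (g \<xi>) * cmod (cis (x * \<xi>) - cis (y * \<xi>))"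
      unfolding right_diff_distrib[symmetric] norm_mult by simp
    also have "\<dots> \<le> cmod (g \<xi>) * \<bar>x * \<xi> - y * \<xi>\<bar>" by (intro mult_left_mono cis_lip) simp
    also have "\<bar>x * \<xi> - y * \<xi>\<bar> = \<bar>\<xi>\<bar> * \<bar>x - y\<bar>" by (simp add: abs_mult[symmetric] algebra_simps)
    also have "cmod (g \<xi>) * (\<bar>\<xi>\<bar> * \<bar>x - y\<bar>) \<le> cmod (g \<xi>) * (pi * \<bar>x - y\<bar>)"
      using True by (intro mult_left_mono mult_right_mono) auto
    finally show ?thesis .
  next
    case False
    then show ?thesis using g by (simp add: band_spectra_def)
  qed
  have "F x - F y = of_real (1 / sqrt (2 * pi)) * (\<integral>\<xi>. g \<xi> * cis (- (- x * \<xi>)) - g \<xi> * cis (- (- y * \<xi>)) \<partial>lebesgue)"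
    unfolding Fx by (simp only: Bochner_Integration.integral_diff[OF fi fi] right_diff_distrib)
  then have "cmod (F x - F y) = 1 / sqrt (2 * pi) * cmod (\<integral>\<xi>. g \<xi> * cis (- (- x * \<xi>)) - g \<xi> * cis (- (- y * \<xi>)) \<partial>lebesgue)"
    by (simp add: norm_mult norm_divide)
  also have "\<dots> \<le> 1 / sqrt (2 * pi) * (\<integral>\<xi>. cmod (g \<xi>) * (pi * \<bar>x - y\<bar>) \<partial>lebesgue)"
    by (intro mult_left_mono Bochner_Integration.integral_norm_bound_integral Bochner_Integration.integrable_diff fi pt)
       (use gi in auto)
  also have "\<dots> = (1 / sqrt (2 * pi) * (\<integral>\<xi>. cmod (g \<xi>) \<partial>lebesgue)) * (pi * \<bar>x - y\<bar>)"
    by simp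
  also have "\<dots> \<le> sqrt (norm2 lebesgue g) * (pi * \<bar>x - y\<bar>)"
    by (intro mult_right_mono L1_le_norm2_band[OF g]) simp
  finally show "cmod (F x - F y) \<le> pi * sqrt (norm2 lebesgue F) * \<bar>x - y\<bar>" unfolding nF by (simp add: mult_ac)
  have "cmod (F x) = 1 / sqrt (2 * pi) * cmod (\<integral>\<xi>. g \<xi> * cis (- (- x * \<xi>)) \<partial>lebesgue)"
    unfolding Fx by (simp add: norm_mult norm_divide)
  also have "\<dots> \<le> 1 / sqrt (2 * pi) * (\<integral>\<xi>. cmod (g \<xi>) \<partial>lebesgue)"
    by (intro mult_left_mono Bochner_Integration.integral_norm_bound_integral fi gi) (auto simp: norm_mult)
  also have "\<dots> \<le> sqrt (norm2 lebesgue g)" by (rule L1_le_norm2_band[OF g])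
  finally show "cmod (F x) \<le> sqrt (norm2 lebesgue F)" unfolding nF .
qed

lemma band_limited_continuous:
  assumes F: "F \<in> band_limited"
  shows "continuous_on UNIV F"
proof -
  obtain g where g: "g \<in> band_spectra" and Fg: "F = inverse_fourier g" using F by (auto simp: band_limited_def)
  have "continuous_on UNIV (\<lambda>x::real. entire_extension g (of_real x))"
    using holomorphic_on_imp_continuous_on[OF entire_extension_holomorphic[OF g]]
    by (rule continuous_on_compose2[OF _ continuous_on_of_real[OF continuous_on_id]]) auto
  then show ?thesis unfolding Fg entire_extension_of_real .
qed

text \<open>Translation by a multiplies the spectrum by the phase cis (a \<xi>), which preserves its
  support and modulus.\<close>

lemma band_limited_translate:
  assumes "F \<in> band_limited"
  shows "(\<lambda>x. F (x + a)) \<in> band_limited"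
proof -
  obtain g where g: "g \<in> band_spectra" and Fg: "F = inverse_fourier g" using assms by (auto simp: band_limited_def)
  have am: "(\<lambda>\<xi>. cis (a * \<xi>)) \<in> borel_measurable lebesgue"
    by (intro measurable_lebesgue_borel) measurable
  have g2: "g \<in> L2 lebesgue" using g by (simp add: band_spectra_def)
  have "(\<lambda>\<xi>. g \<xi> * cis (a * \<xi>)) \<in> L2 lebesgue"
    by (rule L2_dominated[OF g2]) (use am L2_measurable[OF g2] in \<open>auto simp: norm_mult\<close>)
  then have "(\<lambda>\<xi>. g \<xi> * cis (a * \<xi>)) \<in> band_spectra" using g by (simp add: band_spectra_def)
  moreover have "(\<lambda>x. F (x + a)) = inverse_fourier (\<lambda>\<xi>. g \<xi> * cis (a * \<xi>))"
    unfolding Fg inverse_fourier_def[abs_def] fourier_integral_cis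
    by (simp add: cis_mult mult.assoc algebra_simps)
  ultimately show ?thesis by (simp add: band_limited_def)
qed

lemma continuous_AE_eq:
  fixes f g :: "real \<Rightarrow> complex"
  assumes "continuous_on UNIV f" "continuous_on UNIV g" "AE x in lebesgue. f x = g x"
  shows "f = g"
proof -
  have "open {x. f x \<noteq> g x}" using open_Collect_neq[OF assms(1,2)] .
  moreover have "negligible {x. f x \<noteq> g x}"
    using assms(3) by (simp add: negligible_iff_null_sets AE_iff_null_sets[symmetric] completion.AE_iff_null_sets)

  ultimately have "{x. f x \<noteq> g x} = {}" using open_not_negligible by blast
  then show ?thesis by auto
qed

text \<open>Montel on the entire extensions gives convergence at every point, and closedness under
  bounded pointwise limits keeps the limit in the space. The norm may drop.\<close>

lemma band_limited_compact:
  fixes F :: "nat \<Rightarrow> real \<Rightarrow> complex"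
  assumes F: "\<And>n. F n \<in> band_limited" and bd: "\<And>n. norm2 lebesgue (F n) \<le> C"
  obtains r :: "nat \<Rightarrow> nat" and G where "strict_mono r" "G \<in> band_limited" "norm2 lebesgue G \<le> C"
    "\<And>x. (\<lambda>n. F (r n) x) \<longlonglongrightarrow> G x"
proof -
  have "\<exists>g. g \<in> band_spectra \<and> F n = inverse_fourier g" for n using F[of n] by (auto simp: band_limited_def)
  then obtain g where g: "\<And>n. g n \<in> band_spectra" and Fg: "\<And>n. F n = inverse_fourier (g n)" by metis
  have ng: "norm2 lebesgue (g n) \<le> C" for n
    using bd[of n] inverse_fourier_L2(2)[OF band_spectra_bounded_support[OF g]] by (simp add: Fg)
  obtain E r where E: "E holomorphic_on UNIV" and r: "strict_mono r"
    and lim: "\<And>z. (\<lambda>n. entire_extension (g (r n)) z) \<longlonglongrightarrow> E z"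
  proof (rule Montel[of UNIV "range (\<lambda>n. entire_extension (g n))" "\<lambda>n. entire_extension (g n)"])
    fix K :: "complex set" assume "compact K"
    then obtain R where R: "\<And>z. z \<in> K \<Longrightarrow> cmod z \<le> R" using compact_imp_bounded bounded_iff by metis
    have "cmod (entire_extension (g n) z) \<le> sqrt C * exp (pi * R)" if "z \<in> K" for n z
    proof -
      have "cmod (entire_extension (g n) z) \<le> sqrt (norm2 lebesgue (g n)) * exp (pi * cmod z)"
        by (rule entire_extension_bound[OF g])
      also have "\<dots> \<le> sqrt C * exp (pi * R)"
        using ng[of n] R[OF that] norm2_nonneg[of lebesgue "g n"]
        by (intro mult_mono) (auto simp: mult_left_mono)
      finally show ?thesis .
    qed
    then show "\<exists>B. \<forall>h\<in>range (\<lambda>n. entire_extension (g n)). \<forall>z\<in>K. cmod (h z) \<le> B" by blast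
  qed (use entire_extension_holomorphic[OF g] in auto)
  define G0 where "G0 x = E (of_real x)" for x :: real
  have G0c: "continuous_on UNIV G0"
    unfolding G0_def using holomorphic_on_imp_continuous_on[OF E]
    by (rule continuous_on_compose2[OF _ continuous_on_of_real[OF continuous_on_id]]) auto
  have G0m: "G0 \<in> borel_measurable lebesgue"
    by (intro measurable_lebesgue_borel borel_measurable_continuous_onI G0c)
  have lim0: "(\<lambda>n. F (r n) x) \<longlonglongrightarrow> G0 x" for x
    using lim[of "of_real x"] unfolding entire_extension_of_real Fg G0_def .
  have "G0 \<in> paley_wiener" and nG: "norm2 lebesgue G0 \<le> C"
    using paley_wiener_closed[of "\<lambda>n. F (r n)" G0 C] band_limited_paley_wiener[OF F] G0m lim0 bd by auto
  then obtain G where G: "G \<in> band_limited" "AE x in lebesgue. G0 x = G x"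
    using paley_wiener_representative by blast
  \<comment> \<open>The Montel limit is continuous, so it equals its representative everywhere and
    convergence holds at each single point; the existence proof uses it at 0.\<close>
  have "G0 = G" by (rule continuous_AE_eq[OF G0c band_limited_continuous[OF G(1)] G(2)])
  then show ?thesis using that[OF r G(1)] nG lim0 by simp
qed

subsection \<open>Superlevel sets of band-limited functions\<close>

text \<open>A Lipschitz function that reaches c at a point stays above c/2 on an interval of fixed
  length around it and so carries a fixed energy there. Far out, the tail of F has less than
  that.\<close>

lemma band_limited_decay:
  assumes F: "F \<in> band_limited" and c: "c > 0"
  obtains R where "\<And>x. c \<le> cmod (F x) \<Longrightarrow> x \<in> {-R..R}"
proof -
  \<comment> \<open>The summand 1 keeps L positive when F has norm 0.\<close>
  define L where "L = pi * sqrt (norm2 lebesgue F) + 1"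
  have L: "L > 0" unfolding L_def using norm2_nonneg[of lebesgue F] by (intro add_nonneg_pos) auto
  define \<delta> where "\<delta> = c / (2 * L)"
  have \<delta>: "\<delta> > 0" using c L by (simp add: \<delta>_def)
  \<comment> \<open>The energy of an interval of radius \<delta> on which the modulus is at least
    c/2.\<close>
  define d where "d = 2 * \<delta> * (c / 2)\<^sup>2"
  have d: "d > 0" using c \<delta> by (simp add: d_def)
  note F2 = band_limited_L2[OF F]
  define T where "T n = (\<lambda>x. F x - indicator {- real n..real n} x * F x)" for n :: nat
  have T2: "T n \<in> L2 lebesgue" for n unfolding T_def by (intro L2_diff F2 L2_restrict) auto
  obtain n where n: "norm2 lebesgue (T n) < d"
    using order_tendstoD(2)[OF truncate_tendsto[OF F2] d] unfolding T_def
    by (auto simp: eventually_sequentially)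
  have "x \<in> {-(real n + \<delta>)..real n + \<delta>}" if x: "c \<le> cmod (F x)" for x
  proof (rule ccontr)
    assume out: "x \<notin> {-(real n + \<delta>)..real n + \<delta>}"
    have low: "c / 2 \<le> cmod (T n y)" if y: "y \<in> {x - \<delta>..x + \<delta>}" for y
    proof -
      have "y \<notin> {- real n..real n}" using out y by auto
      then have T: "T n y = F y" by (simp add: T_def)
      have "cmod (F x - F y) \<le> pi * sqrt (norm2 lebesgue F) * \<bar>x - y\<bar>" by (rule band_limited_lipschitz[OF F])
      also have "\<dots> \<le> L * \<delta>" using y \<delta> L by (intro mult_mono) (auto simp: L_def)
      also have "\<dots> = c / 2" using L by (simp add: \<delta>_def)
      finally have "cmod (F x - F y) \<le> c / 2" .
      then show ?thesis using x norm_triangle_ineq2[of "F x" "F y"] T by simp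
    qed
    have "d = (\<integral>y. indicator {x - \<delta>..x + \<delta>} y * (c / 2)\<^sup>2 \<partial>lebesgue)"
      using \<delta> by (simp add: d_def)
    also have "\<dots> \<le> norm2 lebesgue (T n)"
      unfolding norm2_def
    proof (rule integral_mono)
      show "integrable lebesgue (\<lambda>y. indicator {x - \<delta>..x + \<delta>} y * (c / 2)\<^sup>2)"
        by (intro integrable_mult_left integrable_real_indicator) (auto simp: emeasure_lborel_Icc_eq)
      show "indicator {x - \<delta>..x + \<delta>} y * (c / 2)\<^sup>2 \<le> (cmod (T n y))\<^sup>2" for y
        using power_mono[OF low, of y 2] c by (cases "y \<in> {x - \<delta>..x + \<delta>}") auto
    qed (rule L2_integrable[OF T2])
    finally show False using n by simp
  qed
  then show ?thesis by (rule that)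
qed

lemma entire_real_zeros_finite:
  assumes H: "H holomorphic_on UNIV" and nc: "\<not> H constant_on UNIV"
  shows "finite {x\<in>{-R..R}. H (of_real x) = 0}"
proof -
  have "finite {z \<in> cball 0 R. H z = 0}"
    by (rule holomorphic_compact_finite_zeros[OF H]) (use nc in auto)
  then have "finite (of_real ` {x\<in>{-R..R}. H (of_real x) = 0} :: complex set)"
    by (rule finite_subset[rotated]) (auto simp: abs_le_iff)
  then show ?thesis by (rule finite_imageD) (auto simp: inj_on_def)
qed

lemma band_limited_not_constant:
  assumes F: "F \<in> band_limited" and c: "c > 0"
  shows "\<exists>x. cmod (F x) \<noteq> c"
proof (rule ccontr)
  assume "\<not> (\<exists>x. cmod (F x) \<noteq> c)"
  then have *: "cmod (F x) = c" for x by blast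
  obtain R where "\<And>x. c \<le> cmod (F x) \<Longrightarrow> x \<in> {-R..R}" using band_limited_decay[OF F c] by blast
  then have "\<bar>R\<bar> + 1 \<in> {-R..R}" using * by simp
  then show False by auto
qed

text \<open>The squared modulus is not holomorphic, but on the real line it agrees with the entire
  function E(z) times the conjugate of E at the conjugate of z. Decay excludes that this function is
  constantly c and confines the level set to a bounded interval.\<close>

lemma band_limited_level_set_finite:
  assumes F: "F \<in> band_limited" and c: "c > 0"
  shows "finite {x. (cmod (F x))\<^sup>2 = c}"
proof (cases "{x. (cmod (F x))\<^sup>2 = c} = {}")
  case False
  then obtain x0 where x0: "(cmod (F x0))\<^sup>2 = c" by blast
  obtain g where g: "g \<in> band_spectra" and Fg: "F = inverse_fourier g" using F by (auto simp: band_limited_def)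
  define H where "H z = entire_extension g z * (cnj \<circ> entire_extension g \<circ> cnj) z - of_real c" for z
  note Eh = entire_extension_holomorphic[OF g]
  have Hh: "H holomorphic_on UNIV"
    unfolding H_def by (intro holomorphic_intros Eh holomorphic_on_compose_cnj_cnj holomorphic_on_subset[OF Eh]) auto
  have Hx: "H (of_real x) = of_real ((cmod (F x))\<^sup>2 - c)" for x
    unfolding H_def o_def complex_cnj_complex_of_real entire_extension_of_real Fg[symmetric]
    by (simp add: complex_norm_square[symmetric])
  have "\<not> H constant_on UNIV"
  proof
    assume "H constant_on UNIV"
    then obtain k where "\<And>z. H z = k" by (auto simp: constant_on_def)
    then have "H (of_real x) = H (of_real x0)" for x by simp
    then have "complex_of_real ((cmod (F x))\<^sup>2 - c) = 0" for x unfolding Hx x0 by simp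
    then have "(cmod (F x))\<^sup>2 = c" for x by (metis eq_iff_diff_eq_0 of_real_eq_0_iff)
    then have "cmod (F x) = sqrt c" for x by (metis norm_ge_zero real_sqrt_unique)
    then show False using band_limited_not_constant[OF F, of "sqrt c"] c by simp
  qed
  obtain R where R: "\<And>x. sqrt c \<le> cmod (F x) \<Longrightarrow> x \<in> {-R..R}"
    using band_limited_decay[OF F, of "sqrt c"] c by auto
  have "{x. (cmod (F x))\<^sup>2 = c} \<subseteq> {x\<in>{-R..R}. H (of_real x) = 0}"
    using R unfolding Hx by (auto simp: real_le_lsqrt)
  then show ?thesis using entire_real_zeros_finite[OF Hh \<open>\<not> H constant_on UNIV\<close>] finite_subset by blast
qed auto

text \<open>Zeros are finite in each bounded window, hence countable. This gives large superlevel
  sets at low levels and positive energy on sets of positive measure.\<close>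

lemma band_limited_nonzero_AE:
  assumes F: "F \<in> band_limited" and nz: "norm2 lebesgue F \<noteq> 0"
  shows "AE x in lebesgue. F x \<noteq> 0"
proof -
  obtain g where g: "g \<in> band_spectra" and Fg: "F = inverse_fourier g" using F by (auto simp: band_limited_def)
  note Eh = entire_extension_holomorphic[OF g]
  have "\<not> entire_extension g constant_on UNIV"
  proof
    assume "entire_extension g constant_on UNIV"
    then obtain k where k: "\<And>z. entire_extension g z = k" by (auto simp: constant_on_def)
    then have Fk: "F x = k" for x using entire_extension_of_real[of g x] Fg by simp
    have "k \<noteq> 0" using nz by (auto simp: norm2_def Fk)
    then show False using band_limited_not_constant[OF F, of "cmod k"] Fk by simp
  qed
  from entire_real_zeros_finite[OF Eh this]
  have fin: "finite {x\<in>{- real n..real n}. F x = 0}" for n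
    by (simp add: entire_extension_of_real Fg)
  have "{x. F x = 0} = (\<Union>n. {x\<in>{- real n..real n}. F x = 0})"
  proof safe
    fix x assume "F x = 0"
    obtain n :: nat where "\<bar>x\<bar> \<le> real n" using real_arch_simple by blast
    then show "x \<in> (\<Union>n. {x\<in>{- real n..real n}. F x = 0})" using \<open>F x = 0\<close> by (auto intro!: exI[of _ n])
  qed
  also have "countable \<dots>" by (intro countable_UN countableI_type countable_finite fin)
  finally have "{x. F x = 0} \<in> null_sets lborel" by (rule countable_imp_null_set_lborel)
  then have "{x. F x = 0} \<in> null_sets lebesgue" by (rule null_sets_completionI)
  then show ?thesis using AE_not_in[of "{x. F x = 0}" lebesgue] by simp
qed

text \<open>The witness has the indicator of the band as its spectrum; it is a multiple of the sinc
  function.\<close>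

lemma band_limited_nonzero_exists: "\<exists>F\<in>band_limited. norm2 lebesgue F \<noteq> 0"
proof -
  define I :: "real \<Rightarrow> complex" where "I = indicator {-pi..pi}"
  have Im: "I \<in> borel_measurable lebesgue"
    unfolding I_def by (intro measurable_lebesgue_borel) measurable
  have I1: "(cmod (I x))\<^sup>2 = indicator {-pi..pi} x" for x by (auto simp: I_def indicator_def)
  have "I \<in> L2 lebesgue" unfolding L2_def using Im by (simp add: I1 integrable_indicator_iff emeasure_lborel_Icc_eq)
  then have I: "I \<in> band_spectra" by (auto simp: band_spectra_def I_def)
  have "norm2 lebesgue I = 2 * pi" unfolding norm2_def I1 by simp
  then have "norm2 lebesgue (inverse_fourier I) = 2 * pi"
    using inverse_fourier_L2(2)[OF band_spectra_bounded_support[OF I]] by simp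
  then show ?thesis using I unfolding band_limited_def by (intro bexI[of _ "inverse_fourier I"]) auto
qed

text \<open>Each component is an open interval, and its right endpoint lies in the frontier.
  Distinct components have distinct right endpoints, so the frontier counts them.\<close>

lemma finite_components_real:
  fixes S :: "real set"
  assumes op: "open S" and bd: "bounded S" and fin: "finite (frontier S)"
  shows "finite (components S)"
proof (rule inj_on_finite[OF _ _ fin, of Sup])
  have bdd: "bdd_above C" if "C \<in> components S" for C
    by (rule bounded_imp_bdd_above[OF bounded_subset[OF bd in_components_subset[OF that]]])
  have lt: "x < Sup C" if C: "C \<in> components S" and x: "x \<in> C" for C x
  proof -
    have "open C" using open_components[OF op C] .
    then obtain e where e: "e > 0" "ball x e \<subseteq> C" using x by (auto simp: open_contains_ball)
    then have "x + e / 2 \<in> C" by (intro subsetD[OF e(2)]) (auto simp: dist_real_def)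
    then have "x + e / 2 \<le> Sup C" by (intro cSup_upper bdd[OF C])
    then show ?thesis using e by simp
  qed
  show "Sup ` components S \<subseteq> frontier S"
  proof safe
    fix C assume C: "C \<in> components S"
    have "Sup C \<in> closure C" by (rule closure_contains_Sup[OF in_components_nonempty[OF C] bdd[OF C]])
    moreover have "Sup C \<notin> interior C" using lt[OF C, of "Sup C"] interior_subset by blast
    ultimately have "Sup C \<in> frontier C" by (simp add: frontier_def)
    then show "Sup C \<in> frontier S" using frontier_of_components_subset[OF C] by blast
  qed
  show "inj_on Sup (components S)"
  proof (rule inj_onI)
    fix C D assume C: "C \<in> components S" and D: "D \<in> components S" and eq: "Sup C = Sup D"
    obtain c d where cd: "c \<in> C" "d \<in> D" using in_components_nonempty C D by blast
    \<comment> \<open>Neither component attains the common supremum, so each extends beyond the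
      larger of the two sample points and, being an interval, contains it.\<close>
    have "max c d \<in> E" if E: "E \<in> components S" and e: "e \<in> E" "e \<le> max c d" and s: "Sup E = Sup C" for E e
    proof -
      have "max c d < Sup E" using lt[OF C cd(1)] lt[OF D cd(2)] eq s by simp
      then obtain e' where e': "e' \<in> E" "max c d < e'"
        using less_cSup_iff[OF in_components_nonempty[OF E] bdd[OF E]] by blast
      have "is_interval E" using in_components_connected[OF E] by (simp add: is_interval_connected_1)
      then show ?thesis using mem_is_interval_1_I[of E e e' "max c d"] e e' by simp
    qed
    from this[OF C cd(1)] this[OF D cd(2)] have "max c d \<in> C \<inter> D" using eq by simp
    then show "C = D" using components_eq[OF C D] by blast
  qed
qed

section \<open>Superlevel sets as finite unions of intervals of prescribed measure\<close>

definition superlevel :: "(real \<Rightarrow> complex) \<Rightarrow> real \<Rightarrow> real set" where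
  "superlevel F c = {x. c < (cmod (F x))\<^sup>2}"

text \<open>The strict inequality gives openness, which the endpoint count in
  \<open>finite_components_real\<close> requires; decay gives boundedness.\<close>

lemma superlevel_open_bounded:
  assumes F: "F \<in> band_limited" and c: "c > 0"
  shows "open (superlevel F c)" "bounded (superlevel F c)" "superlevel F c \<in> lmeasurable"
proof -
  show op: "open (superlevel F c)"
    unfolding superlevel_def using band_limited_continuous[OF F]
    by (intro open_Collect_less continuous_intros)
  obtain R where R: "\<And>x. sqrt c \<le> cmod (F x) \<Longrightarrow> x \<in> {-R..R}"
    using band_limited_decay[OF F, of "sqrt c"] c by auto
  have "superlevel F c \<subseteq> {-R..R}"
  proof
    fix x assume "x \<in> superlevel F c"
    then have "sqrt c \<le> cmod (F x)" by (intro real_le_lsqrt) (use c in \<open>auto simp: superlevel_def\<close>)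
    then show "x \<in> {-R..R}" by (rule R)
  qed
  then show bd: "bounded (superlevel F c)" by (rule bounded_subset[rotated]) simp
  show "superlevel F c \<in> lmeasurable" by (rule lmeasurable_open[OF bd op])
qed

text \<open>By continuity a frontier point has squared modulus exactly c, so the finite level set
  bounds the number of components.\<close>

lemma superlevel_intervals:
  assumes F: "F \<in> band_limited" and c: "c > 0"
  shows "\<exists>\<I>. finite \<I> \<and> (\<forall>I\<in>\<I>. is_interval I) \<and> superlevel F c = \<Union>\<I>"
proof (intro exI[of _ "components (superlevel F c)"] conjI ballI)
  note S = superlevel_open_bounded[OF F c]
  have "closed {x. c \<le> (cmod (F x))\<^sup>2}"
    using band_limited_continuous[OF F] by (intro closed_Collect_le continuous_intros)
  then have "closure (superlevel F c) \<subseteq> {x. c \<le> (cmod (F x))\<^sup>2}"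
    by (intro closure_minimal) (auto simp: superlevel_def)
  then have "frontier (superlevel F c) \<subseteq> {x. (cmod (F x))\<^sup>2 = c}"
    using interior_open[OF S(1)] by (auto simp: frontier_def superlevel_def)
  then have "finite (frontier (superlevel F c))"
    using band_limited_level_set_finite[OF F c] finite_subset by blast
  then show "finite (components (superlevel F c))" by (rule finite_components_real[OF S(1,2)])
  show "is_interval I" if "I \<in> components (superlevel F c)" for I
    using in_components_connected[OF that] by (simp add: is_interval_connected_1)
qed simp

lemma level_set_null:
  assumes F: "F \<in> band_limited" and c: "c > 0"
  shows "AE x in lebesgue. (cmod (F x))\<^sup>2 \<noteq> c"
proof -
  have "{x. (cmod (F x))\<^sup>2 = c} \<in> null_sets lebesgue"
    using band_limited_level_set_finite[OF F c] negligible_finite by (simp add: negligible_iff_null_sets)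
  from AE_not_in[OF this] show ?thesis by simp
qed

text \<open>Away from the null level set at c, the indicators are eventually constant along any
  sequence of levels tending to c. The lower end a > 0 provides the dominating set of finite
  measure.\<close>

lemma superlevel_measure_continuous:
  assumes F: "F \<in> band_limited" and a: "a > 0"
  shows "continuous_on {a..b} (\<lambda>c. measure lebesgue (superlevel F c))"
  unfolding continuous_on_sequentially o_def
proof (intro allI ballI impI, elim conjE)
  fix X c assume c: "c \<in> {a..b}" and X: "\<forall>n. X n \<in> {a..b}" "X \<longlonglongrightarrow> c"
  have m: "measure lebesgue (superlevel F t) = (\<integral>x. indicator (superlevel F t) x \<partial>lebesgue)" for t by simp
  have sm: "superlevel F t \<in> lmeasurable" if "t \<ge> a" for t
    using superlevel_open_bounded(3)[OF F] a that by simp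
  have "(\<lambda>n. \<integral>x. indicator (superlevel F (X n)) x \<partial>lebesgue) \<longlonglongrightarrow> (\<integral>x. indicator (superlevel F c) x \<partial>lebesgue :: real)"
  proof (rule integral_dominated_convergence[where w = "indicator (superlevel F a)"])
    have "AE x in lebesgue. (cmod (F x))\<^sup>2 \<noteq> c" using level_set_null[OF F] a c by simp
    then show "AE x in lebesgue. (\<lambda>n. indicator (superlevel F (X n)) x) \<longlonglongrightarrow> (indicator (superlevel F c) x :: real)"
    proof eventually_elim
      fix x assume ne: "(cmod (F x))\<^sup>2 \<noteq> c"
      have "\<forall>\<^sub>F n in sequentially. (X n < (cmod (F x))\<^sup>2) = (c < (cmod (F x))\<^sup>2)"
      proof (cases "c < (cmod (F x))\<^sup>2")
        case True
        then show ?thesis using order_tendstoD(2)[OF X(2) True] by (auto elim: eventually_mono)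
      next
        case False
        then have "(cmod (F x))\<^sup>2 < c" using ne by simp
        from order_tendstoD(1)[OF X(2) this] show ?thesis using False by (auto elim: eventually_mono)
      qed
      then have "\<forall>\<^sub>F n in sequentially. indicator (superlevel F (X n)) x = (indicator (superlevel F c) x :: real)"
        by eventually_elim (auto simp: superlevel_def indicator_def)
      then show "(\<lambda>n. indicator (superlevel F (X n)) x) \<longlonglongrightarrow> (indicator (superlevel F c) x :: real)"
        by (rule tendsto_eventually)
    qed
    show "AE x in lebesgue. norm (indicator (superlevel F (X n)) x :: real) \<le> indicator (superlevel F a) x" for n
      using X(1) by (intro AE_I2) (auto simp: superlevel_def indicator_def intro: order.strict_trans1 dest: spec[of _ n])
    show "integrable lebesgue (indicator (superlevel F a) :: real \<Rightarrow> real)"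
      using sm[of a] by (intro integrable_real_indicator) (auto simp: fmeasurable_def)
  qed (use sm X(1) c in \<open>auto intro!: borel_measurable_indicator fmeasurableD\<close>)
  then show "(\<lambda>n. measure lebesgue (superlevel F (X n))) \<longlonglongrightarrow> measure lebesgue (superlevel F c)"
    unfolding m .
qed

text \<open>Intermediate values: the measure is at least s at a low level, where almost every point
  of a long interval has been reached, and 0 above the sup norm.\<close>

lemma superlevel_measure_attained:
  assumes F: "F \<in> band_limited" and nz: "norm2 lebesgue F \<noteq> 0" and s: "s > 0"
  obtains c where "c > 0" "measure lebesgue (superlevel F c) = s"
proof -
  define \<mu> where "\<mu> c = measure lebesgue (superlevel F c)" for c
  \<comment> \<open>A window of finite measure permits dominated convergence; its length only has to
    exceed s.\<close>
  define J where "J = {0..2 * s}"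
  have "(\<lambda>n. \<integral>x. indicator (superlevel F (1 / real (Suc n)) \<inter> J) x \<partial>lebesgue) \<longlonglongrightarrow> (\<integral>x. indicator J x \<partial>lebesgue :: real)"
  proof (rule integral_dominated_convergence[where w = "indicator J"])
    show "AE x in lebesgue. (\<lambda>n. indicator (superlevel F (1 / real (Suc n)) \<inter> J) x) \<longlonglongrightarrow> (indicator J x :: real)"
      using band_limited_nonzero_AE[OF F nz]
    proof eventually_elim
      fix x assume "F x \<noteq> 0"
      then have "0 < (cmod (F x))\<^sup>2" by simp
      moreover have "(\<lambda>n. 1 / real (Suc n)) \<longlonglongrightarrow> 0"
        using LIMSEQ_inverse_real_of_nat by (simp add: inverse_eq_divide)
      ultimately have "\<forall>\<^sub>F n in sequentially. 1 / real (Suc n) < (cmod (F x))\<^sup>2"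
        using order_tendstoD(2) by blast
      then have "\<forall>\<^sub>F n in sequentially. indicator (superlevel F (1 / real (Suc n)) \<inter> J) x = (indicator J x :: real)"
        by eventually_elim (auto simp: superlevel_def indicator_def)
      then show "(\<lambda>n. indicator (superlevel F (1 / real (Suc n)) \<inter> J) x) \<longlonglongrightarrow> (indicator J x :: real)"
        by (rule tendsto_eventually)
    qed
    show "integrable lebesgue (indicator J :: real \<Rightarrow> real)"
      unfolding J_def by (intro integrable_real_indicator) (auto simp: emeasure_lborel_Icc_eq)
    have "superlevel F (1 / real (Suc n)) \<in> sets lebesgue" for n
      using superlevel_open_bounded(3)[OF F, of "1 / real (Suc n)"] by (simp add: fmeasurableD)
    then show "indicator (superlevel F (1 / real (Suc n)) \<inter> J) \<in> borel_measurable lebesgue" for n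
      by (intro borel_measurable_indicator sets.Int) (auto simp: J_def)
    show "indicator J \<in> borel_measurable lebesgue" by (intro borel_measurable_indicator) (simp add: J_def)
  qed (auto simp: indicator_def)
  moreover have "(\<integral>x. indicator J x \<partial>lebesgue :: real) = 2 * s" using s by (simp add: J_def)
  ultimately have "\<forall>\<^sub>F n in sequentially. s < (\<integral>x. indicator (superlevel F (1 / real (Suc n)) \<inter> J) x \<partial>lebesgue :: real)"
    using s by (intro order_tendstoD(1)) auto
  then obtain n where n: "s < (\<integral>x. indicator (superlevel F (1 / real (Suc n)) \<inter> J) x \<partial>lebesgue :: real)"
    by (auto simp: eventually_sequentially)
  define a where "a = 1 / real (Suc n)"
  have a: "a > 0" by (simp add: a_def)
  have "s < measure lebesgue (superlevel F a \<inter> J)" using n unfolding a_def by simp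
  also have "\<dots> \<le> \<mu> a"
    unfolding \<mu>_def using superlevel_open_bounded(3)[OF F a]
    by (intro measure_mono_fmeasurable sets.Int) (auto simp: J_def fmeasurableD)
  finally have sa: "s \<le> \<mu> a" by simp
  \<comment> \<open>The squared sup norm is at most the squared L2 norm, so nothing lies above this
    level; the maximum with a keeps the interval of levels nonempty.\<close>
  define b where "b = max a (norm2 lebesgue F)"
  have "(cmod (F x))\<^sup>2 \<le> norm2 lebesgue F" for x
    using power_mono[OF band_limited_bounded[OF F], of x 2] by (simp add: norm2_nonneg)
  then have "superlevel F b = {}" unfolding superlevel_def b_def by (auto simp: not_less le_max_iff_disj)
  then have "\<mu> b \<le> s" using s by (simp add: \<mu>_def)
  moreover have "a \<le> b" by (simp add: b_def)
  ultimately obtain c where "a \<le> c" "\<mu> c = s"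
    using IVT2'[of \<mu> b s a] sa superlevel_measure_continuous[OF F a] unfolding \<mu>_def by blast
  then show ?thesis using that[of c] a by (simp add: \<mu>_def)
qed

section \<open>Energy on a set and the bathtub principle\<close>

definition energy :: "real set \<Rightarrow> (real \<Rightarrow> complex) \<Rightarrow> real" where
  "energy \<Omega> f = norm2 lebesgue (\<lambda>x. indicator \<Omega> x * f x)"

lemma energy_eq: "energy \<Omega> f = (\<integral>x. indicator \<Omega> x * (cmod (f x))\<^sup>2 \<partial>lebesgue)"
  unfolding energy_def norm2_def
  by (rule Bochner_Integration.integral_cong) (auto simp: indicator_def)

text \<open>The function \<phi> is nonnegative, because both its factors change sign with membership
  in the superlevel set. As the measures agree, the constant c drops out of its integral, which is
  the difference of energies; equality therefore forces \<phi> = 0 almost everywhere.\<close>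

lemma bathtub:
  assumes F: "F \<in> L2 lebesgue" and A: "superlevel F c \<in> lmeasurable" and B: "B \<in> lmeasurable"
    and eq: "measure lebesgue B = measure lebesgue (superlevel F c)"
  shows "energy B F \<le> energy (superlevel F c) F"
    and "energy (superlevel F c) F \<le> energy B F \<Longrightarrow>
      AE x in lebesgue. (x \<in> B \<longleftrightarrow> x \<in> superlevel F c) \<or> (cmod (F x))\<^sup>2 = c"
proof -
  let ?u = "\<lambda>x. (cmod (F x))\<^sup>2" and ?A = "superlevel F c"
  define \<phi> where "\<phi> x = (indicator ?A x - indicator B x) * (?u x - c)" for x
  have ind: "integrable lebesgue (indicator S :: real \<Rightarrow> real)" if "S \<in> lmeasurable" for S
    using that by (intro integrable_real_indicator) (auto simp: fmeasurable_def)
  have iu: "integrable lebesgue (\<lambda>x. indicator S x * ?u x)" if "S \<in> lmeasurable" for S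
    using integrable_mult_indicator[OF fmeasurableD[OF that] L2_integrable[OF F]] by simp
  have pos: "0 \<le> \<phi> x" for x by (auto simp: \<phi>_def indicator_def superlevel_def)
  have \<phi>eq: "\<phi> = (\<lambda>x. (indicator ?A x * ?u x - indicator B x * ?u x) - (c * indicator ?A x - c * indicator B x))"
    by (auto simp: \<phi>_def algebra_simps)
  have \<phi>i: "integrable lebesgue \<phi>"
    unfolding \<phi>eq by (intro Bochner_Integration.integrable_diff integrable_mult_right iu ind A B)
  have "integral\<^sup>L lebesgue \<phi> = (energy ?A F - energy B F) - (c * measure lebesgue ?A - c * measure lebesgue B)"
    unfolding \<phi>eq energy_eq using iu ind A B by simp
  then have \<phi>0: "integral\<^sup>L lebesgue \<phi> = energy ?A F - energy B F" using eq by simp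
  then show "energy B F \<le> energy ?A F" using Bochner_Integration.integral_nonneg[of lebesgue \<phi>] pos by simp
  assume "energy ?A F \<le> energy B F"
  then have "integral\<^sup>L lebesgue \<phi> = 0" using \<phi>0 Bochner_Integration.integral_nonneg[of lebesgue \<phi>] pos by simp
  then have "AE x in lebesgue. \<phi> x = 0" using integral_nonneg_eq_0_iff_AE[OF \<phi>i] pos by simp
  then show "AE x in lebesgue. (x \<in> B \<longleftrightarrow> x \<in> ?A) \<or> ?u x = c"
    by eventually_elim (auto simp: \<phi>_def indicator_def split: if_splits)
qed

subsection \<open>The first eigenvalue of the localization operator\<close>

text \<open>Norm and energy see only the class modulo null sets, so inequalities on the
  Paley--Wiener space may be checked on continuous representatives.\<close>

lemma paley_wiener_replace:
  assumes f: "f \<in> paley_wiener" and S: "S \<in> sets lebesgue"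
  obtains F where "F \<in> band_limited" "AE x in lebesgue. f x = F x"
    "norm2 lebesgue f = norm2 lebesgue F" "energy S f = energy S F"
proof -
  obtain F where F: "F \<in> band_limited" "AE x in lebesgue. f x = F x"
    using paley_wiener_representative[OF f] .
  note m = L2_measurable[OF paley_wiener_L2[OF f]] L2_measurable[OF band_limited_L2[OF F(1)]]
  have "norm2 lebesgue f = norm2 lebesgue F" by (rule norm2_cong_AE[OF m F(2)])
  moreover have "energy S f = energy S F"
    unfolding energy_def
  proof (rule norm2_cong_AE)
    show "AE x in lebesgue. indicator S x * f x = indicator S x * F x"
      using F(2) by eventually_elim simp
  qed (rule L2_measurable[OF L2_restrict[OF _ S]], rule paley_wiener_L2[OF f] band_limited_L2[OF F(1)])+
  ultimately show ?thesis using that F by blast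
qed

lemma energy_nonneg: "0 \<le> energy S f"
  unfolding energy_def by (rule norm2_nonneg)

lemma energy_le_norm2:
  assumes "f \<in> L2 lebesgue" "S \<in> sets lebesgue"
  shows "energy S f \<le> norm2 lebesgue f"
  unfolding energy_def
  by (rule norm2_mono[OF assms(1) L2_restrict[OF assms]]) (auto simp: indicator_def)

lemma energy_scale: "energy S (\<lambda>x. c * f x) = (cmod c)\<^sup>2 * energy S f"
  unfolding energy_def using norm2_scale[of lebesgue c "\<lambda>x. indicator S x * f x"] by (simp add: mult_ac)

lemma inner2_restrict: "inner2 lebesgue (\<lambda>x. indicator S x * f x) (\<lambda>x. indicator S x * g x) =
    inner2 lebesgue (\<lambda>x. indicator S x * f x) g"
  unfolding inner2_def by (rule Bochner_Integration.integral_cong) (auto simp: indicator_def)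

lemma energy_add:
  assumes "f \<in> L2 lebesgue" "g \<in> L2 lebesgue" "S \<in> sets lebesgue"
  shows "energy S (\<lambda>x. f x + g x) = energy S f + energy S g + 2 * Re (inner2 lebesgue (\<lambda>x. indicator S x * f x) g)"
  unfolding energy_def
  using norm2_add[OF L2_restrict[OF assms(1,3)] L2_restrict[OF assms(2,3)]]
  by (simp add: distrib_left inner2_restrict)

lemma band_limited_scale:
  assumes "F \<in> band_limited"
  shows "(\<lambda>x. c * F x) \<in> band_limited"
proof -
  obtain g where g: "g \<in> band_spectra" and Fg: "F = inverse_fourier g" using assms by (auto simp: band_limited_def)
  have "(\<lambda>x. c * g x) \<in> band_spectra" using g by (auto simp: band_spectra_def L2_scale)
  moreover have "(\<lambda>x. c * F x) = inverse_fourier (\<lambda>x. c * g x)"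
    unfolding Fg inverse_fourier_def[abs_def] fourier_integral_scale ..
  ultimately show ?thesis by (simp add: band_limited_def)
qed

lemma band_limited_normalize:
  assumes F: "F \<in> band_limited" and nz: "norm2 lebesgue F \<noteq> 0"
  obtains G where "G \<in> band_limited" "norm2 lebesgue G = 1" "\<And>S. energy S F = norm2 lebesgue F * energy S G"
proof -
  define c where "c = complex_of_real (1 / sqrt (norm2 lebesgue F))"
  have N: "norm2 lebesgue F > 0" using nz norm2_nonneg[of lebesgue F] by linarith
  have c: "(cmod c)\<^sup>2 = 1 / norm2 lebesgue F"
    unfolding c_def using N by (simp add: norm_divide power_divide)
  show ?thesis
  proof (rule that[of "\<lambda>x. c * F x"])
    show "(\<lambda>x. c * F x) \<in> band_limited" by (rule band_limited_scale[OF F])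
    show "norm2 lebesgue (\<lambda>x. c * F x) = 1" unfolding norm2_scale c using N by simp
    show "energy S F = norm2 lebesgue F * energy S (\<lambda>x. c * F x)" for S
      unfolding energy_scale c using N by simp
  qed
qed

lemma energy_positive:
  assumes F: "F \<in> band_limited" and nz: "norm2 lebesgue F \<noteq> 0"
    and S: "S \<in> lmeasurable" and pos: "measure lebesgue S > 0"
  shows "energy S F > 0"
proof (rule ccontr)
  have Sm: "S \<in> sets lebesgue" using S by (rule fmeasurableD)
  assume "\<not> energy S F > 0"
  then have "energy S F = 0" using energy_nonneg[of S F] by simp
  then have "AE x in lebesgue. indicator S x * F x = 0"
    unfolding energy_def using norm2_eq_0_iff[OF L2_restrict[OF band_limited_L2[OF F] Sm]] by simp
  then have "AE x in lebesgue. x \<notin> S"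
    using band_limited_nonzero_AE[OF F nz] by eventually_elim (auto simp: indicator_def)
  then have "S \<in> null_sets lebesgue" using AE_iff_null_sets[OF Sm] by simp
  then show False using pos by (simp add: null_sets_def measure_def)
qed

text \<open>Finite measure of S makes the energy continuous along bounded, pointwise convergent
  sequences, since the sup bound lets the indicator of S dominate. Positivity of the supremum then
  prevents loss of norm.\<close>

lemma energy_maximizer:
  assumes S: "S \<in> lmeasurable" and pos: "measure lebesgue S > 0"
  obtains F \<mu> where "F \<in> band_limited" "norm2 lebesgue F = 1" "energy S F = \<mu>" "\<mu> > 0"
    "\<And>f. f \<in> paley_wiener \<Longrightarrow> energy S f \<le> \<mu> * norm2 lebesgue f"
proof -
  have Sm: "S \<in> sets lebesgue" using S by (rule fmeasurableD)
  \<comment> \<open>The unit ball rather than the sphere, since a limit of unit vectors may have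
    smaller norm.\<close>
  define E where "E = energy S ` {F \<in> band_limited. norm2 lebesgue F \<le> 1}"
  have bdd: "bdd_above E"
    unfolding E_def using energy_le_norm2[OF band_limited_L2 Sm] by (intro bdd_aboveI[of _ 1]) fastforce
  obtain F0 where F0: "F0 \<in> band_limited" "norm2 lebesgue F0 \<noteq> 0" using band_limited_nonzero_exists by blast
  obtain F1 where F1: "F1 \<in> band_limited" "norm2 lebesgue F1 = 1" using band_limited_normalize[OF F0] by blast
  have F1E: "energy S F1 \<in> E" using F1 by (auto simp: E_def)
  then have E: "E \<noteq> {}" by blast
  define \<mu> where "\<mu> = Sup E"
  have "0 < energy S F1" using energy_positive[OF F1(1) _ S pos] F1(2) by simp
  also have "\<dots> \<le> \<mu>" unfolding \<mu>_def by (rule cSup_upper[OF F1E bdd])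
  finally have \<mu>: "\<mu> > 0" .
  have le\<mu>: "energy S F \<le> \<mu> * norm2 lebesgue F" if F: "F \<in> band_limited" for F
  proof (cases "norm2 lebesgue F = 0")
    case True
    then show ?thesis using energy_le_norm2[OF band_limited_L2[OF F] Sm] by simp
  next
    case False
    then obtain G where G: "G \<in> band_limited" "norm2 lebesgue G = 1" "\<And>S. energy S F = norm2 lebesgue F * energy S G"
      using band_limited_normalize[OF F] by metis
    have "energy S G \<le> \<mu>" unfolding \<mu>_def by (rule cSup_upper[OF _ bdd]) (use G in \<open>auto simp: E_def\<close>)
    then show ?thesis using G(3)[of S] mult_left_mono[of "energy S G" \<mu> "norm2 lebesgue F"] norm2_nonneg[of lebesgue F]
      by (simp add: mult.commute)
  qed
  have "\<exists>F. F \<in> band_limited \<and> norm2 lebesgue F \<le> 1 \<and> \<mu> - 1 / real (Suc n) < energy S F" for n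
  proof -
    have "\<mu> - 1 / real (Suc n) < Sup E" by (simp add: \<mu>_def)
    then show ?thesis using less_cSup_iff[OF E bdd] by (auto simp: E_def)
  qed
  then obtain F where F: "\<And>n. F n \<in> band_limited" "\<And>n. norm2 lebesgue (F n) \<le> 1"
    "\<And>n. \<mu> - 1 / real (Suc n) < energy S (F n)" by metis
  obtain r G where r: "strict_mono r" and G: "G \<in> band_limited" "norm2 lebesgue G \<le> 1"
    and lim: "\<And>x. (\<lambda>n. F (r n) x) \<longlonglongrightarrow> G x"
    by (rule band_limited_compact[of F 1, OF F(1,2)]) blast
  have "(\<lambda>n. energy S (F (r n))) \<longlonglongrightarrow> energy S G"
    unfolding energy_def norm2_def
  proof (rule integral_dominated_convergence[where w = "indicator S"])
    show "AE x in lebesgue. (\<lambda>n. (cmod (indicator S x * F (r n) x))\<^sup>2) \<longlonglongrightarrow> (cmod (indicator S x * G x))\<^sup>2"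
      by (intro AE_I2 tendsto_intros lim)
    show "integrable lebesgue (indicator S :: real \<Rightarrow> real)"
      using S by (intro integrable_real_indicator) (auto simp: fmeasurable_def)
    have "(cmod (F n x))\<^sup>2 \<le> 1" for n x
      using power_mono[OF band_limited_bounded[OF F(1), of n x], of 2] F(2)[of n]
      by (simp add: norm2_nonneg)
    then show "AE x in lebesgue. norm ((cmod (indicator S x * F (r n) x))\<^sup>2) \<le> indicator S x" for n
      by (intro AE_I2) (auto simp: indicator_def)
    show "(\<lambda>x. (cmod (indicator S x * G x))\<^sup>2) \<in> borel_measurable lebesgue"
      using L2_integrable[OF L2_restrict[OF band_limited_L2[OF G(1)] Sm]] by auto
    show "(\<lambda>x. (cmod (indicator S x * F (r n) x))\<^sup>2) \<in> borel_measurable lebesgue" for n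
      using L2_integrable[OF L2_restrict[OF band_limited_L2[OF F(1)] Sm]] by auto
  qed
  moreover have "(\<lambda>n. \<mu> - 1 / real (Suc (r n))) \<longlonglongrightarrow> \<mu> - 0"
    using LIMSEQ_subseq_LIMSEQ[OF LIMSEQ_inverse_real_of_nat r]
    by (intro tendsto_intros) (simp add: o_def inverse_eq_divide)
  ultimately have "\<mu> - 0 \<le> energy S G"
    by (intro LIMSEQ_le[where X = "\<lambda>n. \<mu> - 1 / real (Suc (r n))" and Y = "\<lambda>n. energy S (F (r n))"])
       (use F(3) in \<open>auto intro: less_imp_le\<close>)
  then have low: "\<mu> \<le> energy S G" by simp
  \<comment> \<open>A limit with norm below 1 could not have energy \<mu>, as \<mu> > 0; so the
    limit is back on the sphere.\<close>
  have "\<mu> * 1 \<le> \<mu> * norm2 lebesgue G" using low le\<mu>[OF G(1)] by simp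
  then have nG: "norm2 lebesgue G = 1" using \<mu> G(2) by simp
  then have "energy S G = \<mu>" using low le\<mu>[OF G(1)] by simp
  moreover have "energy S f \<le> \<mu> * norm2 lebesgue f" if f: "f \<in> paley_wiener" for f
    using paley_wiener_replace[OF f Sm] le\<mu> by metis
  ultimately show ?thesis using that[OF G(1) nG _ \<mu>] by blast
qed

text \<open>At t = -b/d, with d positive and at least q, the expression is at most -b^2/d, which is
  negative unless b = 0.\<close>

lemma linear_term_zero:
  fixes b q :: real
  assumes "\<And>t. 0 \<le> 2 * t * b + t\<^sup>2 * q"
  shows "b = 0"
proof (rule ccontr)
  assume b: "b \<noteq> 0"
  define d where "d = \<bar>q\<bar> + 1"
  have d: "d > 0" "q \<le> d" by (auto simp: d_def)
  have "0 \<le> 2 * (- b / d) * b + (- b / d)\<^sup>2 * q" by (rule assms)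
  also have "\<dots> \<le> 2 * (- b / d) * b + (- b / d)\<^sup>2 * d" using d by (intro add_left_mono mult_left_mono) auto
  also have "\<dots> = - (b\<^sup>2 / d)" using d by (simp add: power2_eq_square field_simps)
  also have "\<dots> < 0" using b d by simp
  finally show False by simp
qed

text \<open>First variation: \<mu> times the squared norm minus the energy is nonnegative and
  vanishes at F, so its linear term in the direction g is zero. Real multiples of g give the real
  part; the direction \<i> g gives the imaginary part.\<close>

lemma energy_maximizer_eigenfunction:
  assumes S: "S \<in> sets lebesgue" and F: "F \<in> paley_wiener" and max: "energy S F = \<mu> * norm2 lebesgue F"
    and le: "\<And>f. f \<in> paley_wiener \<Longrightarrow> energy S f \<le> \<mu> * norm2 lebesgue f" and g: "g \<in> paley_wiener"
  shows "inner2 lebesgue (\<lambda>x. indicator S x * F x) g = of_real \<mu> * inner2 lebesgue F g"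
proof -
  define D where "D g = of_real \<mu> * inner2 lebesgue F g - inner2 lebesgue (\<lambda>x. indicator S x * F x) g" for g
  have re: "Re (D g) = 0" if g: "g \<in> paley_wiener" for g
  proof (rule linear_term_zero)
    fix t :: real
    have F2: "F \<in> L2 lebesgue" and g2: "g \<in> L2 lebesgue" using F g paley_wiener_L2 by auto
    let ?g = "\<lambda>x. of_real t * g x"
    have tg: "?g \<in> paley_wiener" by (rule paley_wiener_scale[OF g])
    have "energy S (\<lambda>x. F x + ?g x) \<le> \<mu> * norm2 lebesgue (\<lambda>x. F x + ?g x)"
      by (rule le[OF paley_wiener_add[OF F tg]])
    then show "0 \<le> 2 * t * Re (D g) + t\<^sup>2 * (\<mu> * norm2 lebesgue g - energy S g)"
      unfolding energy_add[OF F2 L2_scale[OF g2] S] norm2_add[OF F2 L2_scale[OF g2]] energy_scale norm2_scale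
        inner2_scale_right D_def
      using max by (simp add: algebra_simps)
  qed
  have "Im (D g) = Re (D (\<lambda>x. \<i> * g x))" unfolding D_def inner2_scale_right by simp
  then have "D g = 0" using re[OF g] re[OF paley_wiener_scale[OF g, of \<i>]] by (simp add: complex_eq_iff)
  then show ?thesis by (simp add: D_def)
qed

lemma localization_iff:
  "localization S f h \<longleftrightarrow> f \<in> paley_wiener \<and> h \<in> paley_wiener \<and>
     (\<forall>g\<in>paley_wiener. inner2 lebesgue h g = inner2 lebesgue (\<lambda>x. indicator S x * f x) g)"
proof -
  have "(LINT x:S|lebesgue. f x * cnj (g x)) = inner2 lebesgue (\<lambda>x. indicator S x * f x) g" for g
    unfolding set_lebesgue_integral_def inner2_def
    by (rule Bochner_Integration.integral_cong) (auto simp: indicator_def)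
  then show ?thesis by (simp add: localization_def L2_inner_eq_inner2)
qed

text \<open>\<open>GREATEST\<close> has a usable value only once a greatest element is exhibited.
  The maximizer solves the eigenvalue equation, and testing any eigenvalue equation with its own
  eigenfunction shows that the eigenvalue is a Rayleigh quotient.\<close>

lemma first_eigenvalue_maximizer:
  assumes S: "S \<in> lmeasurable" and pos: "measure lebesgue S > 0"
  obtains F where "F \<in> band_limited" "norm2 lebesgue F = 1" "energy S F = first_eigenvalue S"
    "first_eigenvalue S > 0" "\<And>f. f \<in> paley_wiener \<Longrightarrow> energy S f \<le> first_eigenvalue S * norm2 lebesgue f"
proof -
  have Sm: "S \<in> sets lebesgue" using S by (rule fmeasurableD)
  obtain F \<mu> where F: "F \<in> band_limited" "norm2 lebesgue F = 1" "energy S F = \<mu>" "\<mu> > 0"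
    and le: "\<And>f. f \<in> paley_wiener \<Longrightarrow> energy S f \<le> \<mu> * norm2 lebesgue f"
    using energy_maximizer[OF S pos] by metis
  have Fpw: "F \<in> paley_wiener" by (rule band_limited_paley_wiener[OF F(1)])
  have "first_eigenvalue S = \<mu>"
    unfolding first_eigenvalue_def
  proof (rule Greatest_equality)
    have "localization S F (\<lambda>x. of_real \<mu> * F x)"
      unfolding localization_iff
      using Fpw paley_wiener_scale[OF Fpw] energy_maximizer_eigenfunction[OF Sm Fpw _ le] F(2,3)
      by (simp add: inner2_scale_left)
    moreover have "\<not> (AE x in lebesgue. F x = 0)"
      using norm2_eq_0_iff[OF band_limited_L2[OF F(1)]] F(2) by simp
    ultimately show "localization_eigenvalue S \<mu>" unfolding localization_eigenvalue_def by blast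
    fix \<nu> assume "localization_eigenvalue S \<nu>"
    then obtain f where nz: "\<not> (AE x in lebesgue. f x = 0)" and f: "localization S f (\<lambda>x. of_real \<nu> * f x)"
      unfolding localization_eigenvalue_def by blast
    have fpw: "f \<in> paley_wiener" using f by (simp add: localization_iff)
    have N: "norm2 lebesgue f > 0"
      using norm2_eq_0_iff[OF paley_wiener_L2[OF fpw]] nz norm2_nonneg[of lebesgue f] by linarith
    have "of_real \<nu> * inner2 lebesgue f f = inner2 lebesgue (\<lambda>x. indicator S x * f x) f"
      using f fpw unfolding localization_iff inner2_scale_left by blast
    then have "complex_of_real (\<nu> * norm2 lebesgue f) = complex_of_real (energy S f)"
      unfolding inner2_restrict[symmetric, of S f f] inner2_self energy_def by simp
    then have "\<nu> * norm2 lebesgue f = energy S f" by (simp only: of_real_eq_iff)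
    then have "\<nu> * norm2 lebesgue f \<le> \<mu> * norm2 lebesgue f" using le[OF fpw] by simp
    then show "\<nu> \<le> \<mu>" using N by (simp add: mult_le_cancel_right)
  qed
  then show ?thesis using that[of F] F le by simp
qed

subsection \<open>Optimal sets\<close>

lemma translate_energy:
  assumes F: "F \<in> L2 lebesgue"
  shows "norm2 lebesgue (\<lambda>x. F (x + a)) = norm2 lebesgue F"
    and "energy ((+) (- a) ` S) (\<lambda>x. F (x + a)) = energy S F"
proof -
  have tr: "norm2 lebesgue (\<lambda>x. G (x + a)) = norm2 lebesgue G" for G :: "real \<Rightarrow> complex"
    unfolding norm2_def using lebesgue_integral_real_affine[of 1 "\<lambda>x. (cmod (G x))\<^sup>2" a]
    by (simp add: add.commute)
  show "norm2 lebesgue (\<lambda>x. F (x + a)) = norm2 lebesgue F" by (rule tr)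
  have "x \<in> (+) (- a) ` S \<longleftrightarrow> x + a \<in> S" for x
    by (auto intro!: image_eqI[of _ _ "x + a"])
  then have "indicator ((+) (- a) ` S) x = (indicator S (x + a) :: complex)" for x
    by (simp add: indicator_def)
  then show "energy ((+) (- a) ` S) (\<lambda>x. F (x + a)) = energy S F"
    unfolding energy_def using tr[of "\<lambda>x. indicator S x * F x"] by simp
qed

text \<open>With N the squared norm of the limit G, the estimate closes as follows: \<Lambda> is at
  most energy T G + \<Lambda> (1 - N) up to terms tending to 0, hence \<Lambda> N \<le> energy T G.
  As N is not 0, the eigenvalue of T is at least \<Lambda>.\<close>

lemma maximizer_exists:
  assumes s: "s > 0"
  shows "\<exists>\<Omega>. maximizes_first_eigenvalue s \<Omega>"
proof -
  define A :: "real set set" where "A = {\<Omega> \<in> lmeasurable. measure lebesgue \<Omega> = s}"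
  have pos: "\<Omega> \<in> lmeasurable" "measure lebesgue \<Omega> > 0" if "\<Omega> \<in> A" for \<Omega> using that s by (auto simp: A_def)
  have le1: "first_eigenvalue \<Omega> \<le> 1" if \<Omega>: "\<Omega> \<in> A" for \<Omega>
  proof -
    obtain F where F: "F \<in> band_limited" "norm2 lebesgue F = 1" "energy \<Omega> F = first_eigenvalue \<Omega>"
      using first_eigenvalue_maximizer[OF pos[OF \<Omega>]] by metis
    show ?thesis using energy_le_norm2[OF band_limited_L2[OF F(1)] fmeasurableD[OF pos(1)[OF \<Omega>]]] F by simp
  qed
  have bdd: "bdd_above (first_eigenvalue ` A)" using le1 by (intro bdd_aboveI[of _ 1]) auto
  have I: "{0..s} \<in> A" using s by (simp add: A_def)
  define \<Lambda> where "\<Lambda> = Sup (first_eigenvalue ` A)"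
  have upper: "first_eigenvalue \<Omega> \<le> \<Lambda>" if "\<Omega> \<in> A" for \<Omega>
    unfolding \<Lambda>_def using that by (intro cSup_upper bdd) auto
  have "0 < first_eigenvalue {0..s}" using first_eigenvalue_maximizer[OF pos[OF I]] by metis
  then have \<Lambda>: "\<Lambda> > 0" using upper[OF I] by simp
  \<comment> \<open>The error is scaled by \<Lambda>/2, so all eigenvalues of the sequence,
    including the one for n = 0, exceed \<Lambda>/2.\<close>
  have "\<exists>\<Omega>. \<Omega> \<in> A \<and> \<Lambda> - \<Lambda> / 2 * (1 / real (Suc n)) < first_eigenvalue \<Omega>" for n
  proof -
    have "\<Lambda> - \<Lambda> / 2 * (1 / real (Suc n)) < \<Lambda>" using \<Lambda> by simp
    then show ?thesis unfolding \<Lambda>_def using less_cSup_iff[OF _ bdd] I by blast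
  qed
  then obtain W where W: "\<And>n. W n \<in> A" "\<And>n. \<Lambda> - \<Lambda> / 2 * (1 / real (Suc n)) < first_eigenvalue (W n)" by metis
  have "\<exists>F. F \<in> band_limited \<and> norm2 lebesgue F = 1 \<and> energy (W n) F = first_eigenvalue (W n)" for n
    using first_eigenvalue_maximizer[OF pos[OF W(1)]] by metis
  then obtain F where F: "\<And>n. F n \<in> band_limited" "\<And>n. norm2 lebesgue (F n) = 1"
    "\<And>n. energy (W n) (F n) = first_eigenvalue (W n)" by metis
  \<comment> \<open>If the squared modulus stayed below \<kappa>, the energy on a set of measure s
    would be at most \<kappa> s = \<Lambda>/2.\<close>
  define \<kappa> where "\<kappa> = \<Lambda> / (2 * s)"
  have \<kappa>: "\<kappa> > 0" using \<Lambda> s by (simp add: \<kappa>_def)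
  have "\<exists>x. \<kappa> \<le> (cmod (F n x))\<^sup>2" for n
  proof (rule ccontr)
    assume "\<nexists>x. \<kappa> \<le> (cmod (F n x))\<^sup>2"
    then have lt: "(cmod (F n x))\<^sup>2 \<le> \<kappa>" for x by (meson linear)
    have Wm: "W n \<in> lmeasurable" and Ws: "measure lebesgue (W n) = s" using W(1)[of n] by (auto simp: A_def)
    have "energy (W n) (F n) \<le> (\<integral>x. indicator (W n) x * \<kappa> \<partial>lebesgue)"
      unfolding energy_eq
    proof (rule integral_mono)
      show "integrable lebesgue (\<lambda>x. indicator (W n) x * (cmod (F n x))\<^sup>2)"
        using integrable_mult_indicator[OF fmeasurableD[OF Wm] L2_integrable[OF band_limited_L2[OF F(1)]]] by simp
      show "integrable lebesgue (\<lambda>x. indicator (W n) x * \<kappa>)"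
        using Wm by (intro integrable_mult_left integrable_real_indicator) (auto simp: fmeasurable_def)
    qed (use lt in \<open>auto intro: mult_left_mono\<close>)
    also have "\<dots> = \<Lambda> / 2" using Ws s by (simp add: \<kappa>_def)
    finally have "energy (W n) (F n) \<le> \<Lambda> / 2" .
    moreover have "\<Lambda> / 2 * (1 / real (Suc n)) \<le> \<Lambda> / 2 * 1" using \<Lambda> by (intro mult_left_mono) auto
    ultimately show False using W(2)[of n] F(3)[of n] by simp
  qed
  then obtain a where a: "\<And>n. \<kappa> \<le> (cmod (F n (a n)))\<^sup>2" by metis
  \<comment> \<open>Moving a point where the modulus is large to 0 lets pointwise convergence at 0
    keep the limit from vanishing.\<close>
  define H where "H n = (\<lambda>x. F n (x + a n))" for n
  define V where "V n = (+) (- a n) ` W n" for n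
  have H: "H n \<in> band_limited" "norm2 lebesgue (H n) = 1" "energy (V n) (H n) = first_eigenvalue (W n)"
    "\<kappa> \<le> (cmod (H n 0))\<^sup>2" for n
    unfolding H_def V_def using band_limited_translate[OF F(1)] translate_energy[OF band_limited_L2[OF F(1)]] F a by auto
  have V: "V n \<in> A" for n
    using W(1)[of n] measurable_translation[of "W n" "- a n"] measure_translation[of "- a n" "W n"]
    by (auto simp: A_def V_def)
  obtain r G where r: "strict_mono r" and G: "G \<in> band_limited" "norm2 lebesgue G \<le> 1"
    and lim: "\<And>x. (\<lambda>n. H (r n) x) \<longlonglongrightarrow> G x"
    by (rule band_limited_compact[of H 1, OF H(1) eq_refl[OF H(2)]]) blast
  have "(\<lambda>n. (cmod (H (r n) 0))\<^sup>2) \<longlonglongrightarrow> (cmod (G 0))\<^sup>2" by (intro tendsto_intros lim)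
  then have "\<kappa> \<le> (cmod (G 0))\<^sup>2" by (rule LIMSEQ_le_const) (use H(4) in auto)
  then have "norm2 lebesgue G \<noteq> 0" using band_limited_bounded[OF G(1), of 0] \<kappa> by auto
  then obtain c where c: "c > 0" "measure lebesgue (superlevel G c) = s"
    using superlevel_measure_attained[OF G(1) _ s] by blast
  define T where "T = superlevel G c"
  have T: "T \<in> A" unfolding A_def T_def using c superlevel_open_bounded(3)[OF G(1) c(1)] by simp
  note G2 = band_limited_L2[OF G(1)]
  define R where "R n = (\<lambda>x. H (r n) x - G x)" for n
  note H2 = band_limited_L2[OF H(1)]
  have R: "R n \<in> paley_wiener" for n
    unfolding R_def by (intro paley_wiener_diff band_limited_paley_wiener H G)
  note R2 = paley_wiener_L2[OF R]
  \<comment> \<open>One bound for the cross terms on all sets at once, as the sets vary with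
    n.\<close>
  define \<delta> where "\<delta> n = (\<integral>x. cmod (R n x) * cmod (G x) \<partial>lebesgue)" for n
  have inner_le: "\<bar>Re (inner2 lebesgue (\<lambda>x. indicator S x * G x) (R n))\<bar> \<le> \<delta> n" if S: "S \<in> sets lebesgue" for S n
  proof -
    have "cmod (inner2 lebesgue (\<lambda>x. indicator S x * G x) (R n)) \<le> \<delta> n"
      unfolding inner2_def \<delta>_def
    proof (rule Bochner_Integration.integral_norm_bound_integral)
      show "integrable lebesgue (\<lambda>x. indicator S x * G x * cnj (R n x))"
        by (rule L2_mult_cnj[OF L2_restrict[OF G2 S] R2])
      show "integrable lebesgue (\<lambda>x. cmod (R n x) * cmod (G x))"
        using integrable_norm[OF L2_mult[OF R2 G2]] by (simp add: norm_mult)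
      show "cmod (indicator S x * G x * cnj (R n x)) \<le> cmod (R n x) * cmod (G x)" for x
        by (auto simp: norm_mult indicator_def)
    qed
    then show ?thesis using abs_Re_le_cmod order.trans by blast
  qed
  have HR: "H (r n) = (\<lambda>x. G x + R n x)" for n by (auto simp: R_def)
  \<comment> \<open>The splitting of the norm is the case of the whole line.\<close>
  have nR: "norm2 lebesgue (R n) \<le> 1 - norm2 lebesgue G + 2 * \<delta> n" for n
  proof -
    have "1 = norm2 lebesgue (\<lambda>x. G x + R n x)" using H(2)[of "r n"] unfolding HR by simp
    also have "\<dots> = norm2 lebesgue G + norm2 lebesgue (R n) + 2 * Re (inner2 lebesgue G (R n))"
      by (rule norm2_add[OF G2 R2])
    finally show ?thesis using inner_le[of UNIV n] by simp
  qed
  have "\<delta> \<longlonglongrightarrow> 0"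
    unfolding \<delta>_def
  proof (rule L2_product_tendsto_0[OF R2 G2])
    show "AE x in lebesgue. (\<lambda>n. R n x) \<longlonglongrightarrow> 0"
      unfolding R_def using lim by (intro AE_I2 LIM_zero)
    show "norm2 lebesgue (R n) \<le> 4" for n
    proof -
      have "norm2 lebesgue (R n) + norm2 lebesgue (\<lambda>x. H (r n) x + G x) = 2 * norm2 lebesgue (H (r n)) + 2 * norm2 lebesgue G"
        unfolding R_def norm2_diff[OF H2 G2] norm2_add[OF H2 G2] by simp
      then show ?thesis using H(2)[of "r n"] G(2) norm2_nonneg[of lebesgue "\<lambda>x. H (r n) x + G x"] by linarith
    qed
  qed
  then have rhs: "(\<lambda>n. energy T G + \<Lambda> * (1 - norm2 lebesgue G + 2 * \<delta> n) + 2 * \<delta> n) \<longlonglongrightarrow>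
      energy T G + \<Lambda> * (1 - norm2 lebesgue G + 2 * 0) + 2 * 0" by (intro tendsto_intros)
  have lhs: "(\<lambda>n. \<Lambda> - \<Lambda> / 2 * (1 / real (Suc (r n)))) \<longlonglongrightarrow> \<Lambda> - \<Lambda> / 2 * 0"
    using LIMSEQ_subseq_LIMSEQ[OF LIMSEQ_inverse_real_of_nat r]
    by (intro tendsto_intros) (simp add: o_def inverse_eq_divide)
  have "\<Lambda> - \<Lambda> / 2 * (1 / real (Suc (r n))) \<le> energy T G + \<Lambda> * (1 - norm2 lebesgue G + 2 * \<delta> n) + 2 * \<delta> n" for n
  proof -
    let ?V = "V (r n)"
    have Vm: "?V \<in> lmeasurable" "?V \<in> sets lebesgue" using pos(1)[OF V] fmeasurableD by blast+
    have "\<Lambda> - \<Lambda> / 2 * (1 / real (Suc (r n))) \<le> energy ?V (H (r n))" using W(2)[of "r n"] H(3)[of "r n"] by simp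
    also have "\<dots> = energy ?V G + energy ?V (R n) + 2 * Re (inner2 lebesgue (\<lambda>x. indicator ?V x * G x) (R n))"
      unfolding HR by (rule energy_add[OF G2 R2 Vm(2)])
    also have "\<dots> \<le> energy T G + \<Lambda> * (1 - norm2 lebesgue G + 2 * \<delta> n) + 2 * \<delta> n"
    proof (intro add_mono)
      \<comment> \<open>Both sets have measure s, so the moving set may be exchanged for the fixed
        set T.\<close>
      show "energy ?V G \<le> energy T G"
        unfolding T_def using bathtub(1)[OF G2 _ Vm(1)] T V[of "r n"] by (simp add: A_def T_def)
      \<comment> \<open>The remainder is tested on a competitor of measure s, whose eigenvalue is at
        most \<Lambda>.\<close>
      have "energy ?V (R n) \<le> first_eigenvalue ?V * norm2 lebesgue (R n)"
        using first_eigenvalue_maximizer[OF pos[OF V]] R by metis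
      also have "\<dots> \<le> \<Lambda> * norm2 lebesgue (R n)" by (intro mult_right_mono upper V norm2_nonneg)
      also have "\<dots> \<le> \<Lambda> * (1 - norm2 lebesgue G + 2 * \<delta> n)" using \<Lambda> by (intro mult_left_mono nR) auto
      finally show "energy ?V (R n) \<le> \<Lambda> * (1 - norm2 lebesgue G + 2 * \<delta> n)" .
      show "2 * Re (inner2 lebesgue (\<lambda>x. indicator ?V x * G x) (R n)) \<le> 2 * \<delta> n"
        using inner_le[OF Vm(2), of n] by linarith
    qed
    finally show ?thesis .
  qed
  then have "\<Lambda> - \<Lambda> / 2 * 0 \<le> energy T G + \<Lambda> * (1 - norm2 lebesgue G + 2 * 0) + 2 * 0"
    by (intro LIMSEQ_le[OF lhs rhs]) auto
  then have "\<Lambda> * norm2 lebesgue G \<le> energy T G" by (simp add: algebra_simps)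
  also have "\<dots> \<le> first_eigenvalue T * norm2 lebesgue G"
    using first_eigenvalue_maximizer[OF pos[OF T]] band_limited_paley_wiener[OF G(1)] by metis
  finally have "\<Lambda> \<le> first_eigenvalue T"
    using \<open>norm2 lebesgue G \<noteq> 0\<close> norm2_nonneg[of lebesgue G] by (simp add: mult_le_cancel_right)
  then have "maximizes_first_eigenvalue s T"
    unfolding maximizes_first_eigenvalue_def using T upper by (force simp: A_def)
  then show ?thesis by blast
qed

text \<open>Optimality closes the chain energy T F \<le> eigenvalue of T \<le> eigenvalue of
  \<Omega> = energy \<Omega> F against the bathtub inequality, so its equality case applies.\<close>

lemma maximizer_finite_union:
  assumes s: "s > 0" and \<Omega>: "maximizes_first_eigenvalue s \<Omega>"
  shows "\<exists>\<I>. finite \<I> \<and> (\<forall>I\<in>\<I>. is_interval I) \<and> sym_diff \<Omega> (\<Union>\<I>) \<in> null_sets lebesgue"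
proof -
  have \<Omega>m: "\<Omega> \<in> lmeasurable" and \<Omega>s: "measure lebesgue \<Omega> = s"
    and max: "\<And>\<Omega>'. \<Omega>' \<in> lmeasurable \<Longrightarrow> measure lebesgue \<Omega>' = s \<Longrightarrow> first_eigenvalue \<Omega>' \<le> first_eigenvalue \<Omega>"
    using \<Omega> by (auto simp: maximizes_first_eigenvalue_def)
  obtain F where F: "F \<in> band_limited" "norm2 lebesgue F = 1" "energy \<Omega> F = first_eigenvalue \<Omega>"
    using first_eigenvalue_maximizer[OF \<Omega>m] \<Omega>s s by metis
  obtain c where c: "c > 0" "measure lebesgue (superlevel F c) = s"
    using superlevel_measure_attained[OF F(1) _ s] F(2) by auto
  define T where "T = superlevel F c"
  have T: "T \<in> lmeasurable" "measure lebesgue T = s"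
    using superlevel_open_bounded(3)[OF F(1) c(1)] c(2) by (auto simp: T_def)
  have "energy T F \<le> first_eigenvalue T * norm2 lebesgue F"
    using first_eigenvalue_maximizer[OF T(1)] T(2) s band_limited_paley_wiener[OF F(1)] by metis
  also have "\<dots> \<le> energy \<Omega> F" using max[OF T] F by simp
  \<comment> \<open>The bathtub principle leaves the level set undetermined; that set is null for a
    band-limited function.\<close>
  finally have "AE x in lebesgue. (x \<in> \<Omega> \<longleftrightarrow> x \<in> T) \<or> (cmod (F x))\<^sup>2 = c"
    using bathtub(2)[OF band_limited_L2[OF F(1)] _ \<Omega>m, of c] T \<Omega>s by (simp add: T_def)
  then have "AE x in lebesgue. x \<notin> sym_diff \<Omega> T"
    using level_set_null[OF F(1) c(1)] by eventually_elim auto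
  moreover have "sym_diff \<Omega> T \<in> sets lebesgue" using \<Omega>m T(1) by (intro sets.Un sets.Diff fmeasurableD)
  ultimately have "sym_diff \<Omega> T \<in> null_sets lebesgue" using AE_iff_null_sets by blast
  then show ?thesis using superlevel_intervals[OF F(1) c(1)] unfolding T_def by metis
qed

theorem theorem1p3:
  fixes s :: real
  assumes "s > 0"
  shows "(\<exists>\<Omega>. maximizes_first_eigenvalue s \<Omega>) \<and>
    (\<forall>\<Omega>. maximizes_first_eigenvalue s \<Omega> \<longrightarrow>
      (\<exists>\<I>. finite \<I> \<and> (\<forall>I\<in>\<I>. is_interval I) \<and>
           sym_diff \<Omega> (\<Union>\<I>) \<in> null_sets lebesgue))"
  using maximizer_exists[OF assms] maximizer_finite_union[OF assms] by blast

end
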